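(* Consider the viscous-capillary $p$-system $$v_t-u_x=\varepsilon_1v_{xx},\qquad u_t+p(v)_x=\varepsilon_2u_{xx},$$ with constants $\varepsilon_1,\varepsilon_2>0$ and $p\in C^2$ nonmonotone. Its nonconstant periodic traveling waves are stationary, and are periodic orbits of the planar Hamiltonian system $$\varepsilon_1v'=-(u-u_-),\qquad \varepsilon_2u'=p(v)-p(v_-),\tag{$*$}$$ for some rest point $(v_-,u_-)$, with $p'(v_-)\neq0$. (a) Periodic orbits are spectrally unstable whenever $dT/da>0$; in particular, they are spectrally unstable in the large-amplitude limit as they approach either a bounding homoclinic orbit or a bounding heteroclinic two-cycle of $( * )$. (b) Periodic orbits for which $dT/da<0$ are spectrally unstable if the spectrum of $(\partial\bar U_m/\partial U_-)^{-1}df(U_-)$ is nonreal (the inverse being assumed to exist), where $df(U_-)=\begin{pmatrix} 0 & -1 \\ {p'(v_-)} & 0 \end{pmatrix}$. (c) In the small-amplitude limit as orbits approach a nonlinear center, they are spectrally unstable regardless of the value of $\operatorname{sgn}dT/da$.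
   Context: Write $U=(v,u)$, $f(U)=(-u,p(v))$, $B=\operatorname{diag}(\varepsilon_1,\varepsilon_2)$, $U_-=(v_-,u_-)$, so the system is $U_t+f(U)_x=BU_{xx}$ and the traveling-wave ODE with speed $s$ is $BU'=f(U)-f(U_-)-s(U-U_-)$. Spectral instability of a $T$-periodic stationary solution $\bar U$ means that the linearized operator $LV=BV_{xx}-(df(\bar U(x))V)_x$, acting on $L^p(\mathbb R)$, has spectrum meeting $\{\operatorname{Re}\lambda>0\}$. Amplitude and period: with $U_-$ fixed and $s=0$, the system is Hamiltonian and each periodic orbit lies in a one-parameter family of nearby periodic orbits, parametrized by amplitude $a$, measured along a curve in the direction of the outward normal to the orbit (increasing outward); $T(a)$ is the period, and $dT/da$ is evaluated at the given orbit. Mass derivative: for a given orbit $\bar U$ with period $T$ and $dT/da\ne0$, let $\bar U^{(U_-,U_0,s)}$ solve $BU'=f(U)-f(U_-)-s(U-U_-)$, $U(0)=U_0$. In coordinates of $U$-space in which $\bar U'(0)$ is the first basis vector, the parameters $(U_-,U_0,s)$ near the base values for which $\bar U^{(U_-,U_0,s)}(T)=U_0$ form a surface parametrized by $U_-$ and the first component $U_0^1$ of $U_0$ (the case $dT/da\neq 0$ guarantees this by the Implicit Function Theorem). On it set $\bar U_m=\int_0^T\bar U^{(U_-,U_0,s)}(y)\,dy$ (independent of $U_0^1$); $\partial\bar U_m/\partial U_-$ is its $2\times 2$ derivative with respect to $U_-$ at the base point, with $U_0^1$ fixed. "In the large-amplitude limit" means: for a nested one-parameter family of periodic orbits of $(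 * )$ (fixed $U_-$) bounded by a homoclinic orbit, or by a two-cycle (two heteroclinic orbits joining two rest points in both directions), with nondegenerate (hyperbolic) saddle vertices, the statement holds for all orbits sufficiently close to the bounding cycle. "In the small-amplitude limit" means: for a one-parameter family of periodic orbits shrinking to a nonlinear center, i.e. a rest point at which the linearization of $( * )$ has nonzero pure imaginary eigenvalues, the statement holds for all orbits sufficiently close to the center. *)

theory Defs
  imports "HOL-Analysis.Analysis"
begin

text \<open>States are \<open>U = (v, u)\<close>, so \<open>U $ 1\<close> is \<open>v\<close> and \<open>U $ 2\<close> is \<open>u\<close>.\<close>

definition C2_fun :: "(real \<Rightarrow> real) \<Rightarrow> bool" where
  "C2_fun p \<longleftrightarrow> (\<forall>x. p differentiable at x) \<and> (\<forall>x. deriv p differentiable at x)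
     \<and> continuous_on UNIV (deriv (deriv p))"

definition flux :: "(real \<Rightarrow> real) \<Rightarrow> real^2 \<Rightarrow> real^2" where
  "flux p U = vector [- (U $ 2), p (U $ 1)]"

definition dflux :: "(real \<Rightarrow> real) \<Rightarrow> real^2 \<Rightarrow> real^2^2" where
  "dflux p U = vector [vector [0, -1], vector [deriv p (U $ 1), 0]]"

definition visc :: "real \<Rightarrow> real \<Rightarrow> real^2^2" where
  "visc \<epsilon>1 \<epsilon>2 = vector [vector [\<epsilon>1, 0], vector [0, \<epsilon>2]]"

definition psystem_solution ::
  "real \<Rightarrow> real \<Rightarrow> (real \<Rightarrow> real) \<Rightarrow> (real \<Rightarrow> real \<Rightarrow> real) \<Rightarrow> (real \<Rightarrow> real \<Rightarrow> real) \<Rightarrow> bool" where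
  "psystem_solution \<epsilon>1 \<epsilon>2 p v u \<longleftrightarrow>
     (\<exists>vx ux. \<forall>x t.
        ((\<lambda>y. v y t) has_real_derivative vx x t) (at x) \<and>
        ((\<lambda>y. u y t) has_real_derivative ux x t) (at x) \<and>
        (\<exists>vt ut px vxx uxx.
           ((\<lambda>\<tau>. v x \<tau>) has_real_derivative vt) (at t) \<and>
           ((\<lambda>\<tau>. u x \<tau>) has_real_derivative ut) (at t) \<and>
           ((\<lambda>y. p (v y t)) has_real_derivative px) (at x) \<and>
           ((\<lambda>y. vx y t) has_real_derivative vxx) (at x) \<and>
           ((\<lambda>y. ux y t) has_real_derivative uxx) (at x) \<and>
           vt - ux x t = \<epsilon>1 * vxx \<and> ut + px = \<epsilon>2 * uxx))"

definition traveling_wave ::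
  "real \<Rightarrow> real \<Rightarrow> (real \<Rightarrow> real) \<Rightarrow> real \<Rightarrow> (real \<Rightarrow> real^2) \<Rightarrow> bool" where
  "traveling_wave \<epsilon>1 \<epsilon>2 p s U \<longleftrightarrow>
     psystem_solution \<epsilon>1 \<epsilon>2 p (\<lambda>x t. U (x - s * t) $ 1) (\<lambda>x t. U (x - s * t) $ 2)"

definition profile_ode ::
  "real \<Rightarrow> real \<Rightarrow> (real \<Rightarrow> real) \<Rightarrow> real^2 \<Rightarrow> real \<Rightarrow> (real \<Rightarrow> real^2) \<Rightarrow> bool" where
  "profile_ode \<epsilon>1 \<epsilon>2 p Um s U \<longleftrightarrow>
     (\<forall>x. \<exists>D. (U has_vector_derivative D) (at x) \<and>
        visc \<epsilon>1 \<epsilon>2 *v D = flux p (U x) - flux p Um - s *\<^sub>R (U x - Um))"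

text \<open>The vector field of the stationary (\<open>s = 0\<close>) profile system, solved for \<open>U'\<close>.\<close>

definition stat_field :: "real \<Rightarrow> real \<Rightarrow> (real \<Rightarrow> real) \<Rightarrow> real^2 \<Rightarrow> real^2 \<Rightarrow> real^2" where
  "stat_field \<epsilon>1 \<epsilon>2 p Um V = matrix_inv (visc \<epsilon>1 \<epsilon>2) *v (flux p V - flux p Um)"

text \<open>\<open>v' = - H\<^sub>u\<close>, \<open>u' = H\<^sub>v\<close>.\<close>

definition hamiltonian_field :: "(real^2 \<Rightarrow> real^2) \<Rightarrow> bool" where
  "hamiltonian_field F \<longleftrightarrow>
     (\<exists>H::real^2 \<Rightarrow> real. \<forall>V. (H has_derivative (\<lambda>h. F V $ 2 * h $ 1 - F V $ 1 * h $ 2)) (at V))"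

text \<open>\<open>T\<close> is the minimal period; its existence forces the solution to be nonconstant.\<close>

definition periodic_orbit ::
  "real \<Rightarrow> real \<Rightarrow> (real \<Rightarrow> real) \<Rightarrow> real^2 \<Rightarrow> (real \<Rightarrow> real^2) \<Rightarrow> real \<Rightarrow> bool" where
  "periodic_orbit \<epsilon>1 \<epsilon>2 p Um U T \<longleftrightarrow>
     profile_ode \<epsilon>1 \<epsilon>2 p Um 0 U \<and> 0 < T \<and> (\<forall>x. U (x + T) = U x) \<and>
     (\<forall>\<tau>. 0 < \<tau> \<and> \<tau> < T \<longrightarrow> (\<exists>x. U (x + \<tau>) \<noteq> U x))"

text \<open>\<open>L\<^sup>q(\<real>; \<complex>\<^sup>2)\<close> for \<open>1 \<le> q \<le> \<infinity>\<close>, as Borel functions up to almost everywhere equality.\<close>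

definition Lq :: "ennreal \<Rightarrow> (real \<Rightarrow> complex^2) \<Rightarrow> bool" where
  "Lq q g \<longleftrightarrow> g \<in> borel_measurable lborel \<and>
     (if q = \<infinity> then \<exists>C. AE x in lborel. norm (g x) \<le> C
      else integrable lborel (\<lambda>x. norm (g x) powr enn2real q))"

definition Lq_norm :: "ennreal \<Rightarrow> (real \<Rightarrow> complex^2) \<Rightarrow> real" where
  "Lq_norm q g =
     (if q = \<infinity> then Inf {C. 0 \<le> C \<and> (AE x in lborel. norm (g x) \<le> C)}
      else (\<integral>x. norm (g x) powr enn2real q \<partial>lborel) powr (1 / enn2real q))"

text \<open>\<open>V\<close> is the \<open>C\<^sup>1\<close> representative of a class in \<open>W\<^sup>2\<^sup>,\<^sup>q\<close>, with first derivative \<open>V1\<close> and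
  weak second derivative \<open>V2\<close> (which is unique almost everywhere). Using this representative,
  equality in the domain of the operator is equality of functions.\<close>

definition sobolev2 ::
  "ennreal \<Rightarrow> (real \<Rightarrow> complex^2) \<Rightarrow> (real \<Rightarrow> complex^2) \<Rightarrow> (real \<Rightarrow> complex^2) \<Rightarrow> bool" where
  "sobolev2 q V V1 V2 \<longleftrightarrow> Lq q V \<and> Lq q V1 \<and> Lq q V2 \<and>
     (\<forall>x. (V has_vector_derivative V1 x) (at x)) \<and>
     (\<forall>a b. a \<le> b \<longrightarrow> (V2 has_integral (V1 b - V1 a)) {a..b})"

definition cmat :: "real^2^2 \<Rightarrow> complex^2^2" where
  "cmat M = (\<chi> i j. complex_of_real (M $ i $ j))"

text \<open>\<open>L V = B V\<^sub>x\<^sub>x - (df(U) V)\<^sub>x\<close>; the second derivative \<open>V2\<close> of \<open>V\<close> is passed separately.\<close>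

definition lin_op ::
  "real \<Rightarrow> real \<Rightarrow> (real \<Rightarrow> real) \<Rightarrow> (real \<Rightarrow> real^2) \<Rightarrow>
   (real \<Rightarrow> complex^2) \<Rightarrow> (real \<Rightarrow> complex^2) \<Rightarrow> real \<Rightarrow> complex^2" where
  "lin_op \<epsilon>1 \<epsilon>2 p U V V2 x =
     cmat (visc \<epsilon>1 \<epsilon>2) *v V2 x
     - vector_derivative (\<lambda>y. cmat (dflux p (U y)) *v V y) (at x)"

definition resolvent_solution ::
  "real \<Rightarrow> real \<Rightarrow> (real \<Rightarrow> real) \<Rightarrow> (real \<Rightarrow> real^2) \<Rightarrow> ennreal \<Rightarrow> complex \<Rightarrow>
   (real \<Rightarrow> complex^2) \<Rightarrow> (real \<Rightarrow> complex^2) \<Rightarrow> bool" where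
  "resolvent_solution \<epsilon>1 \<epsilon>2 p U q \<mu> g V \<longleftrightarrow>
     (\<exists>V1 V2. sobolev2 q V V1 V2 \<and>
        (AE x in lborel. \<mu> *s V x - lin_op \<epsilon>1 \<epsilon>2 p U V V2 x = g x))"

text \<open>The complement of the resolvent set, the latter consisting of those \<open>\<mu>\<close> for which
  \<open>\<mu> - L\<close> maps \<open>W\<^sup>2\<^sup>,\<^sup>q\<close> bijectively onto \<open>L\<^sup>q\<close> with bounded inverse.\<close>

definition lin_spectrum ::
  "real \<Rightarrow> real \<Rightarrow> (real \<Rightarrow> real) \<Rightarrow> (real \<Rightarrow> real^2) \<Rightarrow> ennreal \<Rightarrow> complex set" where
  "lin_spectrum \<epsilon>1 \<epsilon>2 p U q = - {\<mu>. \<exists>C. \<forall>g. Lq q g \<longrightarrow>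
     (\<exists>!V. resolvent_solution \<epsilon>1 \<epsilon>2 p U q \<mu> g V) \<and>
     (\<forall>V. resolvent_solution \<epsilon>1 \<epsilon>2 p U q \<mu> g V \<longrightarrow> Lq_norm q V \<le> C * Lq_norm q g)}"

definition spectrally_unstable ::
  "real \<Rightarrow> real \<Rightarrow> (real \<Rightarrow> real) \<Rightarrow> (real \<Rightarrow> real^2) \<Rightarrow> bool" where
  "spectrally_unstable \<epsilon>1 \<epsilon>2 p U \<longleftrightarrow>
     (\<forall>q\<ge>1. \<exists>\<mu> \<in> lin_spectrum \<epsilon>1 \<epsilon>2 p U q. 0 < Re \<mu>)"

text \<open>\<open>d = dT/da\<close>, where \<open>T a\<close> is the period of the orbit through the point at signed distance
  \<open>a\<close> from \<open>U 0\<close> on the line in the direction of the outward unit normal \<open>\<nu>\<close>.\<close>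

definition has_period_deriv ::
  "real \<Rightarrow> real \<Rightarrow> (real \<Rightarrow> real) \<Rightarrow> real^2 \<Rightarrow> (real \<Rightarrow> real^2) \<Rightarrow> real \<Rightarrow> bool" where
  "has_period_deriv \<epsilon>1 \<epsilon>2 p Um U d \<longleftrightarrow>
     (\<exists>\<nu> T. norm \<nu> = 1 \<and> \<nu> \<bullet> vector_derivative U (at 0) = 0 \<and>
        (\<forall>\<^sub>F a in at_right 0. U 0 + a *\<^sub>R \<nu> \<in> outside (range U)) \<and>
        (\<forall>\<^sub>F a in nhds 0. \<exists>W. periodic_orbit \<epsilon>1 \<epsilon>2 p Um W (T a) \<and> W 0 = U 0 + a *\<^sub>R \<nu>) \<and>
        (T has_real_derivative d) (at 0))"

text \<open>\<open>M\<close> is the derivative of the mass with respect to \<open>U\<^sub>-\<close>. In the basis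
  \<open>e = U'(0)\<close>, \<open>w\<close> of the state space, initial data are written \<open>\<alpha> e + \<beta> w\<close>. The surface of parameters
  \<open>(Z, \<alpha> e + \<beta> w, s)\<close> near \<open>(Um, U 0, 0)\<close> whose solution closes up after the fixed time \<open>T\<close> is
  the graph \<open>\<beta> = \<beta>(Z, \<alpha>)\<close>, \<open>s = \<sigma>(Z, \<alpha>)\<close>; continuity of \<open>\<beta>\<close> and \<open>\<sigma>\<close> selects the branch
  through the base point. The derivative is taken with \<open>\<alpha> = \<alpha>0\<close> fixed.\<close>

definition has_mass_deriv ::
  "real \<Rightarrow> real \<Rightarrow> (real \<Rightarrow> real) \<Rightarrow> real^2 \<Rightarrow> (real \<Rightarrow> real^2) \<Rightarrow> real \<Rightarrow> real^2^2 \<Rightarrow> bool" where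
  "has_mass_deriv \<epsilon>1 \<epsilon>2 p Um U T M \<longleftrightarrow>
     (\<exists>e w \<alpha>0 N \<beta> \<sigma> W.
        (U has_vector_derivative e) (at 0) \<and> e \<noteq> w \<and> independent {e, w} \<and>
        open N \<and> (Um, \<alpha>0) \<in> N \<and>
        continuous_on N \<beta> \<and> continuous_on N \<sigma> \<and>
        U 0 = \<alpha>0 *\<^sub>R e + \<beta> (Um, \<alpha>0) *\<^sub>R w \<and> \<sigma> (Um, \<alpha>0) = (0::real) \<and>
        (\<forall>(Z, \<alpha>) \<in> N.
           profile_ode \<epsilon>1 \<epsilon>2 p Z (\<sigma> (Z, \<alpha>)) (W (Z, \<alpha>)) \<and>
           W (Z, \<alpha>) 0 = \<alpha> *\<^sub>R e + \<beta> (Z, \<alpha>) *\<^sub>R w \<and>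
           W (Z, \<alpha>) T = W (Z, \<alpha>) 0) \<and>
        ((\<lambda>Z. integral {0..T} (W (Z, \<alpha>0))) has_derivative (\<lambda>h. M *v h)) (at Um))"

definition eigvals :: "real^2^2 \<Rightarrow> complex set" where
  "eigvals M = {\<mu>. \<exists>z. z \<noteq> 0 \<and> cmat M *v z = \<mu> *s z}"

definition rest_point :: "real \<Rightarrow> real \<Rightarrow> (real \<Rightarrow> real) \<Rightarrow> real^2 \<Rightarrow> real^2 \<Rightarrow> bool" where
  "rest_point \<epsilon>1 \<epsilon>2 p Um R \<longleftrightarrow> stat_field \<epsilon>1 \<epsilon>2 p Um R = 0"

definition stat_linearization :: "real \<Rightarrow> real \<Rightarrow> (real \<Rightarrow> real) \<Rightarrow> real^2 \<Rightarrow> real^2^2" where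
  "stat_linearization \<epsilon>1 \<epsilon>2 p R = matrix_inv (visc \<epsilon>1 \<epsilon>2) ** dflux p R"

definition hyperbolic_saddle :: "real \<Rightarrow> real \<Rightarrow> (real \<Rightarrow> real) \<Rightarrow> real^2 \<Rightarrow> real^2 \<Rightarrow> bool" where
  "hyperbolic_saddle \<epsilon>1 \<epsilon>2 p Um R \<longleftrightarrow> rest_point \<epsilon>1 \<epsilon>2 p Um R \<and>
     (\<exists>a b. a < 0 \<and> 0 < b \<and>
        eigvals (stat_linearization \<epsilon>1 \<epsilon>2 p R) = {complex_of_real a, complex_of_real b})"

definition nonlinear_center :: "real \<Rightarrow> real \<Rightarrow> (real \<Rightarrow> real) \<Rightarrow> real^2 \<Rightarrow> real^2 \<Rightarrow> bool" where
  "nonlinear_center \<epsilon>1 \<epsilon>2 p Um R \<longleftrightarrow> rest_point \<epsilon>1 \<epsilon>2 p Um R \<and>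
     (\<forall>\<mu> \<in> eigvals (stat_linearization \<epsilon>1 \<epsilon>2 p R). Re \<mu> = 0 \<and> \<mu> \<noteq> 0)"

definition connecting_orbit ::
  "real \<Rightarrow> real \<Rightarrow> (real \<Rightarrow> real) \<Rightarrow> real^2 \<Rightarrow> real^2 \<Rightarrow> real^2 \<Rightarrow> (real \<Rightarrow> real^2) \<Rightarrow> bool" where
  "connecting_orbit \<epsilon>1 \<epsilon>2 p Um R S W \<longleftrightarrow> profile_ode \<epsilon>1 \<epsilon>2 p Um 0 W \<and>
     (\<exists>x. W x \<noteq> W 0) \<and> (W \<longlongrightarrow> R) at_bot \<and> (W \<longlongrightarrow> S) at_top"

definition homoclinic_cycle ::
  "real \<Rightarrow> real \<Rightarrow> (real \<Rightarrow> real) \<Rightarrow> real^2 \<Rightarrow> (real^2) set \<Rightarrow> bool" where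
  "homoclinic_cycle \<epsilon>1 \<epsilon>2 p Um \<Gamma> \<longleftrightarrow>
     (\<exists>R W. hyperbolic_saddle \<epsilon>1 \<epsilon>2 p Um R \<and> connecting_orbit \<epsilon>1 \<epsilon>2 p Um R R W \<and>
        \<Gamma> = {R} \<union> range W)"

definition heteroclinic_two_cycle ::
  "real \<Rightarrow> real \<Rightarrow> (real \<Rightarrow> real) \<Rightarrow> real^2 \<Rightarrow> (real^2) set \<Rightarrow> bool" where
  "heteroclinic_two_cycle \<epsilon>1 \<epsilon>2 p Um \<Gamma> \<longleftrightarrow>
     (\<exists>R S W W'. R \<noteq> S \<and>
        hyperbolic_saddle \<epsilon>1 \<epsilon>2 p Um R \<and> hyperbolic_saddle \<epsilon>1 \<epsilon>2 p Um S \<and>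
        connecting_orbit \<epsilon>1 \<epsilon>2 p Um R S W \<and> connecting_orbit \<epsilon>1 \<epsilon>2 p Um S R W' \<and>
        \<Gamma> = {R, S} \<union> range W \<union> range W')"

definition hausdorff_close :: "real \<Rightarrow> (real^2) set \<Rightarrow> (real^2) set \<Rightarrow> bool" where
  "hausdorff_close \<delta> A B \<longleftrightarrow>
     (\<forall>x\<in>A. \<exists>y\<in>B. dist x y < \<delta>) \<and> (\<forall>y\<in>B. \<exists>x\<in>A. dist x y < \<delta>)"

text \<open>A one-parameter family of periodic orbits (profiles \<open>W a\<close> with periods \<open>\<tau> a\<close>, \<open>a\<close> in a
  nonempty open interval), nested increasingly in \<open>a\<close> and bounded by \<open>\<Gamma>\<close>, which it approaches at
  the upper end of the parameter interval.\<close>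

definition nested_family_bounded_by ::
  "real \<Rightarrow> real \<Rightarrow> (real \<Rightarrow> real) \<Rightarrow> real^2 \<Rightarrow> (real^2) set \<Rightarrow> real \<Rightarrow> real \<Rightarrow>
   (real \<Rightarrow> real \<Rightarrow> real^2) \<Rightarrow> (real \<Rightarrow> real) \<Rightarrow> bool" where
  "nested_family_bounded_by \<epsilon>1 \<epsilon>2 p Um \<Gamma> l r W \<tau> \<longleftrightarrow> l < r \<and>
     (\<forall>a\<in>{l<..<r}. periodic_orbit \<epsilon>1 \<epsilon>2 p Um (W a) (\<tau> a) \<and> range (W a) \<subseteq> inside \<Gamma>) \<and>
     (\<forall>a\<in>{l<..<r}. \<forall>b\<in>{l<..<r}. a < b \<longrightarrow> range (W a) \<subseteq> inside (range (W b))) \<and>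
     (\<forall>\<delta>>0. \<forall>\<^sub>F a in at_left r. hausdorff_close \<delta> (range (W a)) \<Gamma>)"

definition family_shrinking_to ::
  "real \<Rightarrow> real \<Rightarrow> (real \<Rightarrow> real) \<Rightarrow> real^2 \<Rightarrow> real^2 \<Rightarrow> real \<Rightarrow> real \<Rightarrow>
   (real \<Rightarrow> real \<Rightarrow> real^2) \<Rightarrow> (real \<Rightarrow> real) \<Rightarrow> bool" where
  "family_shrinking_to \<epsilon>1 \<epsilon>2 p Um R l r W \<tau> \<longleftrightarrow> l < r \<and>
     (\<forall>a\<in>{l<..<r}. periodic_orbit \<epsilon>1 \<epsilon>2 p Um (W a) (\<tau> a)) \<and>
     (\<forall>\<delta>>0. \<forall>\<^sub>F a in at_right l. range (W a) \<subseteq> ball R \<delta>)"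

end

theory Submission
  imports Defs "HOL-Complex_Analysis.Great_Picard"
begin

text \<open>All the instability claims are instances of one fact, \<open>periodic_orbit_spectrally_unstable\<close>:
  every periodic orbit of the profile system is spectrally unstable. The reason is that the
  eigenvalue problem is a damped mechanical system with an unstable potential energy.

  Write the eigenvalue equations \<open>\<mu> v = \<epsilon>1 v'' + u'\<close>, \<open>\<mu> u = \<epsilon>2 u'' - (p'(V) v)'\<close> along the
  orbit with first component \<open>V\<close>, and put \<open>v = w'\<close>. The first equation gives
  \<open>u = \<mu> w - \<epsilon>1 w''\<close>, and the second becomes, with \<open>\<epsilon> = \<epsilon>1 \<epsilon>2\<close>, \<open>c = \<epsilon>1 + \<epsilon>2\<close>, \<open>q = p'(V)\<close>,
  the self-adjoint quadratic pencil
  \<open>\<mu>\<^sup>2 w - \<mu> c w'' + \<epsilon> w'''' + (q w')' = 0\<close>.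
  For real \<open>\<mu> \<ge> 0\<close> its quadratic form increases with \<open>\<mu>\<close>, is nonnegative for large \<open>\<mu>\<close>, and
  at \<open>\<mu> = 0\<close> is the energy \<open>\<integral> \<epsilon> f'\<^sup>2 - q f\<^sup>2\<close> of the Schroedinger operator
  \<open>- \<epsilon> \<partial>\<^sup>2 - q\<close> at \<open>f = w'\<close>. If that energy takes a negative value, then at the supremum
  \<open>\<mu> > 0\<close> of the parameters at which the form takes negative values, the form is nonnegative with
  infimum zero on the unit sphere (\<open>critical_parameter\<close>), and by compactness zero is attained
  (\<open>kernel_from_minimizing_sequence\<close>). The minimizer is an eigenfunction with
  eigenvalue \<open>\<mu> > 0\<close>.

  The energy is negative somewhere because of the wave itself: differentiating the profile equation
  gives \<open>\<epsilon> V''' + q V' = 0\<close>, and \<open>V'\<close>, being the derivative of a periodic function,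
  vanishes at some point \<open>a\<close>. The function that equals \<open>V'\<close> on one period \<open>[a, a + T]\<close> and \<open>- V'\<close>
  on the next has energy zero, but has a corner at \<open>a\<close>, so that it cannot minimize; moving
  slightly off it makes the energy negative (\<open>negative_direction\<close>). This function changes sign
  under the shift by \<open>T\<close>, and the whole variational argument is carried out in the class of such
  antiperiodic functions. There every function has a unique primitive in the same class, no boundary
  terms occur, and \<open>w\<close> can be recovered from \<open>f\<close>.

  An antiperiodic eigenfunction is bounded but not in \<open>L\<^sup>q\<close> for \<open>q < \<infinity>\<close>; cutting it off on long
  intervals shows that \<open>\<mu> - L\<close> has no bounded inverse (\<open>eigenfunction_in_spectrum\<close>).

  The remaining claims concern the waves themselves. A periodic wave of speed \<open>s\<close> has an energy with
  derivative \<open>- s (\<epsilon>1 + \<epsilon>2) v'\<^sup>2\<close>, so periodicity forces \<open>s = 0\<close>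
  (\<open>periodic_wave_stationary\<close>), and the Hamiltonian of the stationary system is the sum
  of a primitive of the pressure term and a quadratic term in \<open>u\<close>.\<close>

section \<open>Antiperiodic functions and their primitives\<close>

text \<open>Continuity is included so that all integrals below exist. Since no nonzero constant is
  antiperiodic, differentiation is injective on the class.\<close>

definition antiperiodic :: "real \<Rightarrow> (real \<Rightarrow> real) \<Rightarrow> bool" where
  "antiperiodic T f \<longleftrightarrow> continuous_on UNIV f \<and> (\<forall>x. f (x + T) = - f x)"

definition prim :: "real \<Rightarrow> (real \<Rightarrow> real) \<Rightarrow> real \<Rightarrow> real" where
  "prim T f = (THE F. antiperiodic T F \<and> (\<forall>x. (F has_real_derivative f x) (at x)))"

text \<open>A product of two antiperiodic functions has period \<open>T\<close>, hence integration over one such period is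
  free of boundary terms under integration by parts.\<close>

definition ip :: "real \<Rightarrow> (real \<Rightarrow> real) \<Rightarrow> (real \<Rightarrow> real) \<Rightarrow> real" where
  "ip T f g = integral {0..T} (\<lambda>x. f x * g x)"

lemma antiperiodic_continuous: "antiperiodic T f \<Longrightarrow> continuous_on A f"
  unfolding antiperiodic_def by (blast intro: continuous_on_subset)

lemma antiperiodic_shift: "antiperiodic T f \<Longrightarrow> f (x + T) = - f x"
  unfolding antiperiodic_def by blast

lemma antiperiodic_lincomb:
  "antiperiodic T f \<Longrightarrow> antiperiodic T g \<Longrightarrow> antiperiodic T (\<lambda>x. a * f x + b * g x)"
  unfolding antiperiodic_def by (auto intro!: continuous_intros simp: algebra_simps)

lemma antiperiodic_mult_periodic:
  "antiperiodic T f \<Longrightarrow> continuous_on UNIV q \<Longrightarrow> (\<And>x. q (x + T) = q x) \<Longrightarrow>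
     antiperiodic T (\<lambda>x. q x * f x)"
  unfolding antiperiodic_def by (auto intro!: continuous_intros)

lemma periodic_int_shift:
  fixes D :: "real \<Rightarrow> 'a" and k :: int
  assumes "\<And>y. D (y + T) = D y"
  shows "D (y + of_int k * T) = D y"
proof -
  have up: "D (y + real n * T) = D y" for y n
  proof (induction n)
    case (Suc n)
    have "y + real (Suc n) * T = (y + real n * T) + T" by (simp add: algebra_simps)
    then show ?case using assms Suc by metis
  qed simp
  show ?thesis
  proof (cases "0 \<le> k")
    case True then show ?thesis using up[of y "nat k"] by simp
  next
    case False then show ?thesis using up[of "y + of_int k * T" "nat (- k)"] by simp
  qed
qed

lemma floor_shift_in_period:
  fixes T x :: real
  assumes "0 < T"
  shows "x - of_int \<lfloor>x / T\<rfloor> * T \<in> {0..T}"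
proof -
  have "of_int \<lfloor>x / T\<rfloor> \<le> x / T" "x / T \<le> of_int \<lfloor>x / T\<rfloor> + 1" by linarith+
  then have "of_int \<lfloor>x / T\<rfloor> * T \<le> x" "x \<le> (of_int \<lfloor>x / T\<rfloor> + 1) * T"
    using assms pos_le_divide_eq pos_divide_le_eq by blast+
  then show ?thesis by (simp add: algebra_simps)
qed

lemma periodic_value_in_period:
  fixes D :: "real \<Rightarrow> 'a"
  assumes "0 < T" "\<And>y. D (y + T) = D y"
  shows "D (x - of_int \<lfloor>x / T\<rfloor> * T) = D x"
  using periodic_int_shift[of D T "x - of_int \<lfloor>x / T\<rfloor> * T" "\<lfloor>x / T\<rfloor>"] assms(2) by simp

lemma antiderivative_on_line:
  fixes f :: "real \<Rightarrow> real"
  assumes "continuous_on UNIV f"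
  obtains F where "\<And>x. (F has_real_derivative f x) (at x)"
proof -
  have "\<exists>F. \<forall>x. -\<infinity> < ereal x \<longrightarrow> ereal x < \<infinity> \<longrightarrow> (F has_vector_derivative f x) (at x)"
    by (rule einterval_antiderivative)
       (use assms in \<open>auto simp: continuous_on_eq_continuous_at\<close>)
  then show ?thesis
    using that by (auto simp: has_real_derivative_iff_has_vector_derivative)
qed

lemma has_real_derivative_imp_continuous_on:
  fixes F f :: "real \<Rightarrow> real"
  shows "(\<And>x. (F has_real_derivative f x) (at x)) \<Longrightarrow> continuous_on A F"
  by (meson DERIV_isCont continuous_at_imp_continuous_on)

lemma has_integral_of_derivative:
  fixes F f :: "real \<Rightarrow> real"
  assumes "\<And>x. (F has_real_derivative f x) (at x)" "a \<le> b"
  shows "(f has_integral (F b - F a)) {a..b}"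
  by (rule fundamental_theorem_of_calculus)
     (use assms in \<open>auto intro: has_field_derivative_at_within
        simp flip: has_real_derivative_iff_has_vector_derivative\<close>)

lemma derivative_periodic:
  fixes f :: "real \<Rightarrow> real"
  assumes "\<And>x. (f has_real_derivative f' x) (at x)" "\<And>x. f (x + T) = f x"
  shows "f' (x + T) = f' x"
proof -
  have "((\<lambda>x. f (x + T)) has_real_derivative f' (x + T)) (at x)"
    using assms(1)[of "x + T"] DERIV_shift by blast
  then show ?thesis using assms by (simp add: DERIV_unique)
qed

lemma antiperiodic_primitive_unique:
  assumes "antiperiodic T F" "\<And>x. (F has_real_derivative f x) (at x)"
    and "antiperiodic T G" "\<And>x. (G has_real_derivative f x) (at x)"
  shows "F = G"
proof -
  have "((\<lambda>x. F x - G x) has_real_derivative 0) (at x)" for x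
    using DERIV_diff[OF assms(2)[of x] assms(4)[of x]] by simp
  then have "F x - G x = F y - G y" for x y
    using DERIV_isconst_all[of "\<lambda>x. F x - G x"] by blast
  from this[of _ "_ + T"] have "F x - G x = - (F x - G x)" for x
    using antiperiodic_shift[OF assms(1)] antiperiodic_shift[OF assms(3)] by (metis minus_diff_minus)
  then show ?thesis by (simp add: fun_eq_iff)
qed

text \<open>If \<open>G\<close> is any primitive, then \<open>G (x + T) + G x\<close> has derivative zero; subtracting half of this
  constant from \<open>G\<close> makes it antiperiodic.\<close>

lemma antiperiodic_primitive_exists:
  assumes "antiperiodic T f"
  shows "\<exists>F. antiperiodic T F \<and> (\<forall>x. (F has_real_derivative f x) (at x))"
proof -
  obtain G where G: "\<And>x. (G has_real_derivative f x) (at x)"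
    using antiderivative_on_line assms antiperiodic_def by blast
  have "((\<lambda>x. G (x + T) + G x) has_real_derivative 0) (at x)" for x
  proof -
    have "((\<lambda>x. G (x + T)) has_real_derivative f (x + T)) (at x)"
      using G[of "x + T"] DERIV_shift by blast
    from DERIV_add[OF this G[of x]] show ?thesis
      using antiperiodic_shift[OF assms] by simp
  qed
  then have c: "G (x + T) + G x = G (0 + T) + G 0" for x
    using DERIV_isconst_all[of "\<lambda>x. G (x + T) + G x"] by blast
  define F where "F x = G x - (G (0 + T) + G 0) / 2" for x
  have D: "(F has_real_derivative f x) (at x)" for x
    unfolding F_def using G by (auto intro!: derivative_eq_intros)
  have "F (x + T) = - F x" for x
    using c[of x] unfolding F_def by (simp add: field_simps)
  with D show ?thesis
    unfolding antiperiodic_def using has_real_derivative_imp_continuous_on by blast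
qed

lemma prim_props:
  assumes "antiperiodic T f"
  shows antiperiodic_prim: "antiperiodic T (prim T f)"
    and has_derivative_prim: "(prim T f has_real_derivative f x) (at x)"
proof -
  have "\<exists>!F. antiperiodic T F \<and> (\<forall>x. (F has_real_derivative f x) (at x))"
    using antiperiodic_primitive_exists[OF assms] antiperiodic_primitive_unique by blast
  from theI'[OF this]
  show "antiperiodic T (prim T f)" "(prim T f has_real_derivative f x) (at x)"
    unfolding prim_def by blast+
qed

lemma prim_eqI:
  assumes "antiperiodic T f" "antiperiodic T F" "\<And>x. (F has_real_derivative f x) (at x)"
  shows "prim T f = F"
  using antiperiodic_primitive_unique assms prim_props by blast

lemma prim_lincomb:
  assumes "antiperiodic T f" "antiperiodic T g"
  shows "prim T (\<lambda>x. a * f x + b * g x) = (\<lambda>x. a * prim T f x + b * prim T g x)"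
  by (rule prim_eqI) (auto intro!: antiperiodic_lincomb derivative_eq_intros assms
       antiperiodic_prim has_derivative_prim)

lemma prim_diff:
  assumes "antiperiodic T f" "antiperiodic T g"
  shows "prim T (\<lambda>x. f x - g x) = (\<lambda>x. prim T f x - prim T g x)"
  using prim_lincomb[OF assms, of 1 "-1"] by simp

lemma antiperiodic_diff:
  "antiperiodic T f \<Longrightarrow> antiperiodic T g \<Longrightarrow> antiperiodic T (\<lambda>x. f x - g x)"
  using antiperiodic_lincomb[of T f g 1 "-1"] by simp

lemma antiperiodic_cmult: "antiperiodic T f \<Longrightarrow> antiperiodic T (\<lambda>x. a * f x)"
  using antiperiodic_lincomb[of T f f a 0] by simp

lemma ip_integrable:
  fixes f g :: "real \<Rightarrow> real"
  shows "antiperiodic T f \<Longrightarrow> antiperiodic T g \<Longrightarrow> (\<lambda>x. f x * g x) integrable_on {a..b}"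
  by (intro integrable_continuous_real continuous_intros antiperiodic_continuous)

lemma ip_sym: "ip T f g = ip T g f"
  unfolding ip_def by (simp add: mult.commute)

lemma ip_lincomb_left:
  assumes "antiperiodic T f" "antiperiodic T g" "antiperiodic T h"
  shows "ip T (\<lambda>x. a * f x + b * g x) h = a * ip T f h + b * ip T g h"
proof -
  have "ip T (\<lambda>x. a * f x + b * g x) h
      = integral {0..T} (\<lambda>x. a * (f x * h x) + b * (g x * h x))"
    unfolding ip_def by (simp add: algebra_simps)
  also have "\<dots> = a * ip T f h + b * ip T g h"
    unfolding ip_def using ip_integrable[OF assms(1,3)] ip_integrable[OF assms(2,3)]
    by (subst integral_add) (auto intro!: integrable_on_mult_right)
  finally show ?thesis .
qed

lemma ip_lincomb_right:
  assumes "antiperiodic T f" "antiperiodic T g" "antiperiodic T h"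
  shows "ip T h (\<lambda>x. a * f x + b * g x) = a * ip T h f + b * ip T h g"
  using ip_lincomb_left[OF assms] by (simp add: ip_sym)

lemma ip_nonneg: "antiperiodic T f \<Longrightarrow> 0 \<le> ip T f f"
  unfolding ip_def by (intro integral_nonneg ip_integrable) auto

lemma ip_lincomb_square:
  assumes "antiperiodic T f" "antiperiodic T g"
  shows "ip T (\<lambda>x. a * f x + b * g x) (\<lambda>x. a * f x + b * g x)
     = a\<^sup>2 * ip T f f + 2 * a * b * ip T f g + b\<^sup>2 * ip T g g"
  using assms
  by (simp add: ip_lincomb_left ip_lincomb_right antiperiodic_lincomb ip_sym[of T g f]
      power2_eq_square algebra_simps)

lemma ip_lincomb_le:
  assumes "antiperiodic T f" "antiperiodic T g"
  shows "ip T (\<lambda>x. a * f x + b * g x) (\<lambda>x. a * f x + b * g x)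
     \<le> 2 * a\<^sup>2 * ip T f f + 2 * b\<^sup>2 * ip T g g"
  using ip_lincomb_square[OF assms, of a b] ip_lincomb_square[OF assms, of a "-b"]
    ip_nonneg[OF antiperiodic_lincomb[OF assms, of a "-b"]] by (simp add: mult.commute)

lemma ip_mult_le:
  assumes f: "antiperiodic T f" and q: "continuous_on UNIV q" "\<And>x. \<bar>q x\<bar> \<le> K"
  shows "integral {0..T} (\<lambda>x. q x * (f x * f x)) \<le> K * ip T f f"
proof -
  have "integral {0..T} (\<lambda>x. q x * (f x * f x)) \<le> integral {0..T} (\<lambda>x. K * (f x * f x))"
  proof (rule integral_le)
    show "(\<lambda>x. q x * (f x * f x)) integrable_on {0..T}"
      by (intro integrable_continuous_real continuous_intros antiperiodic_continuous[OF f]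
          continuous_on_subset[OF q(1)]) auto
    show "(\<lambda>x. K * (f x * f x)) integrable_on {0..T}"
      by (intro integrable_on_mult_right ip_integrable[OF f f])
    show "q x * (f x * f x) \<le> K * (f x * f x)" for x
      by (rule mult_right_mono) (use q(2)[of x] in auto)
  qed
  then show ?thesis unfolding ip_def by simp
qed

lemma ip_eq_0D:
  assumes f: "antiperiodic T f" and "0 < T" "ip T f f \<le> 0"
  shows "f x = 0"
proof -
  have z: "f y = 0" if "y \<in> {0..T}" for y
  proof -
    have "integral {0..T} (\<lambda>x. f x * f x) = 0"
      using assms(3) ip_nonneg[OF f] unfolding ip_def by simp
    then have "((\<lambda>x. f x * f x) has_integral 0) (cbox 0 T)"
      using integrable_integral[OF ip_integrable[OF f f, of 0 T]] by simp
    then have "f y * f y = 0"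
      by (rule has_integral_0_cbox_imp_0[rotated 2])
         (use that \<open>0 < T\<close> in \<open>auto intro!: continuous_intros antiperiodic_continuous[OF f]\<close>)
    then show ?thesis by simp
  qed
  have "(f (y + T))\<^sup>2 = (f y)\<^sup>2" for y
    by (simp add: antiperiodic_shift[OF f])
  from periodic_value_in_period[where D = "\<lambda>y. (f y)\<^sup>2", OF \<open>0 < T\<close> this, of x]
    z[OF floor_shift_in_period[OF \<open>0 < T\<close>, of x]]
  show ?thesis by simp
qed

lemma prim_antisymmetric:
  assumes f: "antiperiodic T f" and g: "antiperiodic T g" and "0 < T"
  shows "ip T (prim T f) g = - ip T f (prim T g)"
proof -
  note pf = prim_props[OF f] and pg = prim_props[OF g]
  have "((\<lambda>x. f x * prim T g x + prim T f x * g x) has_integral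
        (prim T f T * prim T g T - prim T f 0 * prim T g 0)) {0..T}"
  proof (rule has_integral_of_derivative)
    show "((\<lambda>x. prim T f x * prim T g x) has_real_derivative
        (f x * prim T g x + prim T f x * g x)) (at x)" for x
      using DERIV_mult[OF pf(2)[of x] pg(2)[of x]] by (simp add: mult.commute add.commute)
  qed (use \<open>0 < T\<close> in simp)
  moreover have "prim T f T * prim T g T = prim T f 0 * prim T g 0"
    using antiperiodic_shift[OF pf(1), of 0] antiperiodic_shift[OF pg(1), of 0] by simp
  ultimately have "integral {0..T} (\<lambda>x. f x * prim T g x + prim T f x * g x) = 0"
    by (simp add: integral_unique)
  then show ?thesis
    unfolding ip_def using ip_integrable[OF f pg(1), of 0 T] ip_integrable[OF pf(1) g, of 0 T]
    by (simp add: integral_add)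
qed

text \<open>The Cauchy-Schwarz inequality for \<open>f\<close> against the constant one, obtained by integrating the
  square of \<open>f\<close> minus its mean.\<close>

lemma prim_holder:
  assumes f: "antiperiodic T f" and xy: "0 \<le> x" "x \<le> y" "y \<le> T"
  shows "(prim T f y - prim T f x)\<^sup>2 \<le> (y - x) * ip T f f"
proof (cases "x = y")
  case False
  then have "x < y" using xy by simp
  define I where "I = prim T f y - prim T f x"
  define m where "m = I / (y - x)"
  have hf: "(f has_integral I) {x..y}"
    unfolding I_def
    by (rule has_integral_of_derivative[OF has_derivative_prim[OF f] xy(2)])
  have hff: "((\<lambda>x. f x * f x) has_integral integral {x..y} (\<lambda>x. f x * f x)) {x..y}"
    by (intro integrable_integral ip_integrable[OF f f])
  have "((\<lambda>x. f x * f x - 2 * m * f x + m\<^sup>2) has_integral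
      (integral {x..y} (\<lambda>x. f x * f x) - 2 * m * I + (y - x) * m\<^sup>2)) {x..y}"
    using has_integral_add[OF has_integral_diff[OF hff has_integral_mult_right[OF hf]]
      has_integral_const_real[of "m\<^sup>2" x y]] \<open>x < y\<close> by simp
  moreover have "0 \<le> f x * f x - 2 * m * f x + m\<^sup>2" for x
    using zero_le_power2[of "f x - m"] by (simp add: power2_eq_square algebra_simps)
  ultimately have "0 \<le> integral {x..y} (\<lambda>x. f x * f x) - 2 * m * I + (y - x) * m\<^sup>2"
    using has_integral_nonneg by blast
  moreover have "2 * m * I - (y - x) * m\<^sup>2 = I\<^sup>2 / (y - x)"
  proof -
    have "I = m * (y - x)" using \<open>x < y\<close> unfolding m_def by simp
    then show ?thesis using \<open>x < y\<close> by (simp add: power2_eq_square)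
  qed
  ultimately have "I\<^sup>2 / (y - x) \<le> integral {x..y} (\<lambda>x. f x * f x)" by linarith
  also have "\<dots> \<le> ip T f f"
    unfolding ip_def by (rule integral_subset_le) (use xy in \<open>auto intro!: ip_integrable f\<close>)
  finally show ?thesis
    using \<open>x < y\<close> unfolding I_def by (simp add: field_simps)
qed auto

text \<open>The primitive satisfies \<open>F T = - F 0\<close>, so its oscillation over one period controls the
  value \<open>F 0\<close> itself and not only differences.\<close>

lemma prim_sup_bound:
  assumes f: "antiperiodic T f" and "x \<in> {0..T}"
  shows "(prim T f x)\<^sup>2 \<le> 3 * T * ip T f f"
proof -
  define F where "F = prim T f"
  have "F T = - F 0"
    using antiperiodic_shift[OF antiperiodic_prim[OF f], of 0] by (simp add: F_def)
  then have "(2 * F 0)\<^sup>2 \<le> T * ip T f f"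
    using prim_holder[OF f, of 0 T] assms(2) unfolding F_def[symmetric] by (simp add: power2_eq_square)
  moreover have "(F x - F 0)\<^sup>2 \<le> T * ip T f f"
  proof -
    have "(F x - F 0)\<^sup>2 \<le> x * ip T f f"
      using prim_holder[OF f, of 0 x] assms(2) unfolding F_def by simp
    also have "\<dots> \<le> T * ip T f f"
      using assms(2) ip_nonneg[OF f] by (intro mult_right_mono) auto
    finally show ?thesis .
  qed
  moreover have "(F x)\<^sup>2 \<le> 2 * (F 0)\<^sup>2 + 2 * (F x - F 0)\<^sup>2"
    using zero_le_power2[of "F x - 2 * F 0"] by (simp add: power2_eq_square algebra_simps)
  moreover have "0 \<le> T * ip T f f"
    using ip_nonneg[OF f] assms(2) by simp
  ultimately show ?thesis unfolding F_def[symmetric] by (simp add: power_mult_distrib)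
qed

lemma ip_prim_le:
  assumes f: "antiperiodic T f" and "0 < T"
  shows "ip T (prim T f) (prim T f) \<le> 3 * T\<^sup>2 * ip T f f"
proof -
  have "ip T (prim T f) (prim T f) \<le> integral {0..T} (\<lambda>x. 3 * T * ip T f f)"
    unfolding ip_def[of T "prim T f"]
  proof (rule integral_le)
    show "(\<lambda>x. prim T f x * prim T f x) integrable_on {0..T}"
      by (intro ip_integrable[of T] antiperiodic_prim f)
  qed (use prim_sup_bound[OF f] in \<open>auto simp: power2_eq_square\<close>)
  also have "\<dots> = 3 * T\<^sup>2 * ip T f f"
    using \<open>0 < T\<close> by (simp add: power2_eq_square)
  finally show ?thesis .
qed

text \<open>Bounded sets in the norm of \<open>ip\<close> have uniformly bounded and equicontinuous primitives, by
  \<open>prim_sup_bound\<close> and \<open>prim_holder\<close>. Arzela-Ascoli on one period then gives a uniformly convergent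
  subsequence on the line, since antiperiodicity transports the estimate to all periods.\<close>

lemma prim_compact:
  fixes h :: "nat \<Rightarrow> real \<Rightarrow> real"
  assumes h: "\<And>n. antiperiodic T (h n)" and 1: "\<And>n. ip T (h n) (h n) \<le> 1" and "0 < T"
  obtains f r where "antiperiodic T f" "strict_mono (r :: nat \<Rightarrow> nat)"
    "(\<lambda>n. ip T (\<lambda>x. prim T (h (r n)) x - f x) (\<lambda>x. prim T (h (r n)) x - f x)) \<longlonglongrightarrow> 0"
proof -
  let ?F = "\<lambda>n. prim T (h n)"
  have F: "antiperiodic T (?F n)" for n by (rule antiperiodic_prim[OF h])
  have shift: "?F n x = - ?F n (x - T)" for n x
    using antiperiodic_shift[OF F, of n "x - T"] by simp
  have hold: "(?F n y - ?F n x)\<^sup>2 \<le> \<bar>y - x\<bar>" if "x \<in> {0..T}" "y \<in> {0..T}" for n x y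
  proof -
    have *: "(?F n y - ?F n x)\<^sup>2 \<le> y - x" if "x \<in> {0..T}" "y \<in> {0..T}" "x \<le> y" for x y
    proof -
      have "(?F n y - ?F n x)\<^sup>2 \<le> (y - x) * ip T (h n) (h n)"
        using prim_holder[OF h] that by simp
      also have "\<dots> \<le> (y - x) * 1" by (intro mult_left_mono 1) (use that in auto)
      finally show ?thesis by simp
    qed
    show ?thesis
      using *[of x y] *[of y x] that by (cases "x \<le> y") (auto simp: power2_commute)
  qed
  have bd: "norm (?F n x) \<le> sqrt (3 * T)" if "x \<in> {0..T}" for n x
  proof -
    have "(?F n x)\<^sup>2 \<le> 3 * T * ip T (h n) (h n)" by (rule prim_sup_bound[OF h that])
    also have "\<dots> \<le> 3 * T * 1" by (intro mult_left_mono 1) (use \<open>0 < T\<close> in auto)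
    finally show ?thesis using real_le_rsqrt[of "\<bar>?F n x\<bar>" "3*T"] by simp
  qed
  have eq: "\<exists>d. 0 < d \<and> (\<forall>n y. y \<in> {0..T} \<and> norm (x - y) < d \<longrightarrow> norm (?F n x - ?F n y) < e)"
    if "x \<in> {0..T}" "0 < e" for x e
  proof (intro exI[of _ "e\<^sup>2"] conjI allI impI)
    fix n y assume y: "y \<in> {0..T} \<and> norm (x - y) < e\<^sup>2"
    have "(?F n x - ?F n y)\<^sup>2 < e\<^sup>2" using hold[of y x n] y that by simp
    then show "norm (?F n x - ?F n y) < e"
      using \<open>0 < e\<close> abs_less_iff power2_less_imp_less[of "\<bar>?F n x - ?F n y\<bar>" e] by simp
  qed (use that in auto)
  obtain g r where g: "continuous_on {0..T} g" and r: "strict_mono (r :: nat \<Rightarrow> nat)"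
    and conv: "\<And>e. 0 < e \<Longrightarrow> \<exists>N. \<forall>n x. n \<ge> N \<and> x \<in> {0..T} \<longrightarrow> norm (?F (r n) x - g x) < e"
    using Arzela_Ascoli[of "{0..T}" ?F "sqrt (3 * T)"] bd eq by (metis compact_Icc)
  have per: "\<bar>?F m (x - of_int \<lfloor>x / T\<rfloor> * T) - ?F n (x - of_int \<lfloor>x / T\<rfloor> * T)\<bar> = \<bar>?F m x - ?F n x\<bar>" for m n x
    by (rule periodic_value_in_period[where D = "\<lambda>x. \<bar>?F m x - ?F n x\<bar>", OF \<open>0 < T\<close>])
       (simp add: antiperiodic_shift[OF F, of m] antiperiodic_shift[OF F, of n])
  have Cau: "uniformly_Cauchy_on UNIV (\<lambda>n. ?F (r n))"
  proof (rule uniformly_Cauchy_onI)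
    fix e :: real assume "0 < e"
    then obtain N where N: "\<And>n x. n \<ge> N \<Longrightarrow> x \<in> {0..T} \<Longrightarrow> norm (?F (r n) x - g x) < e / 2"
      using conv[of "e / 2"] by auto
    have "dist (?F (r m) x) (?F (r n) x) < e" if "m \<ge> N" "n \<ge> N" for m n x
      using N[OF that(1) floor_shift_in_period[OF \<open>0 < T\<close>, of x]]
        N[OF that(2) floor_shift_in_period[OF \<open>0 < T\<close>, of x]]
      unfolding dist_real_def per[of "r m" x "r n", symmetric] real_norm_def by linarith
    then show "\<exists>M. \<forall>x\<in>UNIV. \<forall>m\<ge>M. \<forall>n\<ge>M. dist (?F (r m) x) (?F (r n) x) < e" by blast
  qed
  then obtain f where f: "uniform_limit UNIV (\<lambda>n. ?F (r n)) f sequentially"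
    using uniformly_convergent_eq_Cauchy uniformly_convergent_on_def by metis
  have "antiperiodic T f"
    unfolding antiperiodic_def
  proof (intro conjI allI)
    show "continuous_on UNIV f"
      by (rule uniform_limit_theorem[OF _ f]) (auto intro!: always_eventually antiperiodic_continuous[OF F])
    fix x
    have "(\<lambda>n. ?F (r n) (x + T)) \<longlonglongrightarrow> f (x + T)" "(\<lambda>n. ?F (r n) x) \<longlonglongrightarrow> f x"
      using tendsto_uniform_limitI[OF f] by auto
    moreover have "?F (r n) (x + T) = - ?F (r n) x" for n by (rule antiperiodic_shift[OF F])
    ultimately show "f (x + T) = - f x"
      using LIMSEQ_unique[OF _ tendsto_minus] by simp
  qed
  moreover have "(\<lambda>n. ip T (\<lambda>x. ?F (r n) x - f x) (\<lambda>x. ?F (r n) x - f x)) \<longlonglongrightarrow> 0"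
  proof (rule LIMSEQ_I)
    fix e :: real assume "0 < e"
    define d where "d = sqrt (e / (2 * T))"
    have d: "0 < d" "d\<^sup>2 * T < e" using \<open>0 < e\<close> \<open>0 < T\<close> by (auto simp: d_def)
    from f d(1) obtain N where N: "\<And>n x. n \<ge> N \<Longrightarrow> \<bar>?F (r n) x - f x\<bar> < d"
      unfolding uniform_limit_sequentially_iff dist_real_def by blast
    have "norm (ip T (\<lambda>x. ?F (r n) x - f x) (\<lambda>x. ?F (r n) x - f x) - 0) < e" if "n \<ge> N" for n
    proof -
      have ap: "antiperiodic T (\<lambda>x. ?F (r n) x - f x)"
        by (intro antiperiodic_diff F \<open>antiperiodic T f\<close>)
      have "ip T (\<lambda>x. ?F (r n) x - f x) (\<lambda>x. ?F (r n) x - f x) \<le> integral {0..T} (\<lambda>x. d\<^sup>2)"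
        unfolding ip_def
      proof (rule integral_le[OF ip_integrable[OF ap ap]])
        show "(?F (r n) x - f x) * (?F (r n) x - f x) \<le> d\<^sup>2" for x
          using N[OF that, of x] abs_le_square_iff[of "?F (r n) x - f x" d] d(1)
          by (simp add: power2_eq_square)
      qed auto
      also have "\<dots> < e" using d \<open>0 < T\<close> by (simp add: mult.commute)
      finally show ?thesis using ip_nonneg[OF ap] by simp
    qed
    then show "\<exists>no. \<forall>n\<ge>no. norm (ip T (\<lambda>x. ?F (r n) x - f x) (\<lambda>x. ?F (r n) x - f x) - 0) < e" by blast
  qed
  ultimately show ?thesis using r that by blast
qed

section \<open>A quadratic pencil on antiperiodic functions\<close>

lemma ip_mult_sym: "ip T (\<lambda>x. q x * f x) g = ip T (\<lambda>x. q x * g x) f"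
  unfolding ip_def by (simp add: mult_ac)

text \<open>The setting for the pencil \<open>\<mu>\<^sup>2 w - \<mu> c w'' + \<epsilon> w'''' + (q w')'\<close>. The unknown is taken to be
  \<open>h = w''\<close>, so that \<open>w' = J h\<close> and \<open>w = J (J h)\<close>: the form then lives on continuous functions with
  the \<open>L\<^sup>2\<close> norm, its leading part is \<open>\<epsilon>\<close> times the identity, and all other terms are
  compact.\<close>

locale antiperiodic_pencil =
  fixes T \<epsilon> c K :: real and q :: "real \<Rightarrow> real"
  assumes T_pos: "0 < T" and eps_pos: "0 < \<epsilon>" and c_pos: "0 < c"
    and q_continuous: "continuous_on UNIV q" and q_periodic: "q (x + T) = q x"
    and q_bounded: "\<bar>q x\<bar> \<le> K"
begin

abbreviation AP where "AP \<equiv> antiperiodic T"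
abbreviation J where "J \<equiv> prim T"

text \<open>The weak form of the pencil: \<open>pencil_form \<mu> h k\<close> is obtained by pairing it with \<open>J (J k)\<close> and
  integrating by parts.\<close>

definition pencil_form :: "real \<Rightarrow> (real \<Rightarrow> real) \<Rightarrow> (real \<Rightarrow> real) \<Rightarrow> real" where
  "pencil_form \<mu> h k = \<epsilon> * ip T h k + \<mu>\<^sup>2 * ip T (J (J h)) (J (J k)) + \<mu> * c * ip T (J h) (J k)
     - ip T (\<lambda>x. q x * J h x) (J k)"

text \<open>In terms of \<open>f = w'\<close>, integrating the pencil equation once gives \<open>\<epsilon> f'' = pencil_lower \<mu> f\<close>.\<close>

definition pencil_lower :: "real \<Rightarrow> (real \<Rightarrow> real) \<Rightarrow> real \<Rightarrow> real" where
  "pencil_lower \<mu> f = (\<lambda>x. - \<mu>\<^sup>2 * J (J f) x + (\<mu> * c - q x) * f x)"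

definition pencil_op :: "real \<Rightarrow> (real \<Rightarrow> real) \<Rightarrow> real \<Rightarrow> real" where
  "pencil_op \<mu> h = (\<lambda>x. \<epsilon> * h x - J (pencil_lower \<mu> (J h)) x)"

lemma AP_J [intro]: "AP f \<Longrightarrow> AP (J f)"
  by (rule antiperiodic_prim)

lemma AP_q [intro]: "AP f \<Longrightarrow> AP (\<lambda>x. q x * f x)"
  by (rule antiperiodic_mult_periodic) (auto simp: q_continuous q_periodic)

lemma AP_coeff [intro]: "AP f \<Longrightarrow> AP (\<lambda>x. (\<mu> * c - q x) * f x)"
  using antiperiodic_lincomb[of T f "\<lambda>x. q x * f x" "\<mu> * c" "-1"] AP_q by (simp add: algebra_simps)

lemma AP_lower [intro]: "AP f \<Longrightarrow> AP (pencil_lower \<mu> f)"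
  unfolding pencil_lower_def
  using antiperiodic_lincomb[of T "J (J f)" "\<lambda>x. (\<mu> * c - q x) * f x" "- \<mu>\<^sup>2" 1] by auto

lemma AP_pencil_op [intro]: "AP h \<Longrightarrow> AP (pencil_op \<mu> h)"
  unfolding pencil_op_def
  using antiperiodic_lincomb[of T h "J (pencil_lower \<mu> (J h))" \<epsilon> "-1"] by auto

lemma pencil_form_sym: "pencil_form \<mu> h k = pencil_form \<mu> k h"
  unfolding pencil_form_def using ip_mult_sym[of T q] by (simp add: ip_sym)

lemma pencil_form_lincomb_left:
  assumes "AP h" "AP k" "AP g"
  shows "pencil_form \<mu> (\<lambda>x. a * h x + b * k x) g = a * pencil_form \<mu> h g + b * pencil_form \<mu> k g"
proof -
  have "ip T (\<lambda>x. q x * (a * J h x + b * J k x)) (J g)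
      = a * ip T (\<lambda>x. q x * J h x) (J g) + b * ip T (\<lambda>x. q x * J k x) (J g)"
    using ip_lincomb_left[of T "\<lambda>x. q x * J h x" "\<lambda>x. q x * J k x" "J g" a b] assms
    by (auto simp: algebra_simps)
  then show ?thesis
    unfolding pencil_form_def using assms
    by (simp add: prim_lincomb ip_lincomb_left AP_J algebra_simps)
qed

lemma pencil_form_lincomb_square:
  assumes "AP h" "AP k"
  shows "pencil_form \<mu> (\<lambda>x. a * h x + b * k x) (\<lambda>x. a * h x + b * k x)
     = a\<^sup>2 * pencil_form \<mu> h h + 2 * a * b * pencil_form \<mu> h k + b\<^sup>2 * pencil_form \<mu> k k"
  using assms
  by (simp add: pencil_form_lincomb_left antiperiodic_lincomb pencil_form_sym[of _ h "\<lambda>x. a * h x + b * k x"]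
      pencil_form_sym[of _ k "\<lambda>x. a * h x + b * k x"] pencil_form_sym[of _ k h] power2_eq_square algebra_simps)

text \<open>The operator represents the form because \<open>J\<close> is antisymmetric.\<close>

lemma ip_pencil_op:
  assumes h: "AP h" and k: "AP k"
  shows "ip T (pencil_op \<mu> h) k = pencil_form \<mu> h k"
proof -
  have 1: "ip T (pencil_op \<mu> h) k = \<epsilon> * ip T h k + (-1) * ip T (J (pencil_lower \<mu> (J h))) k"
    unfolding pencil_op_def using ip_lincomb_left[of T h "J (pencil_lower \<mu> (J h))" k \<epsilon> "-1"] h k by auto
  have 2: "ip T (J (pencil_lower \<mu> (J h))) k = - ip T (pencil_lower \<mu> (J h)) (J k)"
    by (rule prim_antisymmetric) (use h k T_pos in auto)
  have 3: "ip T (pencil_lower \<mu> (J h)) (J k)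
      = - \<mu>\<^sup>2 * ip T (J (J (J h))) (J k) + ip T (\<lambda>x. (\<mu> * c - q x) * J h x) (J k)"
    unfolding pencil_lower_def
    using ip_lincomb_left[of T "J (J (J h))" "\<lambda>x. (\<mu> * c - q x) * J h x" "J k" "- \<mu>\<^sup>2" 1] h k by auto
  have 4: "ip T (J (J (J h))) (J k) = - ip T (J (J h)) (J (J k))"
    by (rule prim_antisymmetric) (use h k T_pos in auto)
  have 5: "ip T (\<lambda>x. (\<mu> * c - q x) * J h x) (J k)
      = \<mu> * c * ip T (J h) (J k) + (-1) * ip T (\<lambda>x. q x * J h x) (J k)"
    using ip_lincomb_left[of T "J h" "\<lambda>x. q x * J h x" "J k" "\<mu> * c" "-1"] h k
    by (auto simp: algebra_simps)
  show ?thesis unfolding 1 2 3 4 5 pencil_form_def by simp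
qed

lemma K_nonneg: "0 \<le> K"
  using q_bounded[of 0] by linarith

lemma ip_q_le:
  assumes "AP f"
  shows "\<bar>ip T (\<lambda>x. q x * f x) f\<bar> \<le> K * ip T f f"
proof -
  have "ip T (\<lambda>x. q x * f x) f = integral {0..T} (\<lambda>x. q x * (f x * f x))"
    unfolding ip_def by (simp add: mult.assoc)
  moreover have "- integral {0..T} (\<lambda>x. q x * (f x * f x)) = integral {0..T} (\<lambda>x. (- q x) * (f x * f x))"
    by simp
  moreover have "integral {0..T} (\<lambda>x. q x * (f x * f x)) \<le> K * ip T f f"
    by (rule ip_mult_le) (use assms q_continuous q_bounded in auto)
  moreover have "integral {0..T} (\<lambda>x. (- q x) * (f x * f x)) \<le> K * ip T f f"
    by (rule ip_mult_le) (use assms q_continuous q_bounded in \<open>auto intro!: continuous_intros\<close>)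
  ultimately show ?thesis by linarith
qed

lemma ip_J_le: "AP h \<Longrightarrow> ip T (J h) (J h) \<le> 3 * T\<^sup>2 * ip T h h"
  using ip_prim_le T_pos by blast

lemma ip_JJ_le:
  assumes "AP h"
  shows "ip T (J (J h)) (J (J h)) \<le> (3 * T\<^sup>2)\<^sup>2 * ip T h h"
proof -
  have "ip T (J (J h)) (J (J h)) \<le> 3 * T\<^sup>2 * ip T (J h) (J h)" using ip_J_le assms by blast
  also have "\<dots> \<le> 3 * T\<^sup>2 * (3 * T\<^sup>2 * ip T h h)"
    by (intro mult_left_mono ip_J_le assms) auto
  finally show ?thesis by (simp add: power2_eq_square mult_ac)
qed

lemma pencil_form_le:
  assumes "AP h" "0 \<le> \<mu>"
  shows "pencil_form \<mu> h h \<le> (\<epsilon> + \<mu>\<^sup>2 * (3 * T\<^sup>2)\<^sup>2 + \<mu> * c * (3 * T\<^sup>2) + K * (3 * T\<^sup>2)) * ip T h h"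
proof -
  have "\<mu>\<^sup>2 * ip T (J (J h)) (J (J h)) \<le> \<mu>\<^sup>2 * ((3 * T\<^sup>2)\<^sup>2 * ip T h h)"
    by (intro mult_left_mono ip_JJ_le assms) auto
  moreover have "\<mu> * c * ip T (J h) (J h) \<le> \<mu> * c * (3 * T\<^sup>2 * ip T h h)"
    by (intro mult_left_mono ip_J_le assms) (use assms c_pos in auto)
  moreover have "K * ip T (J h) (J h) \<le> K * (3 * T\<^sup>2 * ip T h h)"
    by (intro mult_left_mono ip_J_le assms K_nonneg)
  moreover have "- ip T (\<lambda>x. q x * J h x) (J h) \<le> K * ip T (J h) (J h)"
    using ip_q_le[OF AP_J[OF assms(1)]] by linarith
  ultimately show ?thesis unfolding pencil_form_def by (simp add: algebra_simps)
qed

lemma pencil_lower_le: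
  assumes f: "AP f" and "0 \<le> \<mu>"
  shows "ip T (pencil_lower \<mu> f) (pencil_lower \<mu> f)
    \<le> (2 * (\<mu>\<^sup>2)\<^sup>2 * (3 * T\<^sup>2)\<^sup>2 + 2 * (\<mu> * c + K)\<^sup>2) * ip T f f"
proof -
  have "ip T (pencil_lower \<mu> f) (pencil_lower \<mu> f) \<le> 2 * (- \<mu>\<^sup>2)\<^sup>2 * ip T (J (J f)) (J (J f))
      + 2 * 1\<^sup>2 * ip T (\<lambda>x. (\<mu> * c - q x) * f x) (\<lambda>x. (\<mu> * c - q x) * f x)"
    unfolding pencil_lower_def
    using ip_lincomb_le[of T "J (J f)" "\<lambda>x. (\<mu> * c - q x) * f x" "- \<mu>\<^sup>2" 1] f by auto
  moreover have "(- \<mu>\<^sup>2)\<^sup>2 * ip T (J (J f)) (J (J f)) \<le> (- \<mu>\<^sup>2)\<^sup>2 * ((3 * T\<^sup>2)\<^sup>2 * ip T f f)"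
    by (intro mult_left_mono ip_JJ_le f) auto
  moreover have "ip T (\<lambda>x. (\<mu> * c - q x) * f x) (\<lambda>x. (\<mu> * c - q x) * f x)
      = integral {0..T} (\<lambda>x. (\<mu> * c - q x)\<^sup>2 * (f x * f x))"
    unfolding ip_def by (simp add: power2_eq_square mult_ac)
  moreover have "integral {0..T} (\<lambda>x. (\<mu> * c - q x)\<^sup>2 * (f x * f x)) \<le> (\<mu> * c + K)\<^sup>2 * ip T f f"
  proof (rule ip_mult_le[OF f])
    show "continuous_on UNIV (\<lambda>x. (\<mu> * c - q x)\<^sup>2)"
      by (intro continuous_intros q_continuous)
    show "\<bar>(\<mu> * c - q x)\<^sup>2\<bar> \<le> (\<mu> * c + K)\<^sup>2" for x
    proof -
      have "\<bar>\<mu> * c - q x\<bar> \<le> \<bar>\<mu> * c + K\<bar>"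
        using q_bounded[of x] mult_nonneg_nonneg[OF assms(2) less_imp_le[OF c_pos]] by linarith
      then show ?thesis by (simp add: abs_le_square_iff)
    qed
  qed
  ultimately show ?thesis by (simp add: algebra_simps)
qed

lemma pencil_lower_diff:
  assumes "AP f" "AP g"
  shows "pencil_lower \<mu> (\<lambda>x. f x - g x) = (\<lambda>x. pencil_lower \<mu> f x - pencil_lower \<mu> g x)"
  unfolding pencil_lower_def using assms by (simp add: prim_diff AP_J algebra_simps)

text \<open>A nonnegative quadratic form obeys a Cauchy-Schwarz inequality, so an almost-minimizer almost
  solves the equation. Concretely, the form is evaluated at \<open>h - (1 / C) P h\<close> with \<open>P\<close> the operator of
  the pencil and \<open>C\<close> the bound of the form from \<open>pencil_form_le\<close>.\<close>

lemma residual_le: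
  assumes nonneg: "\<And>k. AP k \<Longrightarrow> 0 \<le> pencil_form \<mu> k k" and "0 \<le> \<mu>" and h: "AP h"
  shows "ip T (pencil_op \<mu> h) (pencil_op \<mu> h)
    \<le> (\<epsilon> + \<mu>\<^sup>2 * (3 * T\<^sup>2)\<^sup>2 + \<mu> * c * (3 * T\<^sup>2) + K * (3 * T\<^sup>2)) * pencil_form \<mu> h h"
proof -
  define C where "C = \<epsilon> + \<mu>\<^sup>2 * (3 * T\<^sup>2)\<^sup>2 + \<mu> * c * (3 * T\<^sup>2) + K * (3 * T\<^sup>2)"
  have C: "0 < C"
    unfolding C_def using eps_pos c_pos K_nonneg \<open>0 \<le> \<mu>\<close> by (intro add_pos_nonneg) auto
  define k where "k = pencil_op \<mu> h"
  have k: "AP k" unfolding k_def using h by auto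
  define N where "N = ip T k k"
  have "pencil_form \<mu> h k = N" unfolding N_def using ip_pencil_op[OF h k] by (simp add: k_def)
  moreover have "pencil_form \<mu> k k \<le> C * N" unfolding N_def C_def by (rule pencil_form_le[OF k assms(2)])
  moreover have "0 \<le> pencil_form \<mu> (\<lambda>x. 1 * h x + (- (1 / C)) * k x) (\<lambda>x. 1 * h x + (- (1 / C)) * k x)"
    by (rule nonneg[OF antiperiodic_lincomb[OF h k]])
  ultimately have "0 \<le> pencil_form \<mu> h h - 2 * (1 / C) * N + (1 / C)\<^sup>2 * pencil_form \<mu> k k"
    unfolding pencil_form_lincomb_square[OF h k] by simp
  also have "\<dots> \<le> pencil_form \<mu> h h - 2 * (1 / C) * N + (1 / C)\<^sup>2 * (C * N)"
    using \<open>pencil_form \<mu> k k \<le> C * N\<close> by (intro add_left_mono mult_left_mono) auto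
  also have "\<dots> = pencil_form \<mu> h h - N / C"
    using C by (simp add: power2_eq_square field_simps)
  finally show ?thesis using C unfolding N_def k_def C_def[symmetric] by (simp add: field_simps)
qed

text \<open>Along a normalized minimizing sequence \<open>h\<^sub>n\<close> the residual \<open>P h\<^sub>n\<close> tends to zero, and \<open>J h\<^sub>n\<close> converges
  along a subsequence. As \<open>\<epsilon> h\<^sub>n\<close> is the residual plus a bounded operator applied to \<open>J h\<^sub>n\<close>, the
  functions \<open>h\<^sub>n\<close> converge as well. The limit has norm one and is continuous without further
  argument, being given by the equation as a primitive.\<close>

lemma kernel_from_minimizing_sequence:
  assumes nonneg: "\<And>k. AP k \<Longrightarrow> 0 \<le> pencil_form \<mu> k k" and "0 \<le> \<mu>"
    and almost: "\<And>e. 0 < e \<Longrightarrow> \<exists>h. AP h \<and> ip T h h = 1 \<and> pencil_form \<mu> h h \<le> e"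
  shows "\<exists>h. AP h \<and> (\<exists>x. h x \<noteq> 0) \<and> (\<forall>x. pencil_op \<mu> h x = 0)"
proof -
  have "\<forall>n. \<exists>h. AP h \<and> ip T h h = 1 \<and> pencil_form \<mu> h h \<le> 1 / real (Suc n)"
    using almost by simp
  from choice[OF this] obtain h0 where h0: "\<And>n. AP (h0 n)" "\<And>n. ip T (h0 n) (h0 n) = 1"
    "\<And>n. pencil_form \<mu> (h0 n) (h0 n) \<le> 1 / real (Suc n)" by blast
  obtain f r where f: "AP f" and r: "strict_mono (r :: nat \<Rightarrow> nat)"
    and conv0: "(\<lambda>n. ip T (\<lambda>x. J (h0 (r n)) x - f x) (\<lambda>x. J (h0 (r n)) x - f x)) \<longlonglongrightarrow> 0"
    by (rule prim_compact[OF h0(1) eq_refl[OF h0(2)] T_pos])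
  define hs where "hs n = h0 (r n)" for n
  have hs: "AP (hs n)" "ip T (hs n) (hs n) = 1" for n using h0 unfolding hs_def by auto
  define d where "d n = (\<lambda>x. J (hs n) x - f x)" for n
  have d: "AP (d n)" for n unfolding d_def using hs f by (intro antiperiodic_diff AP_J)
  have conv: "(\<lambda>n. ip T (d n) (d n)) \<longlonglongrightarrow> 0" using conv0 unfolding d_def hs_def .
  define res where "res n = pencil_op \<mu> (hs n)" for n
  have res: "AP (res n)" for n unfolding res_def using hs by auto
  have res0: "(\<lambda>n. ip T (res n) (res n)) \<longlonglongrightarrow> 0"
  proof (rule tendsto_sandwich[OF _ _ tendsto_const])
    define C where "C = \<epsilon> + \<mu>\<^sup>2 * (3 * T\<^sup>2)\<^sup>2 + \<mu> * c * (3 * T\<^sup>2) + K * (3 * T\<^sup>2)"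
    have C: "0 < C"
      unfolding C_def using eps_pos c_pos K_nonneg \<open>0 \<le> \<mu>\<close> by (intro add_pos_nonneg) auto
    have "ip T (res n) (res n) \<le> C * (1 / real (Suc n))" for n
    proof -
      have "ip T (res n) (res n) \<le> C * pencil_form \<mu> (hs n) (hs n)"
        unfolding res_def C_def by (rule residual_le[OF nonneg assms(2) hs(1)])
      also have "\<dots> \<le> C * (1 / real (Suc (r n)))"
        using h0(3)[of "r n"] C unfolding hs_def by (intro mult_left_mono) auto
      also have "\<dots> \<le> C * (1 / real (Suc n))"
        using C seq_suble[OF r, of n] by (intro mult_left_mono divide_left_mono) auto
      finally show ?thesis .
    qed
    then show "\<forall>\<^sub>F n in sequentially. ip T (res n) (res n) \<le> C * (1 / real (Suc n))" by simp
    show "(\<lambda>n. C * (1 / real (Suc n))) \<longlonglongrightarrow> 0"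
      using tendsto_mult_right_zero[OF LIMSEQ_inverse_real_of_nat, of C] by (simp add: divide_inverse)
  qed (simp add: ip_nonneg res)
  (* the candidate for the limit of hs, read off from the equation with J (hs n) replaced by f *)
  define h where "h = (\<lambda>x. (1 / \<epsilon>) * J (pencil_lower \<mu> f) x)"
  have h: "AP h" unfolding h_def using f by (intro antiperiodic_cmult) auto
  define e where "e n = (\<lambda>x. hs n x - h x)" for n
  have e: "AP (e n)" for n unfolding e_def using hs h by (intro antiperiodic_diff)
  have e_eq: "e n = (\<lambda>x. (1 / \<epsilon>) * res n x + (1 / \<epsilon>) * J (pencil_lower \<mu> (d n)) x)" for n
  proof -
    have "J (pencil_lower \<mu> (d n)) = (\<lambda>x. J (pencil_lower \<mu> (J (hs n))) x - J (pencil_lower \<mu> f) x)"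
      unfolding d_def using hs f by (simp add: pencil_lower_diff prim_diff AP_J AP_lower)
    then show ?thesis
      unfolding e_def res_def h_def pencil_op_def using eps_pos by (auto simp: field_simps)
  qed
  have e0: "(\<lambda>n. ip T (e n) (e n)) \<longlonglongrightarrow> 0"
  proof (rule tendsto_sandwich[OF _ _ tendsto_const])
    define D where "D = 2 * (\<mu>\<^sup>2)\<^sup>2 * (3 * T\<^sup>2)\<^sup>2 + 2 * (\<mu> * c + K)\<^sup>2"
    have "ip T (e n) (e n) \<le> 2 * (1 / \<epsilon>)\<^sup>2 * ip T (res n) (res n)
        + 2 * (1 / \<epsilon>)\<^sup>2 * (3 * T\<^sup>2 * (D * ip T (d n) (d n)))" for n
    proof -
      have "ip T (e n) (e n) \<le> 2 * (1 / \<epsilon>)\<^sup>2 * ip T (res n) (res n)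
          + 2 * (1 / \<epsilon>)\<^sup>2 * ip T (J (pencil_lower \<mu> (d n))) (J (pencil_lower \<mu> (d n)))"
        unfolding e_eq by (rule ip_lincomb_le) (use res d in auto)
      moreover have "ip T (J (pencil_lower \<mu> (d n))) (J (pencil_lower \<mu> (d n))) \<le> 3 * T\<^sup>2 * ip T (pencil_lower \<mu> (d n)) (pencil_lower \<mu> (d n))"
        using ip_J_le d by blast
      moreover have "3 * T\<^sup>2 * ip T (pencil_lower \<mu> (d n)) (pencil_lower \<mu> (d n)) \<le> 3 * T\<^sup>2 * (D * ip T (d n) (d n))"
        unfolding D_def by (intro mult_left_mono pencil_lower_le d assms(2)) auto
      ultimately show ?thesis
        by (smt (verit, best) mult_left_mono zero_le_power2)
    qed
    then show "\<forall>\<^sub>F n in sequentially. ip T (e n) (e n) \<le> 2 * (1 / \<epsilon>)\<^sup>2 * ip T (res n) (res n)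
        + 2 * (1 / \<epsilon>)\<^sup>2 * (3 * T\<^sup>2 * (D * ip T (d n) (d n)))" by simp
    show "(\<lambda>n. 2 * (1 / \<epsilon>)\<^sup>2 * ip T (res n) (res n)
        + 2 * (1 / \<epsilon>)\<^sup>2 * (3 * T\<^sup>2 * (D * ip T (d n) (d n)))) \<longlonglongrightarrow> 0"
      by (rule tendsto_eq_intros res0 conv refl | simp)+
  qed (simp add: ip_nonneg e)
  (* both f and J h are limits of J (hs n) *)
  have "ip T (\<lambda>x. J h x - f x) (\<lambda>x. J h x - f x) \<le> 0"
  proof (rule LIMSEQ_le_const)
    have eq: "(\<lambda>x. J h x - f x) = (\<lambda>x. 1 * d n x + (-1) * J (e n) x)" for n
      unfolding d_def e_def using hs h by (simp add: prim_diff)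
    have "ip T (\<lambda>x. J h x - f x) (\<lambda>x. J h x - f x)
        \<le> 2 * ip T (d n) (d n) + 2 * (3 * T\<^sup>2 * ip T (e n) (e n))" for n
      using ip_lincomb_le[OF d[of n] AP_J[OF e[of n]], of 1 "-1"] ip_J_le[OF e[of n]]
      unfolding eq[of n] by simp
    then show "\<exists>N. \<forall>n\<ge>N. ip T (\<lambda>x. J h x - f x) (\<lambda>x. J h x - f x)
        \<le> 2 * ip T (d n) (d n) + 2 * (3 * T\<^sup>2 * ip T (e n) (e n))" by blast
    show "(\<lambda>n. 2 * ip T (d n) (d n) + 2 * (3 * T\<^sup>2 * ip T (e n) (e n))) \<longlonglongrightarrow> 0"
      by (rule tendsto_eq_intros e0 conv refl | simp)+
  qed
  then have "J h x - f x = 0" for x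
    using ip_eq_0D[OF antiperiodic_diff[OF AP_J[OF h] f] T_pos] by blast
  then have Jh: "J h = f" by (simp add: fun_eq_iff)
  have "pencil_op \<mu> h x = 0" for x
    unfolding pencil_op_def Jh using eps_pos by (simp add: h_def)
  moreover have "\<exists>x. h x \<noteq> 0"
  proof (rule ccontr)
    assume "\<nexists>x. h x \<noteq> 0"
    then have "e n = hs n" for n unfolding e_def by simp
    then have "(\<lambda>n. 1 :: real) \<longlonglongrightarrow> 0" using e0 hs(2) by simp
    then show False by (simp add: LIMSEQ_const_iff)
  qed
  ultimately show ?thesis using h by blast
qed

lemma pencil_form_tendsto: "((\<lambda>\<mu>. pencil_form \<mu> h h) \<longlongrightarrow> pencil_form \<mu>0 h h) (at_right \<mu>0)"
  unfolding pencil_form_def by (intro tendsto_intros)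

lemma pencil_form_neg_open:
  assumes "pencil_form \<mu>0 h h < 0"
  shows "\<exists>\<mu>>\<mu>0. pencil_form \<mu> h h < 0"
proof -
  have "\<forall>\<^sub>F \<mu> in at_right \<mu>0. pencil_form \<mu> h h < 0"
    by (rule order_tendstoD(2)[OF pencil_form_tendsto assms])
  then have "\<forall>\<^sub>F \<mu> in at_right \<mu>0. \<mu>0 < \<mu> \<and> pencil_form \<mu> h h < 0"
    using eventually_at_right_less eventually_conj by blast
  then show ?thesis
    using eventually_happens[of _ "at_right \<mu>0"] by (auto simp: trivial_limit_at_right_real)
qed

text \<open>A negative value forces \<open>h\<close> to be nonzero in norm, since the only term of the form without a sign is
  bounded by a multiple of \<open>ip T h h\<close>.\<close>

lemma pencil_form_normalize:
  assumes h: "AP h" and neg: "pencil_form \<mu> h h < 0" and "0 \<le> \<mu>"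
  shows "\<exists>k. AP k \<and> ip T k k = 1 \<and> pencil_form \<mu> k k \<le> 0"
proof -
  have "0 \<le> \<mu>\<^sup>2 * ip T (J (J h)) (J (J h))" "0 \<le> \<mu> * c * ip T (J h) (J h)" "0 \<le> \<epsilon> * ip T h h"
    using ip_nonneg[OF AP_J[OF AP_J[OF h]]] ip_nonneg[OF AP_J[OF h]] ip_nonneg[OF h]
      assms(3) c_pos eps_pos by simp_all
  then have "0 < ip T (\<lambda>x. q x * J h x) (J h)" using neg unfolding pencil_form_def by linarith
  also have "\<dots> \<le> K * ip T (J h) (J h)" using ip_q_le[OF AP_J[OF h]] by linarith
  also have "\<dots> \<le> K * (3 * T\<^sup>2 * ip T h h)" by (intro mult_left_mono ip_J_le h K_nonneg)
  finally have pos: "0 < ip T h h"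
    using K_nonneg ip_nonneg[OF h] by (metis less_le mult_zero_right)
  define a where "a = 1 / sqrt (ip T h h)"
  define k where "k = (\<lambda>x. a * h x + 0 * h x)"
  have a: "a\<^sup>2 = 1 / ip T h h" unfolding a_def using pos by (simp add: power_divide)
  have "AP k" unfolding k_def by (rule antiperiodic_lincomb[OF h h])
  moreover have "ip T k k = 1"
    unfolding k_def ip_lincomb_square[OF h h] using a pos by simp
  moreover have "pencil_form \<mu> k k \<le> 0"
    unfolding k_def pencil_form_lincomb_square[OF h h] using neg by (simp add: mult_nonneg_nonpos)
  ultimately show ?thesis by blast
qed

text \<open>Take the supremum of the parameters at which the form is negative somewhere. It is finite since the
  damping term \<open>\<mu> c\<close> eventually dominates \<open>q\<close>, and it is positive and not attained since negativity at
  a fixed function is an open condition on the parameter. A function at which the form is negative for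
  a slightly smaller parameter is almost minimizing at the supremum, uniformly on the unit sphere.\<close>

lemma critical_parameter:
  assumes "AP h0" "pencil_form 0 h0 h0 < 0"
  shows "\<exists>\<mu>>0. (\<forall>k. AP k \<longrightarrow> 0 \<le> pencil_form \<mu> k k)
      \<and> (\<forall>e>0. \<exists>h. AP h \<and> ip T h h = 1 \<and> pencil_form \<mu> h h \<le> e)"
proof -
  define A where "A = {\<mu>. 0 \<le> \<mu> \<and> (\<exists>h. AP h \<and> pencil_form \<mu> h h < 0)}"
  have bd: "\<mu> \<le> K / c" if "\<mu> \<in> A" for \<mu>
  proof (rule ccontr)
    assume "\<not> \<mu> \<le> K / c"
    then have "K \<le> \<mu> * c" using c_pos by (simp add: field_simps)
    have "0 \<le> \<mu>" "\<exists>h. AP h \<and> pencil_form \<mu> h h < 0" using that by (simp_all add: A_def)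
    then obtain h where h: "AP h" "pencil_form \<mu> h h < 0" by (elim exE conjE)
    have "ip T (\<lambda>x. q x * J h x) (J h) \<le> K * ip T (J h) (J h)"
      using ip_q_le[OF AP_J[OF h(1)]] by linarith
    also have "\<dots> \<le> \<mu> * c * ip T (J h) (J h)"
      by (intro mult_right_mono ip_nonneg AP_J h \<open>K \<le> \<mu> * c\<close>)
    finally have "ip T (\<lambda>x. q x * J h x) (J h) \<le> \<mu> * c * ip T (J h) (J h)" .
    moreover have "0 \<le> \<epsilon> * ip T h h" "0 \<le> \<mu>\<^sup>2 * ip T (J (J h)) (J (J h))"
      using ip_nonneg[OF h(1)] ip_nonneg[OF AP_J[OF AP_J[OF h(1)]]] eps_pos by simp_all
    ultimately have "0 \<le> pencil_form \<mu> h h" unfolding pencil_form_def by linarith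
    with h show False by simp
  qed
  then have bdd: "bdd_above A" by (rule bdd_aboveI)
  define \<Lambda> where "\<Lambda> = Sup A"
  have "0 \<in> A" using assms unfolding A_def by auto
  obtain \<mu>1 where \<mu>1: "0 < \<mu>1" "pencil_form \<mu>1 h0 h0 < 0" using pencil_form_neg_open[OF assms(2)] by blast
  then have "\<mu>1 \<in> A" using assms(1) unfolding A_def by auto
  then have pos: "0 < \<Lambda>" using \<mu>1(1) cSup_upper[OF _ bdd] unfolding \<Lambda>_def by fastforce
  have nonneg: "0 \<le> pencil_form \<Lambda> k k" if k: "AP k" for k
  proof (rule ccontr)
    assume "\<not> 0 \<le> pencil_form \<Lambda> k k"
    then obtain \<mu> where "\<Lambda> < \<mu>" "pencil_form \<mu> k k < 0" using pencil_form_neg_open[of \<Lambda> k] by auto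
    then have "\<mu> \<in> A" using k pos unfolding A_def by auto
    then show False using cSup_upper[OF _ bdd] \<open>\<Lambda> < \<mu>\<close> unfolding \<Lambda>_def by fastforce
  qed
  have almost: "\<exists>h. AP h \<and> ip T h h = 1 \<and> pencil_form \<Lambda> h h \<le> e" if "0 < e" for e
  proof -
    (* the largest increase of the form on the unit sphere when the parameter grows to the supremum *)
    define g where "g \<mu> = (\<Lambda>\<^sup>2 - \<mu>\<^sup>2) * (3 * T\<^sup>2)\<^sup>2 + (\<Lambda> - \<mu>) * c * (3 * T\<^sup>2)" for \<mu>
    have "(g \<longlongrightarrow> g \<Lambda>) (at \<Lambda>)" unfolding g_def by (intro tendsto_intros)
    moreover have "g \<Lambda> < e" using that unfolding g_def by simp
    ultimately have "\<forall>\<^sub>F \<mu> in at \<Lambda>. g \<mu> < e" by (rule order_tendstoD(2))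
    then obtain d where d: "0 < d" "\<And>\<mu>. \<mu> \<noteq> \<Lambda> \<Longrightarrow> dist \<mu> \<Lambda> < d \<Longrightarrow> g \<mu> < e"
      unfolding eventually_at by auto
    obtain \<mu> where \<mu>: "\<mu> \<in> A" "\<Lambda> - d < \<mu>"
      using less_cSup_iff[OF _ bdd, of "\<Lambda> - d"] d(1) \<open>0 \<in> A\<close> unfolding \<Lambda>_def by auto
    have le: "\<mu> \<le> \<Lambda>" unfolding \<Lambda>_def by (rule cSup_upper[OF \<mu>(1) bdd])
    have "g \<mu> < e"
      using d(2)[of \<mu>] \<open>g \<Lambda> < e\<close> le \<mu>(2) by (cases "\<mu> = \<Lambda>") (auto simp: dist_real_def)
    have "0 \<le> \<mu>" "\<exists>h. AP h \<and> pencil_form \<mu> h h < 0" using \<mu>(1) by (simp_all add: A_def)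
    then obtain h where h: "AP h" "pencil_form \<mu> h h < 0" by (elim exE conjE)
    obtain k where k: "AP k" "ip T k k = 1" "pencil_form \<mu> k k \<le> 0"
      using pencil_form_normalize[OF h \<open>0 \<le> \<mu>\<close>] by (elim exE conjE)
    have "pencil_form \<Lambda> k k = pencil_form \<mu> k k + (\<Lambda>\<^sup>2 - \<mu>\<^sup>2) * ip T (J (J k)) (J (J k))
        + (\<Lambda> - \<mu>) * c * ip T (J k) (J k)"
      unfolding pencil_form_def by (simp add: algebra_simps)
    moreover have "(\<Lambda>\<^sup>2 - \<mu>\<^sup>2) * ip T (J (J k)) (J (J k)) \<le> (\<Lambda>\<^sup>2 - \<mu>\<^sup>2) * (3 * T\<^sup>2)\<^sup>2"
      using ip_JJ_le[OF k(1)] k(2) le \<open>0 \<le> \<mu>\<close> by (intro mult_left_mono) (auto simp: power_mono)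
    moreover have "(\<Lambda> - \<mu>) * c * ip T (J k) (J k) \<le> (\<Lambda> - \<mu>) * c * (3 * T\<^sup>2)"
      using ip_J_le[OF k(1)] k(2) le c_pos by (intro mult_left_mono) auto
    ultimately have "pencil_form \<Lambda> k k \<le> g \<mu>" using k(3) unfolding g_def by linarith
    then show ?thesis using k \<open>g \<mu> < e\<close> by (intro exI[of _ k]) auto
  qed
  show ?thesis using pos nonneg almost by blast
qed

text \<open>The minimizer at the critical parameter, expressed through \<open>f = J h\<close> and its derivative.\<close>

lemma pencil_eigenfunction:
  assumes "AP h0" "pencil_form 0 h0 h0 < 0"
  obtains \<mu> f h where "0 < \<mu>" "AP f" "AP h" "\<exists>x. f x \<noteq> 0"
    "\<And>x. (f has_real_derivative h x) (at x)"
    "\<And>x. (h has_real_derivative (pencil_lower \<mu> f x / \<epsilon>)) (at x)"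
proof -
  obtain \<mu> where \<mu>: "0 < \<mu>" and "\<And>k. AP k \<Longrightarrow> 0 \<le> pencil_form \<mu> k k"
    "\<And>e. 0 < e \<Longrightarrow> \<exists>h. AP h \<and> ip T h h = 1 \<and> pencil_form \<mu> h h \<le> e"
    using critical_parameter[OF assms] by blast
  then obtain h where h: "AP h" "\<exists>x. h x \<noteq> 0" "\<And>x. pencil_op \<mu> h x = 0"
    using kernel_from_minimizing_sequence[of \<mu>] by auto
  have h_eq: "h = (\<lambda>x. J (pencil_lower \<mu> (J h)) x / \<epsilon>)"
    using h(3) eps_pos unfolding pencil_op_def by (auto simp: field_simps)
  have "((\<lambda>x. J (pencil_lower \<mu> (J h)) x / \<epsilon>) has_real_derivative (pencil_lower \<mu> (J h) x / \<epsilon>)) (at x)" for x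
    by (intro DERIV_cdivide has_derivative_prim AP_lower AP_J h)
  then have D: "(h has_real_derivative (pencil_lower \<mu> (J h) x / \<epsilon>)) (at x)" for x
    by (subst h_eq)
  have nz: "\<exists>x. J h x \<noteq> 0"
  proof (rule ccontr)
    assume "\<nexists>x. J h x \<noteq> 0"
    then have "J h = (\<lambda>x. 0)" by (simp add: fun_eq_iff)
    then have "((\<lambda>x. 0) has_real_derivative h x) (at x)" for x
      using has_derivative_prim[OF h(1), of x] by simp
    then have "h x = 0" for x using DERIV_const DERIV_unique by blast
    with h(2) show False by simp
  qed
  show ?thesis
    by (rule that[OF \<mu> AP_J[OF h(1)] h(1) nz has_derivative_prim[OF h(1)] D])
qed

end

section \<open>A direction of negative energy\<close>

text \<open>Jordan's inequality: the sine is concave on \<open>[0, \<pi> / 2]\<close> and lies above its chord.\<close>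

lemma jordan_sine:
  assumes "0 \<le> y" "y \<le> pi / 2"
  shows "2 / pi * y \<le> sin y"
proof -
  have "concave_on {0..pi/2} sin"
  proof (rule f''_le0_imp_concave[where f' = cos and f'' = "\<lambda>x. - sin x"])
    show "- sin x \<le> 0" if "x \<in> {0..pi/2}" for x
      using that sin_ge_zero[of x] by simp
  qed (auto intro!: derivative_eq_intros)
  from concave_onD_Icc'[OF this, of y] assms show ?thesis by simp
qed

lemma integral_scaled_diff_add:
  fixes f g h :: "real \<Rightarrow> real"
  assumes "f integrable_on S" "g integrable_on S" "h integrable_on S"
  shows "integral S (\<lambda>x. a * f x - g x + b * h x) = a * integral S f - integral S g + b * integral S h"
  using assms by (simp add: integral_add integral_diff integrable_diff integrable_on_mult_right)

context antiperiodic_pencil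
begin

text \<open>Here \<open>\<phi>\<close> is a \<open>T\<close>-periodic solution of \<open>\<epsilon> \<phi>'' + q \<phi> = 0\<close> with a simple zero at \<open>0\<close>. Its square-wave
  multiple \<open>\<sigma> \<phi>\<close>, with \<open>\<sigma> = 1\<close> on \<open>(0, T)\<close> and antiperiodic, has energy zero. Paired with a
  smooth antiperiodic \<open>g\<close> in the energy form it gives \<open>\<epsilon> (\<phi>' T * g T - \<phi>' 0 * g 0) = - 2 \<epsilon> \<phi>' 0 * g 0\<close>,
  the contribution of the corner, which is nonzero for \<open>g = cos (\<pi> x / T)\<close>. So the energy is
  negative at \<open>\<sigma> \<phi> + \<delta> g\<close> for small \<open>\<delta>\<close> of the right sign. Because the form is defined on functions
  with continuous derivative, \<open>\<sigma>\<close> is replaced by \<open>\<psi> d = s / sqrt (s\<^sup>2 + d\<^sup>2)\<close> with \<open>s = sin (\<pi> x / T)\<close>,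
  which converges to \<open>\<sigma>\<close> as \<open>d\<close> tends to \<open>0\<close>. The error in the energy is
  \<open>\<epsilon> \<integral> \<phi>\<^sup>2 \<psi>'\<^sup>2\<close>; since \<open>\<phi>\<close> vanishes where \<open>s\<close> does, its integrand is bounded and dominated
  convergence makes the error disappear.\<close>

lemma negative_direction:
  assumes \<phi>: "\<And>x. (\<phi> has_real_derivative \<phi>1 x) (at x)"
    and \<phi>1: "\<And>x. (\<phi>1 has_real_derivative (- q x * \<phi> x / \<epsilon>)) (at x)"
    and per: "\<And>x. \<phi> (x + T) = \<phi> x" and zero: "\<phi> 0 = 0" and nz: "\<phi>1 0 \<noteq> 0"
  shows "\<exists>h. AP h \<and> pencil_form 0 h h < 0"
proof -
  note per1 = derivative_periodic[OF \<phi> per]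
  have \<phi>T: "\<phi> T = 0" "\<phi>1 T = \<phi>1 0" using per[of 0] per1[of 0] zero by simp_all
  have cont: "continuous_on A \<phi>" "continuous_on A \<phi>1" for A
    by (rule has_real_derivative_imp_continuous_on[OF \<phi>], rule has_real_derivative_imp_continuous_on[OF \<phi>1])
  have contq: "continuous_on A q" for A using q_continuous continuous_on_subset by blast
  define \<omega> where "\<omega> = pi / T"
  have \<omega>T: "\<omega> * T = pi" "\<omega> > 0" using T_pos by (auto simp: \<omega>_def)
  have shift: "sin (\<omega> * (x + T)) = - sin (\<omega> * x)" "cos (\<omega> * (x + T)) = - cos (\<omega> * x)" for x
    by (simp_all add: distrib_left \<omega>T)
  have cancel: "inverse a / 2 * (2 * s * t) = s * t / a" for a s t :: real
    by (cases "a = 0") (simp_all add: field_simps)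
  define r where "r d x = sqrt ((sin (\<omega> * x))\<^sup>2 + d\<^sup>2)" for d x
  have r: "0 < r d x" "(r d x)\<^sup>2 = (sin (\<omega> * x))\<^sup>2 + d\<^sup>2" if "0 < d" for d x
    using that by (auto simp: r_def add_nonneg_pos)
  define \<psi> where "\<psi> d x = sin (\<omega> * x) / r d x" for d x
  define \<psi>1 where "\<psi>1 d x = d\<^sup>2 * (\<omega> * cos (\<omega> * x)) / (r d x) ^ 3" for d x
  have r': "(r d has_real_derivative (sin (\<omega> * x) * (\<omega> * cos (\<omega> * x)) / r d x)) (at x)" if "0 < d" for d x
  proof -
    have 1: "((\<lambda>x. (sin (\<omega> * x))\<^sup>2 + d\<^sup>2) has_real_derivative (2 * sin (\<omega> * x) * (\<omega> * cos (\<omega> * x)))) (at x)"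
      by (auto intro!: derivative_eq_intros)
    have 2: "0 < (sin (\<omega> * x))\<^sup>2 + d\<^sup>2" using that by (simp add: add_nonneg_pos)
    have "(r d has_real_derivative (inverse (r d x) / 2 * (2 * sin (\<omega> * x) * (\<omega> * cos (\<omega> * x))))) (at x)"
      unfolding r_def by (rule DERIV_chain2[where f = sqrt and g = "\<lambda>x. (sin (\<omega> * x))\<^sup>2 + d\<^sup>2", OF DERIV_real_sqrt[OF 2] 1])
    then show ?thesis by (rule DERIV_cong) (rule cancel)
  qed
  have \<psi>': "(\<psi> d has_real_derivative \<psi>1 d x) (at x)" if "0 < d" for d x
  proof -
    have sn: "((\<lambda>x. sin (\<omega> * x)) has_real_derivative (\<omega> * cos (\<omega> * x))) (at x)"
      by (auto intro!: derivative_eq_intros)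
    have "r d x \<noteq> 0" using r(1)[OF that, of x] by simp
    from DERIV_divide[OF sn r'[OF that] this]
    have "(\<psi> d has_real_derivative ((\<omega> * cos (\<omega> * x) * r d x
        - sin (\<omega> * x) * (sin (\<omega> * x) * (\<omega> * cos (\<omega> * x)) / r d x)) / (r d x * r d x))) (at x)"
      unfolding \<psi>_def .
    moreover have "(\<omega> * cos (\<omega> * x) * r d x
        - sin (\<omega> * x) * (sin (\<omega> * x) * (\<omega> * cos (\<omega> * x)) / r d x)) / (r d x * r d x)
        = (\<omega> * cos (\<omega> * x)) * ((r d x)\<^sup>2 - (sin (\<omega> * x))\<^sup>2) / (r d x) ^ 3"
      using \<open>r d x \<noteq> 0\<close> by (simp add: field_simps power2_eq_square power3_eq_cube)
    ultimately show ?thesis unfolding \<psi>1_def r(2)[OF that] by (simp add: mult.commute)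
  qed
  have \<psi>_shift: "\<psi> d (x + T) = - \<psi> d x" "\<psi>1 d (x + T) = - \<psi>1 d x" for d x
    unfolding \<psi>_def \<psi>1_def r_def by (simp_all add: shift)
  have cont\<psi>: "continuous_on A (\<psi> d)" "continuous_on A (\<psi>1 d)" if "0 < d" for A d
  proof -
    show "continuous_on A (\<psi> d)" by (rule has_real_derivative_imp_continuous_on[OF \<psi>'[OF that]])
    have "continuous_on A (r d)" by (rule has_real_derivative_imp_continuous_on[OF r'[OF that]])
    then show "continuous_on A (\<psi>1 d)"
      unfolding \<psi>1_def using r(1)[OF that] by (intro continuous_intros) (auto simp: less_le)
  qed
  define h1 where "h1 d x = \<psi>1 d x * \<phi> x + \<psi> d x * \<phi>1 x" for d x
  define f1 where "f1 d x = \<psi> d x * \<phi> x" for d x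
  have f1': "(f1 d has_real_derivative h1 d x) (at x)" if "0 < d" for d x
    unfolding f1_def h1_def using DERIV_mult[OF \<psi>'[OF that] \<phi>] by (simp add: mult.commute)
  have AP1: "AP (h1 d)" "AP (f1 d)" if "0 < d" for d
    unfolding antiperiodic_def h1_def f1_def
    by (auto intro!: continuous_intros cont cont\<psi> that simp: per per1 \<psi>_shift)
  have J1: "J (h1 d) = f1 d" if "0 < d" for d
    by (rule prim_eqI) (use AP1 f1' that in auto)
  define g where "g x = cos (\<omega> * x)" for x
  define g1 where "g1 x = - \<omega> * sin (\<omega> * x)" for x
  define g2 where "g2 x = - \<omega>\<^sup>2 * cos (\<omega> * x)" for x
  have g': "(g has_real_derivative g1 x) (at x)" "(g1 has_real_derivative g2 x) (at x)" for x
    unfolding g_def g1_def g2_def by (auto intro!: derivative_eq_intros simp: power2_eq_square)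
  have APg: "AP g" "AP g1"
    unfolding antiperiodic_def g_def g1_def by (auto intro!: continuous_intros simp: shift)
  have Jg: "J g1 = g" by (rule prim_eqI) (use APg g' in auto)
  have g2c: "continuous_on A g2" for A unfolding g2_def by (intro continuous_intros)
  (* multiplying a solution by psi changes the energy only through the derivative of psi *)
  have A: "pencil_form 0 (h1 d) (h1 d) = integral {0..T} (\<lambda>x. \<epsilon> * (\<phi> x)\<^sup>2 * (\<psi>1 d x)\<^sup>2)" if d: "0 < d" for d
  proof -
    define E where "E x = \<epsilon> * ((\<psi> d x)\<^sup>2 * (\<phi> x * \<phi>1 x))" for x
    have "(E has_real_derivative
       (\<epsilon> * (h1 d x * h1 d x) - q x * f1 d x * f1 d x + (-1) * (\<epsilon> * (\<phi> x)\<^sup>2 * (\<psi>1 d x)\<^sup>2))) (at x)" for x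
      unfolding E_def h1_def f1_def using eps_pos
      by (auto intro!: derivative_eq_intros \<psi>'[OF d] \<phi> \<phi>1 simp: field_simps power2_eq_square)
    from has_integral_of_derivative[OF this, of 0 T] T_pos
    have "((\<lambda>x. \<epsilon> * (h1 d x * h1 d x) - q x * f1 d x * f1 d x + (-1) * (\<epsilon> * (\<phi> x)\<^sup>2 * (\<psi>1 d x)\<^sup>2)) has_integral 0) {0..T}"
      by (simp add: E_def zero \<phi>T)
    then have "integral {0..T} (\<lambda>x. \<epsilon> * (h1 d x * h1 d x) - q x * f1 d x * f1 d x + (-1) * (\<epsilon> * (\<phi> x)\<^sup>2 * (\<psi>1 d x)\<^sup>2)) = 0"
      by (rule integral_unique)
    moreover have I: "(\<lambda>x. h1 d x * h1 d x) integrable_on {0..T}" "(\<lambda>x. q x * f1 d x * f1 d x) integrable_on {0..T}"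
      "(\<lambda>x. \<epsilon> * (\<phi> x)\<^sup>2 * (\<psi>1 d x)\<^sup>2) integrable_on {0..T}"
      by (intro integrable_continuous_real continuous_intros antiperiodic_continuous[OF AP1(1)]
          antiperiodic_continuous[OF AP1(2)] contq cont cont\<psi> d)+
    ultimately show ?thesis
      using integral_scaled_diff_add[OF I, of \<epsilon> "-1"] unfolding pencil_form_def ip_def J1[OF d] by simp
  qed
  (* integration by parts moves both derivatives to g; the boundary terms vanish with phi *)
  have B: "pencil_form 0 (h1 d) g1 = - integral {0..T} (\<lambda>x. f1 d x * (\<epsilon> * g2 x + q x * g x))" if d: "0 < d" for d
  proof -
    define E where "E x = \<epsilon> * (f1 d x * g1 x)" for x
    have "(E has_real_derivative (\<epsilon> * (h1 d x * g1 x) - q x * f1 d x * g x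
        + f1 d x * (\<epsilon> * g2 x + q x * g x))) (at x)" for x
      unfolding E_def by (auto intro!: derivative_eq_intros f1'[OF d] g' simp: algebra_simps)
    from has_integral_of_derivative[OF this, of 0 T] T_pos
    have "((\<lambda>x. \<epsilon> * (h1 d x * g1 x) - q x * f1 d x * g x
        + 1 * (f1 d x * (\<epsilon> * g2 x + q x * g x))) has_integral 0) {0..T}"
      by (simp add: E_def f1_def zero \<phi>T)
    then have "integral {0..T} (\<lambda>x. \<epsilon> * (h1 d x * g1 x) - q x * f1 d x * g x
        + 1 * (f1 d x * (\<epsilon> * g2 x + q x * g x))) = 0"
      by (rule integral_unique)
    moreover have I: "(\<lambda>x. h1 d x * g1 x) integrable_on {0..T}" "(\<lambda>x. q x * f1 d x * g x) integrable_on {0..T}"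
      "(\<lambda>x. f1 d x * (\<epsilon> * g2 x + q x * g x)) integrable_on {0..T}"
      by (intro integrable_continuous_real continuous_intros antiperiodic_continuous[OF AP1(1)]
          antiperiodic_continuous[OF AP1(2)] antiperiodic_continuous[OF APg(1)]
          antiperiodic_continuous[OF APg(2)] g2c contq d)+
    ultimately show ?thesis
      using integral_scaled_diff_add[OF I, of \<epsilon> 1] unfolding pencil_form_def ip_def J1[OF d] Jg by simp
  qed
  obtain M where "\<forall>y \<in> \<phi>1 ` {0..T}. norm y \<le> M"
    using compact_imp_bounded[OF compact_continuous_image[OF cont(2) compact_Icc, of 0 T]]
    unfolding bounded_iff by blast
  then have M: "\<bar>\<phi>1 x\<bar> \<le> M" if "x \<in> {0..T}" for x using that by auto
  have Mnn: "0 \<le> M" using M[of 0] T_pos by fastforce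
  have lip: "\<bar>\<phi> y - \<phi> x\<bar> \<le> M * (y - x)" if xy: "0 \<le> x" "x \<le> y" "y \<le> T" for x y
  proof (cases "x = y")
    case False
    then obtain z where "x < z" "z < y" "\<phi> y - \<phi> x = (y - x) * \<phi>1 z"
      using MVT2[of x y \<phi> \<phi>1] \<phi> xy by force
    then show ?thesis using M[of z] xy by (simp add: abs_mult mult.commute mult_left_mono)
  qed simp
  (* phi vanishes at both ends of the period, at least as fast as the sine *)
  define C where "C = M * T / 2"
  have \<phi>s: "\<bar>\<phi> x\<bar> \<le> C * sin (\<omega> * x)" if x: "x \<in> {0..T}" for x
  proof (cases "x \<le> T / 2")
    case True
    have "\<omega> * x \<le> pi / 2" using True T_pos unfolding \<omega>_def by (simp add: field_simps)
    then have "2 / pi * (\<omega> * x) \<le> sin (\<omega> * x)" using jordan_sine[of "\<omega> * x"] x \<omega>T by auto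
    then have "C * (2 / pi * (\<omega> * x)) \<le> C * sin (\<omega> * x)"
      using Mnn T_pos by (intro mult_left_mono) (auto simp: C_def)
    moreover have "C * (2 / pi * (\<omega> * x)) = M * x" using T_pos by (simp add: C_def \<omega>_def)
    ultimately show ?thesis using lip[of 0 x] x zero by auto
  next
    case False
    have "\<omega> * (T - x) \<le> pi / 2" using False T_pos unfolding \<omega>_def by (simp add: field_simps)
    then have "2 / pi * (\<omega> * (T - x)) \<le> sin (\<omega> * (T - x))"
      using jordan_sine[of "\<omega> * (T - x)"] x \<omega>T by auto
    moreover have "sin (\<omega> * (T - x)) = sin (\<omega> * x)"
      by (simp add: right_diff_distrib \<omega>T sin_diff)
    ultimately have "C * (2 / pi * (\<omega> * (T - x))) \<le> C * sin (\<omega> * x)"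
      using Mnn T_pos by (intro mult_left_mono) (auto simp: C_def)
    moreover have "C * (2 / pi * (\<omega> * (T - x))) = M * (T - x)" using T_pos by (simp add: C_def \<omega>_def)
    ultimately show ?thesis using lip[of x T] x \<phi>T by auto
  qed
  define dn where "dn n = 1 / real (Suc n)" for n
  have dn: "0 < dn n" for n unfolding dn_def by simp
  have dn0: "dn \<longlonglongrightarrow> 0"
    unfolding dn_def using LIMSEQ_inverse_real_of_nat by (simp add: inverse_eq_divide)
  have limA: "(\<lambda>n. pencil_form 0 (h1 (dn n)) (h1 (dn n))) \<longlonglongrightarrow> 0"
  proof -
    have "(\<lambda>n. integral {0..T} (\<lambda>x. \<epsilon> * (\<phi> x)\<^sup>2 * (\<psi>1 (dn n) x)\<^sup>2)) \<longlonglongrightarrow> integral {0..T} (\<lambda>x. 0)"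
    proof (rule dominated_convergence(2))
      show "(\<lambda>x. \<epsilon> * (\<phi> x)\<^sup>2 * (\<psi>1 (dn n) x)\<^sup>2) integrable_on {0..T}" for n
        by (intro integrable_continuous_real continuous_intros cont cont\<psi> dn)
      show "(\<lambda>x. \<epsilon> * (C\<^sup>2 * \<omega>\<^sup>2)) integrable_on {0..T}"
        by (intro integrable_continuous_real continuous_intros)
      show "norm (\<epsilon> * (\<phi> x)\<^sup>2 * (\<psi>1 (dn n) x)\<^sup>2) \<le> \<epsilon> * (C\<^sup>2 * \<omega>\<^sup>2)" if x: "x \<in> {0..T}" for n x
      proof -
        define s where "s = sin (\<omega> * x)"
        define D where "D = dn n"
        define R where "R = (r D x)\<^sup>2"
        have R: "R = s\<^sup>2 + D\<^sup>2" unfolding R_def D_def s_def by (rule r(2)[OF dn])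
        have R_pos: "0 < R" unfolding R_def D_def using r(1)[OF dn[of n], of x] by simp
        have "(\<phi> x)\<^sup>2 \<le> C\<^sup>2 * s\<^sup>2"
          using power_mono[OF \<phi>s[OF x], of 2] by (simp add: s_def power_mult_distrib)
        moreover have "(\<psi>1 D x)\<^sup>2 = (D\<^sup>2)\<^sup>2 * (\<omega>\<^sup>2 * (cos (\<omega> * x))\<^sup>2) / R ^ 3"
          unfolding \<psi>1_def R_def by (simp add: power_divide power_mult_distrib flip: power_mult)
        moreover have "(D\<^sup>2)\<^sup>2 * (\<omega>\<^sup>2 * (cos (\<omega> * x))\<^sup>2) / R ^ 3 \<le> (D\<^sup>2)\<^sup>2 * (\<omega>\<^sup>2 * 1) / R ^ 3"
          using R_pos by (intro divide_right_mono mult_left_mono) (auto simp: abs_square_le_1)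
        ultimately have "(\<phi> x)\<^sup>2 * (\<psi>1 D x)\<^sup>2 \<le> (C\<^sup>2 * s\<^sup>2) * ((D\<^sup>2)\<^sup>2 * \<omega>\<^sup>2 / R ^ 3)"
          by (intro mult_mono) (use R_pos in auto)
        also have "\<dots> = C\<^sup>2 * \<omega>\<^sup>2 * ((s\<^sup>2 * (D\<^sup>2)\<^sup>2) / R ^ 3)" by simp
        also have "\<dots> \<le> C\<^sup>2 * \<omega>\<^sup>2 * 1"
        proof (intro mult_left_mono)
          have "s\<^sup>2 * (D\<^sup>2)\<^sup>2 \<le> R * R\<^sup>2"
            by (intro mult_mono power_mono) (auto simp: R)
          then show "s\<^sup>2 * (D\<^sup>2)\<^sup>2 / R ^ 3 \<le> 1"
            using R_pos by (simp add: power3_eq_cube power2_eq_square)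
        qed simp
        finally show ?thesis using eps_pos unfolding D_def by (simp add: abs_mult mult.assoc)
      qed
      show "(\<lambda>n. \<epsilon> * (\<phi> x)\<^sup>2 * (\<psi>1 (dn n) x)\<^sup>2) \<longlonglongrightarrow> 0" if x: "x \<in> {0..T}" for x
      proof (cases "sin (\<omega> * x) = 0")
        case True
        then have "\<phi> x = 0" using \<phi>s[OF x] by simp
        then show ?thesis by simp
      next
        case False
        have rl: "(\<lambda>n. r (dn n) x) \<longlonglongrightarrow> r 0 x"
          unfolding r_def by (intro tendsto_intros dn0)
        have "r 0 x \<noteq> 0" using False unfolding r_def by simp
        then have "(\<lambda>n. \<psi>1 (dn n) x) \<longlonglongrightarrow> 0\<^sup>2 * (\<omega> * cos (\<omega> * x)) / (r 0 x) ^ 3"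
          unfolding \<psi>1_def by (intro tendsto_intros dn0 rl) simp
        then have "(\<lambda>n. \<epsilon> * (\<phi> x)\<^sup>2 * (\<psi>1 (dn n) x)\<^sup>2) \<longlonglongrightarrow> \<epsilon> * (\<phi> x)\<^sup>2 * 0\<^sup>2"
          by (intro tendsto_intros) simp
        then show ?thesis by simp
      qed
    qed
    then show ?thesis by (simp add: A[OF dn])
  qed
  have limB: "(\<lambda>n. pencil_form 0 (h1 (dn n)) g1) \<longlonglongrightarrow> - 2 * \<epsilon> * \<phi>1 0"
  proof -
    have "(\<lambda>n. integral {0..T} (\<lambda>x. f1 (dn n) x * (\<epsilon> * g2 x + q x * g x)))
        \<longlonglongrightarrow> integral {0..T} (\<lambda>x. \<phi> x * (\<epsilon> * g2 x + q x * g x))"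
    proof (rule dominated_convergence(2))
      show "(\<lambda>x. f1 (dn n) x * (\<epsilon> * g2 x + q x * g x)) integrable_on {0..T}" for n
        by (intro integrable_continuous_real continuous_intros antiperiodic_continuous[OF AP1(2)]
          antiperiodic_continuous[OF APg(1)] g2c contq dn)
      show "(\<lambda>x. \<bar>\<phi> x * (\<epsilon> * g2 x + q x * g x)\<bar>) integrable_on {0..T}"
        by (intro integrable_continuous_real continuous_intros
          antiperiodic_continuous[OF APg(1)] g2c contq cont)
      show "norm (f1 (dn n) x * (\<epsilon> * g2 x + q x * g x)) \<le> \<bar>\<phi> x * (\<epsilon> * g2 x + q x * g x)\<bar>" for n x
      proof -
        have "(sin (\<omega> * x))\<^sup>2 \<le> (r (dn n) x)\<^sup>2" using r(2)[OF dn[of n], of x] by simp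
        then have "\<bar>sin (\<omega> * x)\<bar> \<le> r (dn n) x"
          using r(1)[OF dn[of n], of x] abs_le_square_iff[of "sin (\<omega> * x)" "r (dn n) x"] by simp
        then have "\<bar>\<psi> (dn n) x\<bar> \<le> 1" unfolding \<psi>_def using r(1)[OF dn[of n], of x] by simp
        then show ?thesis
          unfolding f1_def using mult_right_mono[of "\<bar>\<psi> (dn n) x\<bar>" 1 "\<bar>\<phi> x * (\<epsilon> * g2 x + q x * g x)\<bar>"]
          by (simp add: abs_mult mult.assoc)
      qed
      show "(\<lambda>n. f1 (dn n) x * (\<epsilon> * g2 x + q x * g x)) \<longlonglongrightarrow> \<phi> x * (\<epsilon> * g2 x + q x * g x)"
        if x: "x \<in> {0..T}" for x
      proof (cases "sin (\<omega> * x) = 0")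
        case True
        then have "\<phi> x = 0" using \<phi>s[OF x] by simp
        then show ?thesis by (simp add: f1_def)
      next
        case False
        have "0 \<le> sin (\<omega> * x)"
        proof (rule sin_ge_zero)
          show "\<omega> * x \<le> pi" using x \<omega>T mult_left_mono[of x T \<omega>] by simp
        qed (use x \<omega>T in simp)
        have rl: "(\<lambda>n. r (dn n) x) \<longlonglongrightarrow> r 0 x"
          unfolding r_def by (intro tendsto_intros dn0)
        have r0: "r 0 x = sin (\<omega> * x)" using \<open>0 \<le> sin (\<omega> * x)\<close> unfolding r_def by simp
        have "(\<lambda>n. \<psi> (dn n) x) \<longlonglongrightarrow> sin (\<omega> * x) / r 0 x"
          unfolding \<psi>_def by (intro tendsto_intros rl) (use False r0 in simp)
        then have "(\<lambda>n. \<psi> (dn n) x) \<longlonglongrightarrow> 1" using r0 False by simp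
        then have "(\<lambda>n. f1 (dn n) x * (\<epsilon> * g2 x + q x * g x)) \<longlonglongrightarrow> 1 * \<phi> x * (\<epsilon> * g2 x + q x * g x)"
          unfolding f1_def by (intro tendsto_intros)
        then show ?thesis by simp
      qed
    qed
    (* Green's formula for phi and g leaves the derivative of phi at the two ends, with g T = - g 0 *)
    moreover have "integral {0..T} (\<lambda>x. \<phi> x * (\<epsilon> * g2 x + q x * g x)) = 2 * \<epsilon> * \<phi>1 0"
    proof -
      define E where "E x = \<epsilon> * (\<phi> x * g1 x - \<phi>1 x * g x)" for x
      have "(E has_real_derivative (\<phi> x * (\<epsilon> * g2 x + q x * g x))) (at x)" for x
        unfolding E_def using eps_pos
        by (auto intro!: derivative_eq_intros g' \<phi> \<phi>1 simp: field_simps)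
      from has_integral_of_derivative[OF this, of 0 T] T_pos
      have "((\<lambda>x. \<phi> x * (\<epsilon> * g2 x + q x * g x)) has_integral (E T - E 0)) {0..T}" by simp
      moreover have "E T - E 0 = 2 * \<epsilon> * \<phi>1 0"
        unfolding E_def g_def zero \<phi>T using \<omega>T by simp
      ultimately show ?thesis by (simp add: integral_unique)
    qed
    ultimately show ?thesis using tendsto_minus by (fastforce simp: B[OF dn])
  qed
  (* the energy at phi psi - t b g tends to - 2 t b^2 + t^2 b^2 G, negative for small t *)
  define b where "b = - 2 * \<epsilon> * \<phi>1 0"
  define G where "G = pencil_form 0 g1 g1"
  define t where "t = 1 / (\<bar>G\<bar> + 1)"
  have t: "0 < t" "t * G < 2"
  proof -
    show "0 < t" unfolding t_def by simp
    have "t * G \<le> t * (\<bar>G\<bar> + 1)" using \<open>0 < t\<close> by (intro mult_left_mono) auto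
    also have "\<dots> = 1" unfolding t_def by simp
    finally show "t * G < 2" by simp
  qed
  have "(\<lambda>n. 1\<^sup>2 * pencil_form 0 (h1 (dn n)) (h1 (dn n)) + 2 * 1 * (- t * b) * pencil_form 0 (h1 (dn n)) g1 + (- t * b)\<^sup>2 * G)
      \<longlonglongrightarrow> 1\<^sup>2 * 0 + 2 * 1 * (- t * b) * b + (- t * b)\<^sup>2 * G"
    using limA limB unfolding b_def[symmetric] by (intro tendsto_intros)
  then have "(\<lambda>n. pencil_form 0 (\<lambda>x. 1 * h1 (dn n) x + (- t * b) * g1 x) (\<lambda>x. 1 * h1 (dn n) x + (- t * b) * g1 x))
      \<longlonglongrightarrow> 1\<^sup>2 * 0 + 2 * 1 * (- t * b) * b + (- t * b)\<^sup>2 * G"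
    unfolding pencil_form_lincomb_square[OF AP1(1)[OF dn] APg(2)] G_def .
  moreover have "1\<^sup>2 * 0 + 2 * 1 * (- t * b) * b + (- t * b)\<^sup>2 * G < 0"
  proof -
    have "0 < t * b\<^sup>2" using t(1) nz eps_pos unfolding b_def by simp
    then have "t * b\<^sup>2 * (t * G - 2) < 0" using t(2) by (intro mult_pos_neg) auto
    then show ?thesis by (simp add: power2_eq_square algebra_simps)
  qed
  ultimately have "\<forall>\<^sub>F n in sequentially.
      pencil_form 0 (\<lambda>x. 1 * h1 (dn n) x + (- t * b) * g1 x) (\<lambda>x. 1 * h1 (dn n) x + (- t * b) * g1 x) < 0"
    by (rule order_tendstoD(2))
  then obtain n where
    "pencil_form 0 (\<lambda>x. 1 * h1 (dn n) x + (- t * b) * g1 x) (\<lambda>x. 1 * h1 (dn n) x + (- t * b) * g1 x) < 0"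
    by (auto simp: eventually_sequentially)
  then show ?thesis using antiperiodic_lincomb[OF AP1(1)[OF dn] APg(2)] by blast
qed

end

section \<open>From a bounded eigenfunction to the spectrum\<close>

definition cvec :: "real \<Rightarrow> real \<Rightarrow> complex^2" where
  "cvec a b = a *\<^sub>R axis 1 1 + b *\<^sub>R axis 2 1"

lemma cvec_nth [simp]: "cvec a b $ 1 = complex_of_real a" "cvec a b $ 2 = complex_of_real b"
  unfolding cvec_def by (simp_all add: axis_def of_real_def)

lemma cvec_eqI: "z $ 1 = complex_of_real a \<Longrightarrow> z $ 2 = complex_of_real b \<Longrightarrow> z = cvec a b"
  by (simp add: vec_eq_iff forall_2)

lemma cvec_eq_0_iff [simp]: "cvec a b = 0 \<longleftrightarrow> a = 0 \<and> b = 0"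
  by (simp add: vec_eq_iff forall_2)

lemma cvec_0 [simp]: "cvec 0 0 = 0"
  by simp

lemma norm_cvec: "norm (cvec a b) = sqrt (a\<^sup>2 + b\<^sup>2)"
  by (simp add: norm_vec_def L2_set_def sum_2)

lemma norm_cvec_le: "norm (cvec a b) \<le> \<bar>a\<bar> + \<bar>b\<bar>"
  unfolding norm_cvec by (rule sqrt_sum_squares_le_sum_abs)

lemma cvec_scale: "complex_of_real c *s cvec a b = cvec (c * a) (c * b)"
  by (rule cvec_eqI) simp_all

lemma norm_cvec_scale: "norm (cvec (c * a) (c * b)) = \<bar>c\<bar> * norm (cvec a b)"
  unfolding norm_cvec by (simp add: power_mult_distrib real_sqrt_mult flip: distrib_left)

lemma continuous_on_cvec:
  "continuous_on S a \<Longrightarrow> continuous_on S b \<Longrightarrow> continuous_on S (\<lambda>x. cvec (a x) (b x))"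
  unfolding cvec_def by (intro continuous_intros)

lemma has_vector_derivative_cvec:
  assumes "(a has_real_derivative a') (at x)" "(b has_real_derivative b') (at x)"
  shows "((\<lambda>x. cvec (a x) (b x)) has_vector_derivative cvec a' b') (at x)"
  unfolding cvec_def
  using has_vector_derivative_add[OF has_vector_derivative_scaleR[OF assms(1) has_vector_derivative_const]
      has_vector_derivative_scaleR[OF assms(2) has_vector_derivative_const]] by simp

lemma has_integral_cvec:
  assumes "(a has_integral A) S" "(b has_integral B) S"
  shows "((\<lambda>x. cvec (a x) (b x)) has_integral cvec A B) S"
  unfolding cvec_def by (intro has_integral_add has_integral_scaleR_left assms)

lemma lin_op_cvec:
  assumes "\<And>x. (v has_real_derivative v1 x) (at x)" "\<And>x. (u has_real_derivative u1 x) (at x)"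
    and "\<And>x. ((\<lambda>x. deriv p (U x $ 1)) has_real_derivative k1 x) (at x)"
  shows "lin_op \<epsilon>1 \<epsilon>2 p U (\<lambda>x. cvec (v x) (u x)) (\<lambda>x. cvec (v2 x) (u2 x)) x
    = cvec (\<epsilon>1 * v2 x + u1 x) (\<epsilon>2 * u2 x - (k1 x * v x + deriv p (U x $ 1) * v1 x))"
proof -
  have "cmat (dflux p (U y)) *v cvec (v y) (u y) = cvec (- u y) (deriv p (U y $ 1) * v y)" for y
    by (rule cvec_eqI) (simp_all add: matrix_vector_mult_def cmat_def dflux_def sum_2)
  moreover have "((\<lambda>y. cvec (- u y) (deriv p (U y $ 1) * v y)) has_vector_derivative
      cvec (- u1 x) (k1 x * v x + deriv p (U x $ 1) * v1 x)) (at x)"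
    by (rule has_vector_derivative_cvec)
       (use assms DERIV_mult[OF assms(3)[of x] assms(1)[of x]] in \<open>auto intro!: derivative_eq_intros simp: mult_ac\<close>)
  ultimately have "vector_derivative (\<lambda>y. cmat (dflux p (U y)) *v cvec (v y) (u y)) (at x)
      = cvec (- u1 x) (k1 x * v x + deriv p (U x $ 1) * v1 x)"
    by (simp add: vector_derivative_at)
  moreover have "cmat (visc \<epsilon>1 \<epsilon>2) *v cvec (v2 x) (u2 x) = cvec (\<epsilon>1 * v2 x) (\<epsilon>2 * u2 x)"
    by (rule cvec_eqI) (simp_all add: matrix_vector_mult_def cmat_def visc_def sum_2)
  ultimately show ?thesis
    unfolding lin_op_def by (intro cvec_eqI) simp_all
qed

text \<open>For real parameters and twice continuously differentiable real functions the resolvent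
  equation holds pointwise, and its right-hand side can be computed.\<close>

lemma resolvent_solution_cvec:
  assumes v: "\<And>x. (v has_real_derivative v1 x) (at x)" "\<And>x. (v1 has_real_derivative v2 x) (at x)"
    and u: "\<And>x. (u has_real_derivative u1 x) (at x)" "\<And>x. (u1 has_real_derivative u2 x) (at x)"
    and k: "\<And>x. ((\<lambda>x. deriv p (U x $ 1)) has_real_derivative k1 x) (at x)"
    and Lq: "Lq q (\<lambda>x. cvec (v x) (u x))" "Lq q (\<lambda>x. cvec (v1 x) (u1 x))" "Lq q (\<lambda>x. cvec (v2 x) (u2 x))"
    and g: "\<And>x. g x = cvec (\<mu> * v x - (\<epsilon>1 * v2 x + u1 x))
        (\<mu> * u x - (\<epsilon>2 * u2 x - (k1 x * v x + deriv p (U x $ 1) * v1 x)))"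
  shows "resolvent_solution \<epsilon>1 \<epsilon>2 p U q (complex_of_real \<mu>) g (\<lambda>x. cvec (v x) (u x))"
proof -
  have diff: "cvec a b - cvec c d = cvec (a - c) (b - d)" for a b c d
    by (rule cvec_eqI) simp_all
  have "sobolev2 q (\<lambda>x. cvec (v x) (u x)) (\<lambda>x. cvec (v1 x) (u1 x)) (\<lambda>x. cvec (v2 x) (u2 x))"
    unfolding sobolev2_def diff
    by (intro conjI allI impI Lq has_vector_derivative_cvec v u has_integral_cvec has_integral_of_derivative)
  moreover have "complex_of_real \<mu> *s cvec (v x) (u x)
      - lin_op \<epsilon>1 \<epsilon>2 p U (\<lambda>x. cvec (v x) (u x)) (\<lambda>x. cvec (v2 x) (u2 x)) x = g x" for x
    unfolding lin_op_cvec[OF v(1) u(1) k] cvec_scale diff g by simp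
  ultimately show ?thesis unfolding resolvent_solution_def by (intro exI conjI) auto
qed

lemma Lq_bounded_continuous:
  assumes "continuous_on UNIV g" "\<And>x. norm (g x) \<le> C"
  shows "Lq \<infinity> g"
  unfolding Lq_def using assms borel_measurable_continuous_onI[OF assms(1)] by auto

lemma enn2real_ge_1:
  assumes "1 \<le> q" "q \<noteq> (\<infinity>::ennreal)"
  shows "1 \<le> enn2real q"
proof -
  have "enn2real 1 \<le> enn2real q" using assms by (intro enn2real_mono) (auto simp: top.not_eq_extremum)
  then show ?thesis by simp
qed

lemma integrable_norm_powr_compact_support:
  fixes g :: "real \<Rightarrow> complex^2"
  assumes g: "continuous_on UNIV g" and supp: "\<And>x. R < \<bar>x\<bar> \<Longrightarrow> g x = 0" and "0 < r"
  shows "integrable lborel (\<lambda>x. norm (g x) powr r)"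
proof -
  have "continuous_on {- R..R} (\<lambda>x. norm (g x) powr r)"
    using assms(3) by (intro continuous_on_powr' continuous_intros continuous_on_subset[OF g]) auto
  then have "set_integrable lborel {- R..R} (\<lambda>x. norm (g x) powr r)"
    by (rule borel_integrable_atLeastAtMost')
  moreover have "indicator {- R..R} x *\<^sub>R (norm (g x) powr r) = norm (g x) powr r" for x
    using supp[of x] by (cases "R < \<bar>x\<bar>") (auto simp: indicator_def)
  ultimately show ?thesis unfolding set_integrable_def by (simp only:)
qed

lemma Lq_compact_support:
  assumes g: "continuous_on UNIV g" and supp: "\<And>x. R < \<bar>x\<bar> \<Longrightarrow> g x = 0" and "1 \<le> q" "q \<noteq> \<infinity>"
  shows "Lq q g"
proof -
  have "0 < enn2real q" using enn2real_ge_1[OF assms(3,4)] by simp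
  from integrable_norm_powr_compact_support[OF g supp this] show ?thesis
    unfolding Lq_def using borel_measurable_continuous_onI[OF g] assms(4) by simp
qed

lemma periodic_bounded:
  fixes f :: "real \<Rightarrow> real"
  assumes "0 < P" "\<And>x. f (x + P) = f x" "continuous_on UNIV f"
  obtains C where "0 \<le> C" "\<And>x. \<bar>f x\<bar> \<le> C"
proof -
  have "bounded (f ` {0..P})"
    by (intro compact_imp_bounded compact_continuous_image compact_Icc continuous_on_subset[OF assms(3)]) auto
  then obtain C where C: "\<forall>y \<in> f ` {0..P}. norm y \<le> C" unfolding bounded_iff by blast
  have b: "\<bar>f x\<bar> \<le> C" for x
  proof -
    have "\<bar>f (x - of_int \<lfloor>x / P\<rfloor> * P)\<bar> \<le> C" using C floor_shift_in_period[OF assms(1), of x] by auto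
    then show ?thesis using periodic_value_in_period[where D = f, OF assms(1,2)] by simp
  qed
  have "0 \<le> C" using b[of 0] by linarith
  with b show ?thesis by (rule that[rotated])
qed

lemma has_derivative_max_cube:
  "((\<lambda>y::real. (max 0 y) ^ 3) has_real_derivative (3 * (max 0 y)\<^sup>2)) (at y)"
  "((\<lambda>y::real. 3 * (max 0 y)\<^sup>2) has_real_derivative (6 * max 0 y)) (at y)"
proof -
  have gen: "((\<lambda>y::real. (max 0 y) ^ Suc (Suc n)) has_real_derivative (real (Suc (Suc n)) * (max 0 y) ^ Suc n)) (at y)" for n
  proof (cases y "0::real" rule: linorder_cases)
    case less
    have "((\<lambda>y::real. 0) has_real_derivative 0) (at y)" by simp
    then have "((\<lambda>y::real. (max 0 y) ^ Suc (Suc n)) has_real_derivative 0) (at y)"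
      by (rule has_field_derivative_transform_within_open[where S = "{..<0}"]) (use less in auto)
    then show ?thesis using less by simp
  next
    case greater
    have "((\<lambda>y::real. y ^ Suc (Suc n)) has_real_derivative (real (Suc (Suc n)) * y ^ Suc n)) (at y)"
      using DERIV_pow[of "Suc (Suc n)" y] by simp
    then have "((\<lambda>y::real. (max 0 y) ^ Suc (Suc n)) has_real_derivative (real (Suc (Suc n)) * y ^ Suc n)) (at y)"
      by (rule has_field_derivative_transform_within_open[where S = "{0<..}"]) (use greater in auto)
    then show ?thesis using greater by simp
  next
    case equal
    have "((\<lambda>h::real. ((max 0 (0 + h)) ^ Suc (Suc n) - (max 0 0) ^ Suc (Suc n)) / h) \<longlongrightarrow> 0) (at 0)"
    proof (rule Lim_null_comparison)
      have "norm (((max 0 (0 + h)) ^ Suc (Suc n) - (max 0 0) ^ Suc (Suc n)) / h) \<le> \<bar>h\<bar> ^ Suc n" for h :: real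
        by (cases "0 < h") (simp_all add: max_absorb1 zero_le_power mult_nonpos_nonneg)
      then show "\<forall>\<^sub>F h in at 0. norm (((max 0 (0 + h)) ^ Suc (Suc n) - (max 0 0) ^ Suc (Suc n)) / h) \<le> \<bar>h :: real\<bar> ^ Suc n"
        by (intro always_eventually allI)
      show "((\<lambda>h::real. \<bar>h\<bar> ^ Suc n) \<longlongrightarrow> 0) (at 0)"
        by (rule tendsto_eq_intros refl | simp)+
    qed
    then show ?thesis using equal by (simp add: DERIV_def)
  qed
  show "((\<lambda>y::real. (max 0 y) ^ 3) has_real_derivative (3 * (max 0 y)\<^sup>2)) (at y)"
    using gen[of 1] by (simp add: numeral_eq_Suc)
  show "((\<lambda>y::real. 3 * (max 0 y)\<^sup>2) has_real_derivative (6 * max 0 y)) (at y)"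
    using DERIV_cmult[OF gen[of 0], of 3] by (simp add: numeral_eq_Suc)
qed


lemma integral_periodic_multiple:
  fixes f :: "real \<Rightarrow> real"
  assumes "continuous_on UNIV f" "\<And>x. f (x + P) = f x" "0 < P"
  shows "integral {0..real n * P} f = real n * integral {0..P} f"
proof (induction n)
  case (Suc n)
  have int: "f integrable_on {a..b}" for a b
    by (intro integrable_continuous_real continuous_on_subset[OF assms(1)]) auto
  have per: "f (x + real n * P) = f x" for x
    using periodic_int_shift[of f P x "int n"] assms(2) by simp
  have "integral {0..real (Suc n) * P} f
      = integral {0..real n * P} f + integral {real n * P..real (Suc n) * P} f"
    by (rule Henstock_Kurzweil_Integration.integral_combine[symmetric])
       (use assms(3) int in \<open>auto simp: distrib_right\<close>)
  also have "integral {real n * P..real (Suc n) * P} f = integral {0..P} (\<lambda>x. f (x + real n * P))"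
    using integral_shift_Icc_real[of 0 P f "real n * P"]
    by (simp add: distrib_right add.commute o_def)
  finally show ?case unfolding per using Suc by (simp add: algebra_simps)
qed simp

text \<open>A compactly supported cutoff that is twice continuously differentiable given by a single formula.
  Its scale is \<open>R\<close>, so each derivative costs a factor \<open>1 / R\<close>.\<close>

definition cutoff :: "real \<Rightarrow> real \<Rightarrow> real" where
  "cutoff R x = (max 0 (1 - (x / R)\<^sup>2)) ^ 3"

definition cutoff1 :: "real \<Rightarrow> real \<Rightarrow> real" where
  "cutoff1 R x = 3 * (max 0 (1 - (x / R)\<^sup>2))\<^sup>2 * (- 2 * x / R\<^sup>2)"

definition cutoff2 :: "real \<Rightarrow> real \<Rightarrow> real" where
  "cutoff2 R x = 6 * max 0 (1 - (x / R)\<^sup>2) * (- 2 * x / R\<^sup>2)\<^sup>2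
     + 3 * (max 0 (1 - (x / R)\<^sup>2))\<^sup>2 * (- 2 / R\<^sup>2)"

lemma has_derivative_cutoff:
  "(cutoff R has_real_derivative cutoff1 R x) (at x)"
  "(cutoff1 R has_real_derivative cutoff2 R x) (at x)"
proof -
  have i: "((\<lambda>x. 1 - (x / R)\<^sup>2) has_real_derivative (- 2 * x / R\<^sup>2)) (at x)"
    by (cases "R = 0") (auto intro!: derivative_eq_intros simp: field_simps power2_eq_square)
  have i2: "((\<lambda>x. - 2 * x / R\<^sup>2) has_real_derivative (- 2 / R\<^sup>2)) (at x)"
    by (intro DERIV_cdivide) (auto intro!: derivative_eq_intros)
  show "(cutoff R has_real_derivative cutoff1 R x) (at x)"
    unfolding cutoff_def[abs_def] cutoff1_def
    using DERIV_chain2[OF has_derivative_max_cube(1) i] .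
  have "((\<lambda>x. 3 * (max 0 (1 - (x / R)\<^sup>2))\<^sup>2) has_real_derivative
      (6 * max 0 (1 - (x / R)\<^sup>2) * (- 2 * x / R\<^sup>2))) (at x)"
    using DERIV_chain2[OF has_derivative_max_cube(2) i] .
  from DERIV_mult[OF this i2] show "(cutoff1 R has_real_derivative cutoff2 R x) (at x)"
    unfolding cutoff1_def[abs_def] cutoff2_def by (rule DERIV_cong) (simp add: power2_eq_square)
qed

lemma cutoff_outside:
  assumes "0 < R" "R < \<bar>x\<bar>"
  shows "cutoff R x = 0" "cutoff1 R x = 0" "cutoff2 R x = 0"
proof -
  have "1 \<le> (\<bar>x\<bar> / R)\<^sup>2" using assms by (intro one_le_power) (simp add: field_simps)
  then have "max 0 (1 - (x / R)\<^sup>2) = 0" by (simp add: power_divide)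
  then show "cutoff R x = 0" "cutoff1 R x = 0" "cutoff2 R x = 0"
    unfolding cutoff_def cutoff1_def cutoff2_def by simp_all
qed

lemma cutoff_bounds:
  assumes "1 \<le> R"
  shows "\<bar>cutoff1 R x\<bar> \<le> 6 / R" "\<bar>cutoff2 R x\<bar> \<le> 30 / R"
proof -
  have "\<bar>cutoff1 R x\<bar> \<le> 6 / R \<and> \<bar>cutoff2 R x\<bar> \<le> 30 / R"
  proof (cases "R < \<bar>x\<bar>")
    case True
    then show ?thesis using cutoff_outside[of R x] assms by simp
  next
    case False
    define m where "m = max 0 (1 - (x / R)\<^sup>2)"
    have m: "0 \<le> m" "m \<le> 1" unfolding m_def by auto
    then have m2: "0 \<le> m\<^sup>2" "m\<^sup>2 \<le> 1" by (auto simp: power_le_one)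
    define t where "t = - 2 * x / R\<^sup>2"
    have t: "\<bar>t\<bar> \<le> 2 / R"
    proof -
      have "\<bar>t\<bar> = 2 * \<bar>x\<bar> / R\<^sup>2" unfolding t_def by (simp add: abs_mult)
      also have "\<dots> \<le> 2 * R / R\<^sup>2" using False by (intro divide_right_mono) auto
      also have "\<dots> = 2 / R" using assms by (simp add: power2_eq_square)
      finally show ?thesis .
    qed
    have R2: "1 / R\<^sup>2 \<le> 1 / R"
      using assms by (intro divide_left_mono) (auto simp: power2_eq_square)
    have "\<bar>cutoff1 R x\<bar> = 3 * m\<^sup>2 * \<bar>t\<bar>"
      unfolding cutoff1_def m_def[symmetric] t_def[symmetric] by (simp add: abs_mult)
    also have "\<dots> \<le> 3 * 1 * (2 / R)" using m2 t by (intro mult_mono) auto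
    finally have 1: "\<bar>cutoff1 R x\<bar> \<le> 6 / R" by simp
    have "t\<^sup>2 \<le> (2 / R)\<^sup>2" using t assms by (simp add: abs_le_square_iff[symmetric])
    then have t2: "t\<^sup>2 \<le> 4 * (1 / R\<^sup>2)" by (simp add: power_divide)
    have "\<bar>cutoff2 R x\<bar> \<le> \<bar>6 * m * t\<^sup>2\<bar> + \<bar>3 * m\<^sup>2 * (- 2 / R\<^sup>2)\<bar>"
      unfolding cutoff2_def m_def[symmetric] t_def[symmetric] by (rule abs_triangle_ineq)
    also have "\<dots> = 6 * m * t\<^sup>2 + 6 * m\<^sup>2 * (1 / R\<^sup>2)" using m by (simp add: abs_mult)
    also have "\<dots> \<le> 6 * 1 * (4 * (1 / R\<^sup>2)) + 6 * 1 * (1 / R\<^sup>2)"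
      using m m2 t2 by (intro add_mono mult_mono) auto
    also have "\<dots> = 30 * (1 / R\<^sup>2)" by simp
    also have "\<dots> \<le> 30 * (1 / R)" using R2 by (intro mult_left_mono) auto
    finally have "\<bar>cutoff2 R x\<bar> \<le> 30 / R" by simp
    with 1 show ?thesis by blast
  qed
  then show "\<bar>cutoff1 R x\<bar> \<le> 6 / R" "\<bar>cutoff2 R x\<bar> \<le> 30 / R" by blast+
qed

lemma cutoff_lower:
  assumes "0 < R" "\<bar>x\<bar> \<le> R / 2"
  shows "27 / 64 \<le> cutoff R x"
proof -
  have "\<bar>x / R\<bar> \<le> 1 / 2" using assms by (simp add: field_simps)
  then have "(x / R)\<^sup>2 \<le> (1 / 2)\<^sup>2" by (simp only: abs_le_square_iff[symmetric])
  also have "(1 / 2 :: real)\<^sup>2 = 1 / 4" by (simp add: power2_eq_square)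
  finally have "3 / 4 \<le> max 0 (1 - (x / R)\<^sup>2)" by linarith
  then have "(3 / 4) ^ 3 \<le> cutoff R x" unfolding cutoff_def by (rule power_mono) simp
  then show ?thesis by (simp add: power3_eq_cube)
qed

lemma powr_norm_ratio:
  fixes r a b C :: real
  assumes "1 \<le> r" "0 \<le> a" "0 \<le> b" "a powr (1 / r) \<le> C * b powr (1 / r)"
  shows "a \<le> \<bar>C\<bar> powr r * b"
proof -
  have "a = (a powr (1 / r)) powr r" using assms by (simp add: powr_powr)
  also have "\<dots> \<le> (\<bar>C\<bar> * b powr (1 / r)) powr r"
  proof (rule powr_mono2)
    have "C * b powr (1 / r) \<le> \<bar>C\<bar> * b powr (1 / r)" by (intro mult_right_mono) auto
    then show "a powr (1 / r) \<le> \<bar>C\<bar> * b powr (1 / r)" using assms(4) by linarith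
  qed (use assms in auto)
  also have "\<dots> = \<bar>C\<bar> powr r * b" using assms by (simp add: powr_mult powr_powr)
  finally show ?thesis .
qed

text \<open>For \<open>q = \<infinity>\<close> the eigenfunction itself destroys uniqueness. For \<open>q < \<infinity>\<close> the products of
  the eigenfunction with cutoffs of scale \<open>R\<close> are approximate eigenfunctions: only terms with a
  derivative of the cutoff survive in the resolvent equation, so that the right-hand side is
  \<open>O(1 / R)\<close> uniformly, on an interval of length \<open>2 R\<close>. By periodicity the \<open>q\<close>-th power of the norm
  of the product grows at least in proportion to \<open>R\<close>. The ratio of the norms is thus \<open>O(1 / R)\<close>,
  which a bounded inverse excludes.\<close>

lemma eigenfunction_in_spectrum:
  assumes v: "\<And>x. (v has_real_derivative v1 x) (at x)" "\<And>x. (v1 has_real_derivative v2 x) (at x)"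
    and u: "\<And>x. (u has_real_derivative u1 x) (at x)" "\<And>x. (u1 has_real_derivative u2 x) (at x)"
    and k: "\<And>x. ((\<lambda>x. deriv p (U x $ 1)) has_real_derivative k1 x) (at x)"
    and cont: "continuous_on UNIV v2" "continuous_on UNIV u2"
    and eig1: "\<And>x. \<mu> * v x = \<epsilon>1 * v2 x + u1 x"
    and eig2: "\<And>x. \<mu> * u x = \<epsilon>2 * u2 x - (k1 x * v x + deriv p (U x $ 1) * v1 x)"
    and per: "0 < P" "\<And>x. v (x + P) = v x" "\<And>x. u (x + P) = u x" "\<And>x. U (x + P) = U x"
    and nz: "v x0 \<noteq> 0 \<or> u x0 \<noteq> 0"
    and eps: "0 < \<epsilon>1" "0 < \<epsilon>2" and q: "1 \<le> q"
  shows "complex_of_real \<mu> \<in> lin_spectrum \<epsilon>1 \<epsilon>2 p U q"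
proof (rule ccontr)
  assume "complex_of_real \<mu> \<notin> lin_spectrum \<epsilon>1 \<epsilon>2 p U q"
  then obtain C where "\<forall>g. Lq q g \<longrightarrow>
      (\<exists>!V. resolvent_solution \<epsilon>1 \<epsilon>2 p U q (complex_of_real \<mu>) g V) \<and>
      (\<forall>V. resolvent_solution \<epsilon>1 \<epsilon>2 p U q (complex_of_real \<mu>) g V \<longrightarrow> Lq_norm q V \<le> C * Lq_norm q g)"
    unfolding lin_spectrum_def Compl_iff mem_Collect_eq not_not by (rule exE)
  then have C: "\<And>g. Lq q g \<Longrightarrow> \<exists>!V. resolvent_solution \<epsilon>1 \<epsilon>2 p U q (complex_of_real \<mu>) g V"
    "\<And>g V. Lq q g \<Longrightarrow> resolvent_solution \<epsilon>1 \<epsilon>2 p U q (complex_of_real \<mu>) g V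
        \<Longrightarrow> Lq_norm q V \<le> C * Lq_norm q g"
    by blast+
  define \<kappa> where "\<kappa> x = deriv p (U x $ 1)" for x
  have contv: "continuous_on S v" "continuous_on S v1" "continuous_on S u" "continuous_on S u1"
    "continuous_on S \<kappa>" for S
    using has_real_derivative_imp_continuous_on[OF v(1), of S] has_real_derivative_imp_continuous_on[OF v(2), of S]
      has_real_derivative_imp_continuous_on[OF u(1), of S] has_real_derivative_imp_continuous_on[OF u(2), of S]
      has_real_derivative_imp_continuous_on[OF k, of S] unfolding \<kappa>_def[abs_def] by this
  have cont2: "continuous_on S v2" "continuous_on S u2" for S
    using cont continuous_on_subset by blast+
  note per_v1 = derivative_periodic[OF v(1) per(2)] and per_u1 = derivative_periodic[OF u(1) per(3)]
  note per_v2 = derivative_periodic[OF v(2) per_v1] and per_u2 = derivative_periodic[OF u(2) per_u1]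
  have bound: "\<exists>K\<ge>0. \<forall>x. \<bar>f x\<bar> \<le> K" if "continuous_on UNIV f" "\<And>x. f (x + P) = f x" for f :: "real \<Rightarrow> real"
    by (rule periodic_bounded[OF per(1) that(2,1)]) auto
  show False
  proof (cases "q = \<infinity>")
    case True
    have bd: "Lq q (\<lambda>x. cvec (a x) (b x))"
      if ab: "continuous_on UNIV a" "\<And>x. a (x + P) = a x" "continuous_on UNIV b" "\<And>x. b (x + P) = b x" for a b
    proof -
      obtain A B where "\<And>x. \<bar>a x\<bar> \<le> A" "\<And>x. \<bar>b x\<bar> \<le> B"
        using bound[OF ab(1,2)] bound[OF ab(3,4)] by blast
      then have "norm (cvec (a x) (b x)) \<le> A + B" for x
        using norm_cvec_le[of "a x" "b x"] by (smt (verit))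
      then show ?thesis
        unfolding True by (intro Lq_bounded_continuous continuous_on_cvec ab)
    qed
    have Lq_0: "Lq q (\<lambda>x. cvec 0 0)" by (intro bd) auto
    have "resolvent_solution \<epsilon>1 \<epsilon>2 p U q (complex_of_real \<mu>) (\<lambda>x. cvec 0 0) (\<lambda>x. cvec (v x) (u x))"
      by (rule resolvent_solution_cvec[OF v u k])
         (auto intro!: bd contv cont2 simp: per per_v1 per_v2 per_u1 per_u2 eig1 eig2)
    moreover have "resolvent_solution \<epsilon>1 \<epsilon>2 p U q (complex_of_real \<mu>) (\<lambda>x. cvec 0 0) (\<lambda>x. cvec 0 0)"
      by (rule resolvent_solution_cvec[where v = "\<lambda>x. 0" and u = "\<lambda>x. 0" and ?k1.0 = k1
            and ?v1.0 = "\<lambda>x. 0" and ?u1.0 = "\<lambda>x. 0" and ?v2.0 = "\<lambda>x. 0" and ?u2.0 = "\<lambda>x. 0"])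
         (use Lq_0 in \<open>auto intro: k\<close>)
    ultimately have "(\<lambda>x. cvec (v x) (u x)) = (\<lambda>x. cvec 0 0)"
      using C(1)[OF Lq_0] by blast
    then have "cvec (v x0) (u x0) = cvec 0 0" by (rule fun_cong)
    with nz show False by (metis cvec_eq_0_iff)
  next
    case False
    define r where "r = enn2real q"
    have r: "1 \<le> r" unfolding r_def by (rule enn2real_ge_1[OF q False])
    obtain Kv Kv1 Ku Ku1 Kk where K0: "0 \<le> Kv" "\<And>x. \<bar>v x\<bar> \<le> Kv" "0 \<le> Kv1" "\<And>x. \<bar>v1 x\<bar> \<le> Kv1"
      "0 \<le> Ku" "\<And>x. \<bar>u x\<bar> \<le> Ku" "0 \<le> Ku1" "\<And>x. \<bar>u1 x\<bar> \<le> Ku1" "0 \<le> Kk" "\<And>x. \<bar>\<kappa> x * v x\<bar> \<le> Kk"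
    proof -
      have pk: "\<kappa> (x + P) * v (x + P) = \<kappa> x * v x" for x using per unfolding \<kappa>_def by simp
      have ck: "continuous_on UNIV (\<lambda>x. \<kappa> x * v x)" by (intro continuous_intros contv)
      show ?thesis
        using bound[of v, OF contv(1) per(2)] bound[of v1, OF contv(2) per_v1]
          bound[of u, OF contv(3) per(3)] bound[of u1, OF contv(4) per_u1] bound[OF ck pk] that
        by (elim exE conjE) blast
    qed
    define K where "K = Kv + Kv1 + Ku + Ku1 + Kk"
    have K: "\<bar>v x\<bar> \<le> K" "\<bar>v1 x\<bar> \<le> K" "\<bar>u x\<bar> \<le> K" "\<bar>u1 x\<bar> \<le> K" "\<bar>\<kappa> x * v x\<bar> \<le> K" "0 \<le> K" for x
      unfolding K_def using K0(1,3,5,7,9) K0(2)[of x] K0(4)[of x] K0(6)[of x] K0(8)[of x] K0(10)[of x]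
      by linarith+
    define A where "A = (42 * \<epsilon>1 + 42 * \<epsilon>2 + 12) * K"
    have A: "0 \<le> A" unfolding A_def using eps K(6) by simp
    define N where "N x = norm (cvec (v x) (u x)) powr r" for x
    have N_cont: "continuous_on S N" for S
      unfolding N_def using r by (intro continuous_on_powr' continuous_intros continuous_on_cvec contv) auto
    have N_per: "N (x + P) = N x" for x unfolding N_def using per by simp
    define I where "I = integral {0..P} N"
    have "0 < I"
    proof -
      have Nn: "0 \<le> N x" for x unfolding N_def by simp
      have "0 \<le> I" unfolding I_def
        by (intro integral_nonneg integrable_continuous_real N_cont Nn)
      moreover have "I \<noteq> 0"
      proof
        assume "I = 0"
        then have "(N has_integral 0) (cbox 0 P)"
          using integrable_integral[OF integrable_continuous_real[OF N_cont, of 0 P]] unfolding I_def by simp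
        from has_integral_0_cbox_imp_0[OF _ _ this]
        have "N (x0 - of_int \<lfloor>x0 / P\<rfloor> * P) = 0"
          using N_cont Nn floor_shift_in_period[OF per(1), of x0] per(1) by auto
        then have "N x0 = 0" using periodic_value_in_period[where D = N, OF per(1) N_per] by simp
        then show False using nz unfolding N_def by simp
      qed
      ultimately show ?thesis by simp
    qed
    (* the scale is an even multiple of the period, so that n whole periods fit where the cutoff is
       at least (3/4)^3 *)
    have key: "(27 / 64) powr r * (real n * I) \<le> \<bar>C\<bar> powr r * ((A / R) powr r * (2 * R))"
      if n: "R = 2 * real n * P" "1 \<le> R" for n R
    proof -
      have R: "0 < R" using n(2) by linarith
      define \<eta> \<eta>1 \<eta>2 where "\<eta> = cutoff R" and "\<eta>1 = cutoff1 R" and "\<eta>2 = cutoff2 R"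
      have \<eta>: "(\<eta> has_real_derivative \<eta>1 x) (at x)" "(\<eta>1 has_real_derivative \<eta>2 x) (at x)" for x
        unfolding \<eta>_def \<eta>1_def \<eta>2_def by (rule has_derivative_cutoff)+
      have out: "\<eta> x = 0" "\<eta>1 x = 0" "\<eta>2 x = 0" if "R < \<bar>x\<bar>" for x
        unfolding \<eta>_def \<eta>1_def \<eta>2_def using cutoff_outside[OF R that] by blast+
      have cont\<eta>: "continuous_on S \<eta>" "continuous_on S \<eta>1" "continuous_on S \<eta>2" for S
      proof -
        show "continuous_on S \<eta>2"
          unfolding \<eta>2_def cutoff2_def[abs_def] by (intro continuous_intros ballI) (use R in auto)
      qed (rule has_real_derivative_imp_continuous_on, rule \<eta>)+
      define w where "w f x = \<eta> x * f x" for f x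
      define w1 where "w1 f f1 x = \<eta>1 x * f x + \<eta> x * f1 x" for f f1 :: "real \<Rightarrow> real" and x
      define w2 where "w2 f f1 f2 x = \<eta>2 x * f x + 2 * \<eta>1 x * f1 x + \<eta> x * f2 x"
        for f f1 f2 :: "real \<Rightarrow> real" and x
      have w': "(w f has_real_derivative w1 f f1 x) (at x)"
        if "\<And>x. (f has_real_derivative f1 x) (at x)" for f f1 x
        unfolding w_def[abs_def] w1_def using DERIV_mult[OF \<eta>(1) that] by (simp add: mult.commute)
      have w1': "(w1 f f1 has_real_derivative w2 f f1 f2 x) (at x)"
        if "\<And>x. (f has_real_derivative f1 x) (at x)" "\<And>x. (f1 has_real_derivative f2 x) (at x)" for f f1 f2 x
        unfolding w1_def[abs_def] w2_def
        by (rule DERIV_cong[OF DERIV_add[OF DERIV_mult[OF \<eta>(2) that(1)] DERIV_mult[OF \<eta>(1) that(2)]]])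
           (simp add: algebra_simps)
      define g1 where "g1 x = - \<epsilon>1 * (\<eta>2 x * v x + 2 * \<eta>1 x * v1 x) - \<eta>1 x * u x" for x
      define g2 where "g2 x = - \<epsilon>2 * (\<eta>2 x * u x + 2 * \<eta>1 x * u1 x) + \<eta>1 x * (\<kappa> x * v x)" for x
      have Lq_supp: "Lq q (\<lambda>x. cvec (a x) (b x))"
        if "continuous_on UNIV a" "continuous_on UNIV b" "\<And>x. R < \<bar>x\<bar> \<Longrightarrow> a x = 0" "\<And>x. R < \<bar>x\<bar> \<Longrightarrow> b x = 0" for a b
        by (rule Lq_compact_support[where R = R, OF _ _ q False]) (auto intro!: continuous_on_cvec that)
      have sol: "resolvent_solution \<epsilon>1 \<epsilon>2 p U q (complex_of_real \<mu>) (\<lambda>x. cvec (g1 x) (g2 x))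
          (\<lambda>x. cvec (w v x) (w u x))"
      proof (rule resolvent_solution_cvec[OF w'[OF v(1)] w1'[OF v] w'[OF u(1)] w1'[OF u] k])
        show "Lq q (\<lambda>x. cvec (w v x) (w u x))"
          by (rule Lq_supp) (auto simp: w_def out intro!: continuous_intros contv cont\<eta>)
        show "Lq q (\<lambda>x. cvec (w1 v v1 x) (w1 u u1 x))"
          by (rule Lq_supp) (auto simp: w1_def out intro!: continuous_intros contv cont\<eta>)
        show "Lq q (\<lambda>x. cvec (w2 v v1 v2 x) (w2 u u1 u2 x))"
          by (rule Lq_supp) (auto simp: w2_def out intro!: continuous_intros contv cont\<eta> cont2)
        fix x
        have "g1 x = \<mu> * w v x - (\<epsilon>1 * w2 v v1 v2 x + w1 u u1 x)"
        proof -
          have "\<eta> x * (\<mu> * v x) = \<eta> x * (\<epsilon>1 * v2 x + u1 x)" by (simp add: eig1)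
          then show ?thesis unfolding g1_def w_def w1_def w2_def by (simp add: algebra_simps)
        qed
        moreover have "g2 x = \<mu> * w u x - (\<epsilon>2 * w2 u u1 u2 x - (k1 x * w v x + deriv p (U x $ 1) * w1 v v1 x))"
        proof -
          have "\<eta> x * (\<mu> * u x) = \<eta> x * (\<epsilon>2 * u2 x - (k1 x * v x + \<kappa> x * v1 x))"
            using eig2 by (simp add: \<kappa>_def)
          then show ?thesis
            unfolding g2_def w_def w1_def w2_def \<kappa>_def[symmetric] by (simp add: algebra_simps)
        qed
        ultimately show "cvec (g1 x) (g2 x) = cvec (\<mu> * w v x - (\<epsilon>1 * w2 v v1 v2 x + w1 u u1 x))
           (\<mu> * w u x - (\<epsilon>2 * w2 u u1 u2 x - (k1 x * w v x + deriv p (U x $ 1) * w1 v v1 x)))"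
          by simp
      qed
      have g_cont: "continuous_on UNIV g1" "continuous_on UNIV g2"
        unfolding g1_def g2_def by (intro continuous_intros contv cont\<eta>)+
      have g_out: "g1 x = 0" "g2 x = 0" if "R < \<bar>x\<bar>" for x
        unfolding g1_def g2_def using out[OF that] by simp_all
      have Lg: "Lq q (\<lambda>x. cvec (g1 x) (g2 x))"
        by (rule Lq_supp) (use g_cont g_out in auto)
      have "Lq_norm q (\<lambda>x. cvec (w v x) (w u x)) \<le> C * Lq_norm q (\<lambda>x. cvec (g1 x) (g2 x))"
        by (rule C(2)[OF Lg sol])
      then have "(\<integral>x. norm (cvec (w v x) (w u x)) powr r \<partial>lborel) powr (1 / r)
          \<le> C * (\<integral>x. norm (cvec (g1 x) (g2 x)) powr r \<partial>lborel) powr (1 / r)"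
        unfolding Lq_norm_def r_def using False by simp
      then have ratio: "(\<integral>x. norm (cvec (w v x) (w u x)) powr r \<partial>lborel)
          \<le> \<bar>C\<bar> powr r * (\<integral>x. norm (cvec (g1 x) (g2 x)) powr r \<partial>lborel)"
        by (intro powr_norm_ratio r) auto
      have w_cont: "continuous_on UNIV (\<lambda>x. cvec (w v x) (w u x))"
        unfolding w_def by (intro continuous_on_cvec continuous_intros contv cont\<eta>)
      have int_w: "integrable lborel (\<lambda>x. norm (cvec (w v x) (w u x)) powr r)"
        by (rule integrable_norm_powr_compact_support[where R = R, OF w_cont])
           (use r in \<open>auto simp: w_def out\<close>)
      have int_g: "integrable lborel (\<lambda>x. norm (cvec (g1 x) (g2 x)) powr r)"
        by (rule integrable_norm_powr_compact_support[where R = R, OF continuous_on_cvec[OF g_cont]])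
           (use r in \<open>auto simp: g_out\<close>)
      have lower: "(27 / 64) powr r * (real n * I) \<le> (\<integral>x. norm (cvec (w v x) (w u x)) powr r \<partial>lborel)"
      proof -
        have si: "set_integrable lborel {0..real n * P} N"
          by (rule borel_integrable_atLeastAtMost'[OF N_cont])
        have "(27 / 64) powr r * (real n * I) = (27 / 64) powr r * integral {0..real n * P} N"
          unfolding I_def using integral_periodic_multiple[OF N_cont N_per per(1)] by simp
        also have "integral {0..real n * P} N = (\<integral>x. indicator {0..real n * P} x *\<^sub>R N x \<partial>lborel)"
          using set_borel_integral_eq_integral(2)[OF si] unfolding set_lebesgue_integral_def by simp
        also have "(27 / 64) powr r * (\<integral>x. indicator {0..real n * P} x *\<^sub>R N x \<partial>lborel)
            = (\<integral>x. (27 / 64) powr r * (indicator {0..real n * P} x *\<^sub>R N x) \<partial>lborel)"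
          by simp
        also have "\<dots> \<le> (\<integral>x. norm (cvec (w v x) (w u x)) powr r \<partial>lborel)"
        proof (rule integral_mono)
          show "integrable lborel (\<lambda>x. (27 / 64) powr r * (indicator {0..real n * P} x *\<^sub>R N x))"
            using si unfolding set_integrable_def by (intro integrable_mult_right)
          show "(27 / 64) powr r * (indicator {0..real n * P} x *\<^sub>R N x)
              \<le> norm (cvec (w v x) (w u x)) powr r" for x
          proof (cases "x \<in> {0..real n * P}")
            case True
            then have "27 / 64 \<le> \<eta> x"
              unfolding \<eta>_def by (intro cutoff_lower[OF R]) (use n in auto)
            then have "27 / 64 * norm (cvec (v x) (u x)) \<le> norm (cvec (w v x) (w u x))"
              unfolding w_def norm_cvec_scale by (intro mult_right_mono) auto
            then have "(27 / 64 * norm (cvec (v x) (u x))) powr r \<le> norm (cvec (w v x) (w u x)) powr r"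
              using r by (intro powr_mono2) auto
            moreover have "(27 / 64 * norm (cvec (v x) (u x))) powr r = (27 / 64) powr r * N x"
              unfolding N_def by (rule powr_mult)
            ultimately show ?thesis using True by simp
          qed simp
        qed (rule int_w)
        finally show ?thesis .
      qed
      have g_bd: "norm (cvec (g1 x) (g2 x)) \<le> A / R" for x
      proof -
        have c1: "\<bar>\<eta>1 x\<bar> \<le> 6 / R" and c2: "\<bar>\<eta>2 x\<bar> \<le> 30 / R"
          unfolding \<eta>1_def \<eta>2_def using cutoff_bounds[OF n(2)] by blast+
        have m1: "\<bar>\<eta>1 x * y\<bar> \<le> 6 / R * K" and m2: "\<bar>\<eta>2 x * y\<bar> \<le> 30 / R * K" if "\<bar>y\<bar> \<le> K" for y
          unfolding abs_mult
          by (rule mult_mono[OF c1 that] mult_mono[OF c2 that]; use R in simp)+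
        have e: "\<bar>\<epsilon> * (\<eta>2 x * y + 2 * \<eta>1 x * z)\<bar> \<le> \<epsilon> * (42 / R * K)"
          if "0 < \<epsilon>" "\<bar>y\<bar> \<le> K" "\<bar>z\<bar> \<le> K" for \<epsilon> y z
        proof -
          have "\<bar>\<eta>2 x * y + 2 * \<eta>1 x * z\<bar> \<le> 42 / R * K"
            using m2[OF that(2)] m1[OF that(3)] by (simp add: mult.assoc)
          then have "\<epsilon> * \<bar>\<eta>2 x * y + 2 * \<eta>1 x * z\<bar> \<le> \<epsilon> * (42 / R * K)"
            by (rule mult_left_mono) (use that(1) in simp)
          then show ?thesis unfolding abs_mult abs_of_pos[OF that(1)] .
        qed
        have "\<bar>g1 x\<bar> \<le> \<epsilon>1 * (42 / R * K) + 6 / R * K"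
          unfolding g1_def using e[OF eps(1) K(1)[of x] K(2)[of x]] m1[OF K(3)[of x]] by linarith
        moreover have "\<bar>g2 x\<bar> \<le> \<epsilon>2 * (42 / R * K) + 6 / R * K"
          unfolding g2_def using e[OF eps(2) K(3)[of x] K(4)[of x]] m1[OF K(5)[of x]] by linarith
        moreover have "A / R = \<epsilon>1 * (42 / R * K) + 6 / R * K + (\<epsilon>2 * (42 / R * K) + 6 / R * K)"
          unfolding A_def using R by (simp add: field_simps)
        ultimately show ?thesis using norm_cvec_le[of "g1 x" "g2 x"] by linarith
      qed
      have upper: "(\<integral>x. norm (cvec (g1 x) (g2 x)) powr r \<partial>lborel) \<le> (A / R) powr r * (2 * R)"
      proof -
        have "(\<integral>x. norm (cvec (g1 x) (g2 x)) powr r \<partial>lborel)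
            \<le> (\<integral>x. (A / R) powr r * indicator {- R..R} x \<partial>lborel)"
        proof (rule integral_mono[OF int_g])
          show "integrable lborel (\<lambda>x. (A / R) powr r * indicator {- R..R} x)"
            by (intro integrable_mult_right integrable_real_indicator) (auto simp: emeasure_lborel_Icc_eq)
          show "norm (cvec (g1 x) (g2 x)) powr r \<le> (A / R) powr r * indicator {- R..R} x" for x
          proof (cases "x \<in> {- R..R}")
            case True
            then show ?thesis using g_bd[of x] r by (auto intro!: powr_mono2)
          next
            case False
            then have "R < \<bar>x\<bar>" by auto
            then show ?thesis using g_out by simp
          qed
        qed
        also have "\<dots> = (A / R) powr r * (2 * R)" using R by simp
        finally show ?thesis .
      qed
      show ?thesis
        using lower ratio mult_left_mono[OF upper, of "\<bar>C\<bar> powr r"] by simp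
    qed
    have fin: "(27 / 64) powr r * I \<le> \<bar>C\<bar> powr r * A powr r * (4 * P) * (2 * real n * P) powr (- r)"
      if n: "1 \<le> 2 * real n * P" for n
    proof -
      define R where "R = 2 * real n * P"
      have R: "1 \<le> R" using n unfolding R_def .
      then have R0: "0 < R" by linarith
      have n0: "0 < real n" using n by (cases n) auto
      have "(27 / 64) powr r * (real n * I) \<le> \<bar>C\<bar> powr r * ((A / R) powr r * (2 * R))"
        by (rule key[OF R_def R])
      also have "(A / R) powr r = A powr r * R powr (- r)"
        using A R0 by (simp add: powr_divide powr_minus_divide)
      finally have "((27 / 64) powr r * I) * real n
          \<le> (\<bar>C\<bar> powr r * A powr r * (4 * P) * R powr (- r)) * real n"
        unfolding R_def by (simp add: mult_ac)
      then show ?thesis using n0 unfolding R_def by simp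
    qed
    have lin: "filterlim (\<lambda>n. 2 * real n * P) at_top sequentially"
      using filterlim_tendsto_pos_mult_at_top[OF tendsto_const[of "2 * P"] _ filterlim_real_sequentially] per(1)
      by (simp add: mult_ac)
    have "(\<lambda>n. \<bar>C\<bar> powr r * A powr r * (4 * P) * (2 * real n * P) powr (- r)) \<longlonglongrightarrow> 0"
      by (intro tendsto_mult_right_zero tendsto_neg_powr lin) (use r in simp)
    moreover have "\<forall>\<^sub>F n in sequentially. 1 \<le> 2 * real n * P"
      using lin unfolding filterlim_at_top by blast
    then have "\<forall>\<^sub>F n in sequentially. (27 / 64) powr r * I
        \<le> \<bar>C\<bar> powr r * A powr r * (4 * P) * (2 * real n * P) powr (- r)"
      by (rule eventually_mono) (rule fin)
    ultimately have "(27 / 64) powr r * I \<le> 0" by (rule tendsto_lowerbound) simp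
    moreover have "0 < (27 / 64) powr r * I" using \<open>0 < I\<close> by simp
    ultimately show False by simp
  qed
qed

section \<open>Periodic waves\<close>

lemma matrix_inv_eqI:
  fixes A B :: "real^'n^'n"
  assumes "A ** B = mat 1" "B ** A = mat 1"
  shows "matrix_inv A = B"
proof -
  have "A ** matrix_inv A = mat 1 \<and> matrix_inv A ** A = mat 1"
    unfolding matrix_inv_def by (rule someI[of _ B]) (use assms in simp)
  then have "matrix_inv A = matrix_inv A ** (A ** B)" "(matrix_inv A ** A) ** B = B"
    using assms by (simp_all add: matrix_mul_rid matrix_mul_lid)
  then show ?thesis by (metis matrix_mul_assoc)
qed

lemma visc_mult: "visc a b *v D = vector [a * D $ 1, b * D $ 2]"
  by (simp add: vec_eq_iff forall_2 matrix_vector_mult_def visc_def sum_2)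

lemma matrix_inv_visc:
  assumes "0 < \<epsilon>1" "0 < \<epsilon>2"
  shows "matrix_inv (visc \<epsilon>1 \<epsilon>2) = visc (1 / \<epsilon>1) (1 / \<epsilon>2)"
  by (rule matrix_inv_eqI)
     (use assms in \<open>simp_all add: vec_eq_iff forall_2 matrix_matrix_mult_def visc_def mat_def sum_2\<close>)

lemma C2_fun_derivs:
  assumes "C2_fun p"
  shows "(p has_real_derivative deriv p x) (at x)"
    and "(deriv p has_real_derivative deriv (deriv p) x) (at x)"
    and "continuous_on S (deriv (deriv p))"
  using assms unfolding C2_fun_def
  by (auto simp: DERIV_deriv_iff_real_differentiable intro: continuous_on_subset)

text \<open>The field has the form \<open>v' = - b'(u)\<close>, \<open>u' = a'(v)\<close>, so \<open>a v + b u\<close> is a Hamiltonian.\<close>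

lemma hamiltonian_stat_field:
  assumes "0 < \<epsilon>1" "0 < \<epsilon>2" and p: "C2_fun p"
  shows "hamiltonian_field (stat_field \<epsilon>1 \<epsilon>2 p Um)"
proof -
  have "continuous_on UNIV p"
    by (rule has_real_derivative_imp_continuous_on[OF C2_fun_derivs(1)[OF p]])
  then obtain G where G: "\<And>x. (G has_real_derivative p x) (at x)" using antiderivative_on_line by blast
  define a where "a v = (G v - p (Um $ 1) * v) / \<epsilon>2" for v
  define b where "b u = (u - Um $ 2)\<^sup>2 / (2 * \<epsilon>1)" for u
  have a: "(a has_real_derivative ((p v - p (Um $ 1)) / \<epsilon>2)) (at v)" for v
    unfolding a_def using assms by (auto intro!: derivative_eq_intros G)
  have b: "(b has_real_derivative ((u - Um $ 2) / \<epsilon>1)) (at u)" for u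
    unfolding b_def using assms by (auto intro!: derivative_eq_intros simp: field_simps)
  have proj: "((\<lambda>V::real^2. V $ i) has_derivative (\<lambda>h. h $ i)) (at V)" for i V
    by (rule bounded_linear.has_derivative[OF bounded_linear_vec_nth has_derivative_ident, simplified])
  have "((\<lambda>V. a (V $ 1) + b (V $ 2)) has_derivative
      (\<lambda>h. ((p (V $ 1) - p (Um $ 1)) / \<epsilon>2) * h $ 1 + ((V $ 2 - Um $ 2) / \<epsilon>1) * h $ 2)) (at V)" for V :: "real^2"
    using has_derivative_add[OF
        has_derivative_compose[OF proj a[of "V $ 1", unfolded has_field_derivative_def]]
        has_derivative_compose[OF proj b[of "V $ 2", unfolded has_field_derivative_def]]] .
  moreover have "stat_field \<epsilon>1 \<epsilon>2 p Um V $ 2 = (p (V $ 1) - p (Um $ 1)) / \<epsilon>2"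
    "stat_field \<epsilon>1 \<epsilon>2 p Um V $ 1 = - ((V $ 2 - Um $ 2) / \<epsilon>1)" for V
    unfolding stat_field_def matrix_inv_visc[OF assms(1,2)] visc_mult flux_def by (simp_all add: diff_divide_distrib)
  ultimately show ?thesis
    unfolding hamiltonian_field_def by (intro exI[of _ "\<lambda>V. a (V $ 1) + b (V $ 2)"] allI) simp
qed

lemma has_vector_derivative_vec2:
  fixes U :: "real \<Rightarrow> real^2"
  assumes "((\<lambda>x. U x $ 1) has_real_derivative a) (at x)" "((\<lambda>x. U x $ 2) has_real_derivative b) (at x)"
  shows "(U has_vector_derivative vector [a, b]) (at x)"
proof -
  have "((\<lambda>x. (U x $ 1) *\<^sub>R axis 1 1 + (U x $ 2) *\<^sub>R axis 2 1 :: real^2) has_vector_derivative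
      (a *\<^sub>R axis 1 1 + b *\<^sub>R axis 2 1)) (at x)"
    using has_vector_derivative_add[OF has_vector_derivative_scaleR[OF assms(1) has_vector_derivative_const]
      has_vector_derivative_scaleR[OF assms(2) has_vector_derivative_const]] by simp
  moreover have "c *\<^sub>R axis 1 1 + d *\<^sub>R axis 2 1 = (vector [c, d] :: real^2)" for c d
    by (simp add: vec_eq_iff forall_2 axis_def)
  moreover have "vector [U x $ 1, U x $ 2] = U x" for x
    by (simp add: vec_eq_iff forall_2)
  ultimately show ?thesis by simp
qed

lemma has_derivative_vec_nth:
  fixes U :: "real \<Rightarrow> real^2"
  assumes "(U has_vector_derivative D) (at x)"
  shows "((\<lambda>x. U x $ i) has_real_derivative D $ i) (at x)"
  using bounded_linear.has_vector_derivative[OF bounded_linear_vec_nth assms]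
  by (simp add: has_real_derivative_iff_has_vector_derivative)

lemma profile_components:
  assumes "profile_ode \<epsilon>1 \<epsilon>2 p Um 0 U" "0 < \<epsilon>1" "0 < \<epsilon>2"
  shows "((\<lambda>x. U x $ 1) has_real_derivative (- (U x $ 2 - Um $ 2) / \<epsilon>1)) (at x)"
    and "((\<lambda>x. U x $ 2) has_real_derivative ((p (U x $ 1) - p (Um $ 1)) / \<epsilon>2)) (at x)"
proof -
  obtain D where D: "(U has_vector_derivative D) (at x)"
    "visc \<epsilon>1 \<epsilon>2 *v D = flux p (U x) - flux p Um - 0 *\<^sub>R (U x - Um)"
    using assms(1) unfolding profile_ode_def by blast
  from arg_cong[OF D(2), of "\<lambda>z. z $ 1"] arg_cong[OF D(2), of "\<lambda>z. z $ 2"]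
  have "D $ 1 = - (U x $ 2 - Um $ 2) / \<epsilon>1" "D $ 2 = (p (U x $ 1) - p (Um $ 1)) / \<epsilon>2"
    unfolding visc_mult flux_def using assms(2,3) by (simp_all add: field_simps)
  with has_derivative_vec_nth[OF D(1), of 1] has_derivative_vec_nth[OF D(1), of 2]
  show "((\<lambda>x. U x $ 1) has_real_derivative (- (U x $ 2 - Um $ 2) / \<epsilon>1)) (at x)"
    "((\<lambda>x. U x $ 2) has_real_derivative ((p (U x $ 1) - p (Um $ 1)) / \<epsilon>2)) (at x)" by simp_all
qed

lemma constant_of_zero_derivative:
  fixes f :: "real \<Rightarrow> real"
  assumes "\<And>x. (f has_real_derivative 0) (at x)"
  shows "f x = f y"
  using DERIV_isconst_all assms by blast

text \<open>The infimum of all positive periods is again a period by continuity. It is positive: arbitrarily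
  small periods would allow \<open>a\<close> to be moved arbitrarily close to \<open>b\<close> by multiples of periods, so that
  \<open>U a = U b\<close>.\<close>

lemma minimal_period:
  fixes U :: "real \<Rightarrow> 'a::metric_space"
  assumes cont: "continuous_on UNIV U" and "0 < P" "\<And>x. U (x + P) = U x" and nc: "U a \<noteq> U b"
  shows "\<exists>T>0. (\<forall>x. U (x + T) = U x) \<and> (\<forall>\<tau>. 0 < \<tau> \<and> \<tau> < T \<longrightarrow> (\<exists>x. U (x + \<tau>) \<noteq> U x))"
proof -
  define S where "S = {\<tau>. 0 < \<tau> \<and> (\<forall>x. U (x + \<tau>) = U x)}"
  have "P \<in> S" unfolding S_def using assms by simp
  have bdd: "bdd_below S" unfolding S_def by (rule bdd_belowI[of _ 0]) auto
  define T where "T = Inf S"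
  have "0 \<le> T" unfolding T_def by (rule cInf_greatest) (use \<open>P \<in> S\<close> in \<open>auto simp: S_def\<close>)
  have "\<exists>\<tau>\<in>S. \<tau> < T + 1 / real (Suc n)" for n
    using cInf_lessD[of S "T + 1 / real (Suc n)"] \<open>P \<in> S\<close> unfolding T_def by auto
  then obtain \<tau> where \<tau>: "\<And>n. \<tau> n \<in> S" "\<And>n. \<tau> n < T + 1 / real (Suc n)" by metis
  have ge: "T \<le> \<tau> n" for n unfolding T_def by (rule cInf_lower[OF \<tau>(1) bdd])
  have lim: "\<tau> \<longlonglongrightarrow> T"
  proof (rule tendsto_sandwich[OF _ _ tendsto_const])
    show "\<forall>\<^sub>F n in sequentially. \<tau> n \<le> T + 1 / real (Suc n)" using \<tau>(2) by (simp add: less_imp_le)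
    show "(\<lambda>n. T + 1 / real (Suc n)) \<longlonglongrightarrow> T"
      using LIMSEQ_inverse_real_of_nat_add[of T] by (simp add: inverse_eq_divide)
  qed (use ge in auto)
  have cont_at: "isCont U x" for x using cont by (simp add: continuous_on_eq_continuous_at)
  have per: "U (x + T) = U x" for x
  proof -
    have "(\<lambda>n. U (x + \<tau> n)) \<longlonglongrightarrow> U (x + T)"
      by (rule isCont_tendsto_compose[OF cont_at]) (intro tendsto_intros lim)
    moreover have "U (x + \<tau> n) = U x" for n using \<tau>(1) unfolding S_def by blast
    ultimately have "(\<lambda>n. U x) \<longlonglongrightarrow> U (x + T)" by simp
    then show ?thesis using LIMSEQ_unique[OF tendsto_const] by metis
  qed
  have "T \<noteq> 0"
  proof
    assume "T = 0"
    have "U a = U b"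
    proof -
      define z where "z n = a + of_int \<lfloor>(b - a) / \<tau> n\<rfloor> * \<tau> n" for n
      have \<tau>pos: "0 < \<tau> n" for n using \<tau>(1) unfolding S_def by blast
      have Uz: "U (z n) = U a" for n
        unfolding z_def by (rule periodic_int_shift) (use \<tau>(1) in \<open>simp add: S_def\<close>)
      have d: "0 \<le> b - z n \<and> b - z n \<le> \<tau> n" for n
        using floor_shift_in_period[OF \<tau>pos, of "b - a" n] unfolding z_def by auto
      have "(\<lambda>n. b - z n) \<longlonglongrightarrow> 0"
        by (rule tendsto_sandwich[OF _ _ tendsto_const lim[unfolded \<open>T = 0\<close>]]) (use d in auto)
      then have "z \<longlonglongrightarrow> b" using tendsto_diff[OF tendsto_const[of b]] by fastforce
      then have "(\<lambda>n. U (z n)) \<longlonglongrightarrow> U b" by (rule isCont_tendsto_compose[OF cont_at])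
      then show ?thesis unfolding Uz using LIMSEQ_unique[OF tendsto_const] by metis
    qed
    with nc show False by simp
  qed
  then have "0 < T" using \<open>0 \<le> T\<close> by simp
  moreover have "\<exists>x. U (x + \<sigma>) \<noteq> U x" if "0 < \<sigma>" "\<sigma> < T" for \<sigma>
  proof (rule ccontr)
    assume "\<nexists>x. U (x + \<sigma>) \<noteq> U x"
    then have "\<sigma> \<in> S" using that unfolding S_def by auto
    then show False using cInf_lower[OF _ bdd] that unfolding T_def by fastforce
  qed
  ultimately show ?thesis using per by blast
qed

lemma periodic_critical_point:
  fixes f :: "real \<Rightarrow> real"
  assumes "\<And>x. (f has_real_derivative f' x) (at x)" "0 < P" "f P = f 0"
  shows "\<exists>x. f' x = 0"
proof -
  obtain z where "f P - f 0 = (P - 0) * f' z" using MVT2[of 0 P f f'] assms by blast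
  then show ?thesis using assms by auto
qed

text \<open>Both equations integrate once. Eliminating \<open>u\<close> leaves the damped Newton equation
  \<open>\<epsilon>1 \<epsilon>2 v'' + s (\<epsilon>1 + \<epsilon>2) v' + p v + s\<^sup>2 v = const\<close>. Its energy is monotone and periodic, hence
  constant, so that \<open>s = 0\<close> or \<open>v' = 0\<close>; in the latter case the wave is constant. A
  zero of \<open>u'\<close> provides the rest point: there \<open>p v\<close> equals the constant of integration.\<close>

lemma periodic_wave_stationary:
  assumes eps: "0 < \<epsilon>1" "0 < \<epsilon>2" and p: "C2_fun p"
    and wave: "traveling_wave \<epsilon>1 \<epsilon>2 p s U"
    and per: "0 < P" "\<And>x. U (x + P) = U x" and nc: "U a \<noteq> U b"
  shows "s = 0 \<and> (\<exists>Um T. periodic_orbit \<epsilon>1 \<epsilon>2 p Um U T)"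
proof -
  obtain vx ux where W: "\<forall>x t.
        ((\<lambda>y. U (y - s * t) $ 1) has_real_derivative vx x t) (at x) \<and>
        ((\<lambda>y. U (y - s * t) $ 2) has_real_derivative ux x t) (at x) \<and>
        (\<exists>vt ut px vxx uxx.
           ((\<lambda>\<tau>. U (x - s * \<tau>) $ 1) has_real_derivative vt) (at t) \<and>
           ((\<lambda>\<tau>. U (x - s * \<tau>) $ 2) has_real_derivative ut) (at t) \<and>
           ((\<lambda>y. p (U (y - s * t) $ 1)) has_real_derivative px) (at x) \<and>
           ((\<lambda>y. vx y t) has_real_derivative vxx) (at x) \<and>
           ((\<lambda>y. ux y t) has_real_derivative uxx) (at x) \<and>
           vt - ux x t = \<epsilon>1 * vxx \<and> ut + px = \<epsilon>2 * uxx)"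
    using wave unfolding traveling_wave_def psystem_solution_def by blast
  define V Z V1 Z1 where "V x = U x $ 1" and "Z x = U x $ 2" and "V1 x = vx x 0" and "Z1 x = ux x 0" for x
  have V': "(V has_real_derivative V1 x) (at x)" and Z': "(Z has_real_derivative Z1 x) (at x)" for x
    using W[rule_format, of 0 x] unfolding V_def[abs_def] Z_def[abs_def] V1_def Z1_def by simp_all
  have "\<exists>V2 Z2. (V1 has_real_derivative V2) (at x) \<and> (Z1 has_real_derivative Z2) (at x) \<and>
      - s * V1 x - Z1 x = \<epsilon>1 * V2 \<and> - s * Z1 x + deriv p (V x) * V1 x = \<epsilon>2 * Z2" for x
  proof -
    obtain vt ut px vxx uxx where w: "((\<lambda>\<tau>. V (x - s * \<tau>)) has_real_derivative vt) (at 0)"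
      "((\<lambda>\<tau>. Z (x - s * \<tau>)) has_real_derivative ut) (at 0)"
      "((\<lambda>y. p (V y)) has_real_derivative px) (at x)"
      "(V1 has_real_derivative vxx) (at x)" "(Z1 has_real_derivative uxx) (at x)"
      "vt - Z1 x = \<epsilon>1 * vxx" "ut + px = \<epsilon>2 * uxx"
      using W[rule_format, of 0 x] unfolding V_def[abs_def] Z_def[abs_def] V1_def[abs_def] Z1_def[abs_def]
      by auto
    have chain: "((\<lambda>\<tau>. f (x - s * \<tau>)) has_real_derivative (f1 x * - s)) (at 0)"
      if "\<And>x. (f has_real_derivative f1 x) (at x)" for f f1
    proof -
      have "((\<lambda>\<tau>. x - s * \<tau>) has_real_derivative - s) (at 0)" by (auto intro!: derivative_eq_intros)
      moreover have "(f has_real_derivative f1 x) (at (x - s * 0))" using that[of x] by simp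
      ultimately show ?thesis by (rule DERIV_chain2[rotated])
    qed
    have "vt = V1 x * - s" by (rule DERIV_unique[OF w(1) chain[OF V']])
    moreover have "ut = Z1 x * - s" by (rule DERIV_unique[OF w(2) chain[OF Z']])
    moreover have "px = deriv p (V x) * V1 x"
      by (rule DERIV_unique[OF w(3) DERIV_chain2[OF C2_fun_derivs(1)[OF p] V']])
    ultimately show ?thesis using w(4-7) by (intro exI[of _ vxx] exI[of _ uxx]) (simp add: mult.commute)
  qed
  then obtain V2 Z2 where V1': "\<And>x. (V1 has_real_derivative V2 x) (at x)"
    and Z1': "\<And>x. (Z1 has_real_derivative Z2 x) (at x)"
    and e1: "\<And>x. - s * V1 x - Z1 x = \<epsilon>1 * V2 x"
    and e2: "\<And>x. - s * Z1 x + deriv p (V x) * V1 x = \<epsilon>2 * Z2 x"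
    by metis
  have perV: "V (x + P) = V x" and perZ: "Z (x + P) = Z x" for x
    unfolding V_def Z_def by (simp_all add: per)
  have perV1: "V1 (x + P) = V1 x" for x by (rule derivative_periodic[OF V' perV])
  have "((\<lambda>x. s * V x + Z x + \<epsilon>1 * V1 x) has_real_derivative 0) (at x)" for x
    by (auto intro!: derivative_eq_intros V' Z' V1') (use e1[of x] in \<open>simp add: algebra_simps\<close>)
  then obtain cA where cA: "\<And>x. s * V x + Z x + \<epsilon>1 * V1 x = cA"
    using constant_of_zero_derivative by blast
  have "((\<lambda>x. p (V x) - s * Z x - \<epsilon>2 * Z1 x) has_real_derivative 0) (at x)" for x
    by (auto intro!: derivative_eq_intros DERIV_chain2[OF C2_fun_derivs(1)[OF p]] V' Z' Z1')
       (use e2[of x] in \<open>simp add: algebra_simps\<close>)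
  then obtain cB where cB: "\<And>x. p (V x) - s * Z x - \<epsilon>2 * Z1 x = cB"
    using constant_of_zero_derivative by blast
  have "continuous_on UNIV p"
    by (rule has_real_derivative_imp_continuous_on[OF C2_fun_derivs(1)[OF p]])
  then obtain G where G: "\<And>x. (G has_real_derivative p x) (at x)" using antiderivative_on_line by blast
  define E where "E x = \<epsilon>1 * \<epsilon>2 * (V1 x)\<^sup>2 / 2 + G (V x) + s\<^sup>2 * (V x)\<^sup>2 / 2 - (s * cA + cB) * V x" for x
  have E': "(E has_real_derivative (- s * (\<epsilon>1 + \<epsilon>2)) * (V1 x)\<^sup>2) (at x)" for x
  proof -
    have "(E has_real_derivative (V1 x * (\<epsilon>1 * \<epsilon>2 * V2 x + p (V x) + s\<^sup>2 * V x - (s * cA + cB)))) (at x)"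
      unfolding E_def
      by (auto intro!: derivative_eq_intros V' V1' DERIV_chain2[OF G] simp: algebra_simps power2_eq_square)
    moreover have "\<epsilon>1 * \<epsilon>2 * V2 x + p (V x) + s\<^sup>2 * V x - (s * cA + cB) = - s * (\<epsilon>1 + \<epsilon>2) * V1 x"
    proof -
      have "\<epsilon>2 * (\<epsilon>1 * V2 x) = \<epsilon>2 * (- s * V1 x - Z1 x)" by (simp only: e1)
      moreover have "s * (s * V x + Z x + \<epsilon>1 * V1 x) = s * cA" by (simp add: cA)
      ultimately show ?thesis using cB[of x] by (simp add: algebra_simps power2_eq_square)
    qed
    ultimately show ?thesis by (simp add: power2_eq_square mult_ac)
  qed
  have "s = 0"
  proof (rule ccontr)
    assume "s \<noteq> 0"
    have V1_0: "V1 x = 0" for x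
    proof -
      have "E (x + P) = E x" unfolding E_def perV perV1 ..
      then have "((\<lambda>x. (- s * (\<epsilon>1 + \<epsilon>2)) * (V1 x)\<^sup>2) has_integral 0) {x..x + P}"
        using has_integral_of_derivative[OF E', of x "x + P"] per(1) by simp
      from has_integral_mult_right[OF this, of "1 / (- s * (\<epsilon>1 + \<epsilon>2))"]
      have "((\<lambda>x. (V1 x)\<^sup>2) has_integral 0) (cbox x (x + P))"
        using \<open>s \<noteq> 0\<close> eps by simp
      then have "(V1 x)\<^sup>2 = 0"
        by (rule has_integral_0_cbox_imp_0[rotated 2])
           (use per(1) in \<open>auto intro!: continuous_intros has_real_derivative_imp_continuous_on[OF V1']\<close>)
      then show ?thesis by simp
    qed
    have V_ab: "V a = V b" by (rule constant_of_zero_derivative) (use V' V1_0 in simp)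
    have "Z a = Z b" using cA[of a] cA[of b] V_ab V1_0 by simp
    with V_ab have "U a = U b" unfolding V_def Z_def by (simp add: vec_eq_iff forall_2)
    with nc show False by simp
  qed
  obtain z where z: "Z1 z = 0"
    using periodic_critical_point[OF Z' per(1)] perZ[of 0] by auto
  define Um :: "real^2" where "Um = vector [V z, cA]"
  have Z_eq: "Z x - cA = - \<epsilon>1 * V1 x" and Z1_eq: "p (V x) - p (V z) = \<epsilon>2 * Z1 x" for x
    using cA[of x] cB[of x] cB[of z] z \<open>s = 0\<close> by simp_all
  have U': "(U has_vector_derivative vector [V1 x, Z1 x]) (at x)" for x
    by (rule has_vector_derivative_vec2) (use V' Z' in \<open>simp_all add: V_def[abs_def] Z_def[abs_def]\<close>)
  have "profile_ode \<epsilon>1 \<epsilon>2 p Um 0 U"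
    unfolding profile_ode_def
  proof (intro allI exI conjI)
    show "(U has_vector_derivative vector [V1 x, Z1 x]) (at x)" for x by (rule U')
    show "visc \<epsilon>1 \<epsilon>2 *v vector [V1 x, Z1 x] = flux p (U x) - flux p Um - 0 *\<^sub>R (U x - Um)" for x
      using Z_eq[of x] Z1_eq[of x]
      by (simp add: visc_mult flux_def Um_def vec_eq_iff forall_2 V_def Z_def)
  qed
  moreover have "continuous_on UNIV U"
    by (intro continuous_at_imp_continuous_on ballI has_vector_derivative_continuous[OF U'])
  from minimal_period[OF this per nc] obtain T where "0 < T" "\<forall>x. U (x + T) = U x"
    "\<forall>\<tau>. 0 < \<tau> \<and> \<tau> < T \<longrightarrow> (\<exists>x. U (x + \<tau>) \<noteq> U x)" by blast
  ultimately have "periodic_orbit \<epsilon>1 \<epsilon>2 p Um U T" unfolding periodic_orbit_def by blast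
  with \<open>s = 0\<close> show ?thesis by blast
qed

text \<open>Gronwall: the logarithmic derivative of \<open>\<phi>\<^sup>2 + \<phi>'\<^sup>2\<close> is bounded by \<open>1 + M\<close>, so multiplying with
  \<open>exp (\<mp> (1 + M) x)\<close> gives a monotone function in each direction from \<open>a\<close>.\<close>

lemma linear_ode_zero:
  fixes \<phi> \<phi>1 m :: "real \<Rightarrow> real"
  assumes \<phi>: "\<And>x. (\<phi> has_real_derivative \<phi>1 x) (at x)"
    and \<phi>1: "\<And>x. (\<phi>1 has_real_derivative (m x * \<phi> x)) (at x)"
    and M: "\<And>x. \<bar>m x\<bar> \<le> M" and zero: "\<phi> a = 0" "\<phi>1 a = 0"
  shows "\<phi> x = 0"
proof -
  define k where "k = 1 + M"
  define E where "E y = (\<phi> y)\<^sup>2 + (\<phi>1 y)\<^sup>2" for y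
  define D where "D y = 2 * \<phi> y * \<phi>1 y * (1 + m y)" for y
  have E': "(E has_real_derivative D y) (at y)" for y
    unfolding E_def D_def by (auto intro!: derivative_eq_intros \<phi> \<phi>1 simp: algebra_simps)
  have bound: "\<bar>D y\<bar> \<le> k * E y" for y
  proof -
    have "\<bar>1 + m y\<bar> \<le> k" unfolding k_def using M[of y] by linarith
    moreover have "\<bar>2 * \<phi> y * \<phi>1 y\<bar> \<le> E y"
      unfolding E_def using zero_le_power2[of "\<phi> y - \<phi>1 y"] zero_le_power2[of "\<phi> y + \<phi>1 y"]
      by (simp add: abs_le_iff power2_eq_square algebra_simps)
    ultimately have "\<bar>2 * \<phi> y * \<phi>1 y\<bar> * \<bar>1 + m y\<bar> \<le> E y * k" by (intro mult_mono) auto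
    moreover have "\<bar>D y\<bar> = \<bar>2 * \<phi> y * \<phi>1 y\<bar> * \<bar>1 + m y\<bar>" unfolding D_def by (rule abs_mult)
    ultimately show ?thesis by (simp add: mult.commute)
  qed
  have "E x \<le> 0"
  proof (cases "a \<le> x")
    case True
    have "E x * exp (- k * x) \<le> E a * exp (- k * a)"
    proof (rule DERIV_nonpos_imp_nonincreasing[OF True, where f = "\<lambda>y. E y * exp (- k * y)"])
      fix y
      have "((\<lambda>y. E y * exp (- k * y)) has_real_derivative ((D y - k * E y) * exp (- k * y))) (at y)"
        by (auto intro!: derivative_eq_intros E' simp: algebra_simps)
      moreover have "(D y - k * E y) * exp (- k * y) \<le> 0"
        using bound[of y] by (intro mult_nonpos_nonneg) auto
      ultimately show "\<exists>z. ((\<lambda>y. E y * exp (- k * y)) has_real_derivative z) (at y) \<and> z \<le> 0" by blast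
    qed
    then show ?thesis using zero by (simp add: E_def[of a] mult_le_0_iff)
  next
    case False
    then have "x \<le> a" by simp
    have "E x * exp (k * x) \<le> E a * exp (k * a)"
    proof (rule DERIV_nonneg_imp_nondecreasing[OF \<open>x \<le> a\<close>, where f = "\<lambda>y. E y * exp (k * y)"])
      fix y
      have "((\<lambda>y. E y * exp (k * y)) has_real_derivative ((D y + k * E y) * exp (k * y))) (at y)"
        by (auto intro!: derivative_eq_intros E' simp: algebra_simps)
      moreover have "0 \<le> (D y + k * E y) * exp (k * y)"
        using bound[of y] by (intro mult_nonneg_nonneg) auto
      ultimately show "\<exists>z. ((\<lambda>y. E y * exp (k * y)) has_real_derivative z) (at y) \<and> 0 \<le> z" by blast
    qed
    then show ?thesis using zero by (simp add: E_def[of a] mult_le_0_iff)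
  qed
  then show ?thesis unfolding E_def by (simp add: sum_power2_le_zero_iff)
qed

section \<open>Instability of periodic orbits\<close>

lemma has_derivative_shift:
  fixes f :: "real \<Rightarrow> real"
  assumes "\<And>x. (f has_real_derivative f' x) (at x)"
  shows "((\<lambda>x. f (x + a)) has_real_derivative f' (x + a)) (at x)"
  using assms[of "x + a"] DERIV_shift by blast

text \<open>With \<open>\<phi> = V'\<close> for the first component \<open>V\<close> of the orbit, \<open>\<phi>\<close> solves \<open>\<epsilon> \<phi>'' + p'(V) \<phi> = 0\<close> and has
  a zero \<open>a\<close>. The zero is simple, as otherwise \<open>\<phi>\<close> vanishes identically and the orbit is a
  rest point. After a translation by \<open>a\<close> the pencil has an eigenfunction \<open>f = w'\<close> with eigenvalue
  \<open>\<mu> > 0\<close>; then \<open>v = f\<close> and \<open>u = \<mu> w - \<epsilon>1 f'\<close> solve the linearized system.\<close>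

lemma periodic_orbit_spectrally_unstable:
  assumes eps: "0 < \<epsilon>1" "0 < \<epsilon>2" and p: "C2_fun p"
    and orbit: "periodic_orbit \<epsilon>1 \<epsilon>2 p Um U T"
  shows "spectrally_unstable \<epsilon>1 \<epsilon>2 p U"
proof -
  have ode: "profile_ode \<epsilon>1 \<epsilon>2 p Um 0 U" and T: "0 < T" and per: "\<And>x. U (x + T) = U x"
    and minimal: "\<And>\<tau>. 0 < \<tau> \<Longrightarrow> \<tau> < T \<Longrightarrow> \<exists>x. U (x + \<tau>) \<noteq> U x"
    using orbit unfolding periodic_orbit_def by blast+
  define \<epsilon> where "\<epsilon> = \<epsilon>1 * \<epsilon>2"
  have \<epsilon>: "0 < \<epsilon>" using eps by (simp add: \<epsilon>_def)
  define V where "V x = U x $ 1" for x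
  define \<phi> where "\<phi> x = - (U x $ 2 - Um $ 2) / \<epsilon>1" for x
  define \<phi>1 where "\<phi>1 x = - (p (V x) - p (Um $ 1)) / \<epsilon>" for x
  define \<kappa> where "\<kappa> x = deriv p (V x)" for x
  define \<kappa>1 where "\<kappa>1 x = deriv (deriv p) (V x) * \<phi> x" for x
  have V': "(V has_real_derivative \<phi> x) (at x)" for x
    unfolding V_def[abs_def] \<phi>_def by (rule profile_components(1)[OF ode eps])
  have \<phi>': "(\<phi> has_real_derivative \<phi>1 x) (at x)" for x
    unfolding \<phi>_def[abs_def] \<phi>1_def V_def \<epsilon>_def using eps
    by (auto intro!: derivative_eq_intros profile_components(2)[OF ode eps] simp: field_simps)
  have \<phi>1': "(\<phi>1 has_real_derivative (- \<kappa> x * \<phi> x / \<epsilon>)) (at x)" for x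
    unfolding \<phi>1_def[abs_def] \<kappa>_def using \<epsilon>
    by (auto intro!: derivative_eq_intros DERIV_chain2[OF C2_fun_derivs(1)[OF p]] V')
  have \<kappa>': "(\<kappa> has_real_derivative \<kappa>1 x) (at x)" for x
    unfolding \<kappa>_def[abs_def] \<kappa>1_def by (rule DERIV_chain2[OF C2_fun_derivs(2)[OF p] V'])
  have V_per: "V (x + T) = V x" and \<phi>_per: "\<phi> (x + T) = \<phi> x" and \<kappa>_per: "\<kappa> (x + T) = \<kappa> x"
    and \<kappa>1_per: "\<kappa>1 (x + T) = \<kappa>1 x" for x
    unfolding V_def \<phi>_def \<kappa>_def \<kappa>1_def by (simp_all add: per)
  have \<kappa>_cont: "continuous_on S \<kappa>" for S by (rule has_real_derivative_imp_continuous_on[OF \<kappa>'])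
  have \<kappa>1_cont: "continuous_on S \<kappa>1" for S
    unfolding \<kappa>1_def[abs_def]
    by (intro continuous_intros continuous_on_compose2[OF C2_fun_derivs(3)[OF p, of UNIV]]
        has_real_derivative_imp_continuous_on[OF V'] has_real_derivative_imp_continuous_on[OF \<phi>']) auto
  obtain K where K: "0 \<le> K" "\<And>x. \<bar>\<kappa> x\<bar> \<le> K"
    using periodic_bounded[OF T \<kappa>_per \<kappa>_cont] by blast
  obtain a where a: "\<phi> a = 0"
    using periodic_critical_point[OF V' T] V_per[of 0] by auto
  have "\<phi>1 a \<noteq> 0"
  proof
    assume "\<phi>1 a = 0"
    have "\<phi> x = 0" for x
    proof (rule linear_ode_zero[OF \<phi>' _ _ a \<open>\<phi>1 a = 0\<close>])
      show "(\<phi>1 has_real_derivative (- \<kappa> x / \<epsilon>) * \<phi> x) (at x)" for x using \<phi>1' by simp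
      show "\<bar>- \<kappa> x / \<epsilon>\<bar> \<le> K / \<epsilon>" for x using K \<epsilon> by (simp add: divide_right_mono)
    qed
    then have "U x $ 2 = Um $ 2" "(V has_real_derivative 0) (at x)" for x
      using V'[of x] eps unfolding \<phi>_def by (auto simp: field_simps)
    then have "U x = U y" for x y
      using constant_of_zero_derivative[of V x y] by (simp add: vec_eq_iff forall_2 V_def)
    then show False using minimal[of "T / 2"] T by auto
  qed
  define q where "q x = \<kappa> (x + a)" for x
  interpret antiperiodic_pencil T \<epsilon> "\<epsilon>1 + \<epsilon>2" K q
  proof
    show "continuous_on UNIV q"
      unfolding q_def[abs_def] by (intro continuous_on_compose2[OF \<kappa>_cont[of UNIV]] continuous_intros) auto
    show "q (x + T) = q x" for x unfolding q_def using \<kappa>_per[of "x + a"] by (simp add: add_ac)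
    show "\<bar>q x\<bar> \<le> K" for x unfolding q_def by (rule K)
  qed (use T \<epsilon> eps in auto)
  have "\<exists>h. AP h \<and> pencil_form 0 h h < 0"
  proof (rule negative_direction)
    show "((\<lambda>x. \<phi> (x + a)) has_real_derivative \<phi>1 (x + a)) (at x)" for x
      by (rule has_derivative_shift[OF \<phi>'])
    show "((\<lambda>x. \<phi>1 (x + a)) has_real_derivative (- q x * \<phi> (x + a) / \<epsilon>)) (at x)" for x
      unfolding q_def by (rule has_derivative_shift[OF \<phi>1'])
    show "\<phi> (x + T + a) = \<phi> (x + a)" for x using \<phi>_per[of "x + a"] by (simp add: add_ac)
  qed (use a \<open>\<phi>1 a \<noteq> 0\<close> in auto)
  then obtain h0 where h0: "AP h0" "pencil_form 0 h0 h0 < 0" by blast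
  obtain \<mu> f h where \<mu>: "0 < \<mu>" and f: "AP f" and h: "AP h" and nz: "\<exists>x. f x \<noteq> 0"
    and f': "\<And>x. (f has_real_derivative h x) (at x)"
    and h': "\<And>x. (h has_real_derivative (pencil_lower \<mu> f x / \<epsilon>)) (at x)"
    using pencil_eigenfunction[OF h0] by blast
  define L where "L x = pencil_lower \<mu> f x / \<epsilon>" for x
  define L1 where "L1 x = (- \<mu>\<^sup>2 * J f x + (\<mu> * (\<epsilon>1 + \<epsilon>2) - q x) * h x - \<kappa>1 (x + a) * f x) / \<epsilon>" for x
  have q': "(q has_real_derivative \<kappa>1 (x + a)) (at x)" for x
    unfolding q_def[abs_def] by (rule has_derivative_shift[OF \<kappa>'])
  have Jf': "(J f has_real_derivative f x) (at x)" and JJf': "(J (J f) has_real_derivative J f x) (at x)" for x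
    using has_derivative_prim f AP_J by blast+
  have h'': "(h has_real_derivative L x) (at x)" for x unfolding L_def by (rule h')
  have L': "(L has_real_derivative L1 x) (at x)" for x
    unfolding L_def[abs_def] L1_def pencil_lower_def
    by (rule DERIV_cdivide) (auto intro!: derivative_eq_intros q' Jf' JJf' f' simp: algebra_simps)
  define u where "u x = \<mu> * J f x - \<epsilon>1 * h x" for x
  define u1 where "u1 x = \<mu> * f x - \<epsilon>1 * L x" for x
  define u2 where "u2 x = \<mu> * h x - \<epsilon>1 * L1 x" for x
  have u': "(u has_real_derivative u1 x) (at x)" "(u1 has_real_derivative u2 x) (at x)" for x
    unfolding u_def[abs_def] u1_def[abs_def] u2_def
    by (auto intro!: derivative_eq_intros Jf' f' h'' L')
  have shift: "((\<lambda>x. F (x + - a)) has_real_derivative F' (x + - a)) (at x)"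
    if "\<And>x. (F has_real_derivative F' x) (at x)" for F F' x
    by (rule has_derivative_shift[OF that])
  have shift_cont: "continuous_on UNIV (\<lambda>x. F (x + - a))" if "continuous_on UNIV F" for F :: "real \<Rightarrow> real"
    by (rule continuous_on_compose2[OF that]) (auto intro!: continuous_intros)
  have L_cont: "continuous_on UNIV L" by (rule has_real_derivative_imp_continuous_on[OF L'])
  have L1_cont: "continuous_on UNIV L1"
    unfolding L1_def[abs_def] using \<epsilon>
    by (auto intro!: continuous_intros antiperiodic_continuous[OF f] antiperiodic_continuous[OF h]
        antiperiodic_continuous[OF AP_J[OF f]] q_continuous continuous_on_compose2[OF \<kappa>1_cont[of UNIV]])
  have u2_cont: "continuous_on UNIV u2"
    unfolding u2_def[abs_def] by (intro continuous_intros antiperiodic_continuous[OF h] L1_cont)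
  have double: "F (x + 2 * T + - a) = F (x + - a)" if "AP F" for F x
  proof -
    have "x + 2 * T + - a = (x + - a + T) + T" by simp
    then show ?thesis by (simp only: antiperiodic_shift[OF that] minus_minus)
  qed
  have "complex_of_real \<mu> \<in> lin_spectrum \<epsilon>1 \<epsilon>2 p U q'" if "1 \<le> q'" for q'
  proof -
    obtain y where y: "f y \<noteq> 0" using nz by blast
    show ?thesis
    proof (rule eigenfunction_in_spectrum[OF shift[OF f'] shift[OF h''] shift[OF u'(1)] shift[OF u'(2)]])
      show "((\<lambda>x. deriv p (U x $ 1)) has_real_derivative \<kappa>1 x) (at x)" for x
        using \<kappa>' unfolding \<kappa>_def[abs_def] V_def .
      show "continuous_on UNIV (\<lambda>x. L (x + - a))" by (rule shift_cont[OF L_cont])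
      show "continuous_on UNIV (\<lambda>x. u2 (x + - a))"
        by (rule shift_cont[OF u2_cont])
      show "\<mu> * f (x + - a) = \<epsilon>1 * L (x + - a) + u1 (x + - a)" for x unfolding u1_def by simp
      show "\<mu> * u (x + - a) = \<epsilon>2 * u2 (x + - a) - (\<kappa>1 x * f (x + - a) + deriv p (U x $ 1) * h (x + - a))" for x
      proof -
        define y where "y = x + - a"
        have "x = y + a" unfolding y_def by simp
        then have kq: "deriv p (U x $ 1) = q y" "\<kappa>1 x = \<kappa>1 (y + a)" unfolding q_def \<kappa>_def V_def by simp_all
        have "\<epsilon>2 * (\<epsilon>1 * L1 y) = - \<mu>\<^sup>2 * J f y + (\<mu> * (\<epsilon>1 + \<epsilon>2) - q y) * h y - \<kappa>1 (y + a) * f y"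
          unfolding L1_def \<epsilon>_def using eps by simp
        then show ?thesis
          unfolding kq y_def[symmetric] u_def u2_def by (simp add: algebra_simps power2_eq_square)
      qed
      show "f (x + 2 * T + - a) = f (x + - a)" for x by (rule double[OF f])
      show "u (x + 2 * T + - a) = u (x + - a)" for x
        unfolding u_def using double[OF AP_J[OF f]] double[OF h] by simp
      show "U (x + 2 * T) = U x" for x
      proof -
        have "x + 2 * T = (x + T) + T" by simp
        then show ?thesis by (simp only: per)
      qed
      show "f (y + a + - a) \<noteq> 0 \<or> u (y + a + - a) \<noteq> 0" using y by simp
    qed (use T eps that in auto)
  qed
  with \<mu> show ?thesis
    unfolding spectrally_unstable_def by (intro allI impI bexI[of _ "complex_of_real \<mu>"]) auto
qed

theorem theorem7p1:
  fixes \<epsilon>1 \<epsilon>2 :: real and p :: "real \<Rightarrow> real"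
  assumes eps: "0 < \<epsilon>1" "0 < \<epsilon>2"
    and p_C2: "C2_fun p"
    and p_nonmonotone: "\<not> mono p" "\<not> antimono p"
  shows
    "(\<forall>s U. traveling_wave \<epsilon>1 \<epsilon>2 p s U \<and> (\<exists>P>0. \<forall>x. U (x + P) = U x) \<and> (\<exists>x y. U x \<noteq> U y)
        \<longrightarrow> s = 0 \<and> (\<exists>Um T. periodic_orbit \<epsilon>1 \<epsilon>2 p Um U T))
     \<and> (\<forall>Um. hamiltonian_field (stat_field \<epsilon>1 \<epsilon>2 p Um))
     \<and> (\<forall>Um. deriv p (Um $ 1) \<noteq> 0 \<longrightarrow>
          \<comment> \<open>(a)\<close>
          (\<forall>U T d. periodic_orbit \<epsilon>1 \<epsilon>2 p Um U T \<and> has_period_deriv \<epsilon>1 \<epsilon>2 p Um U d \<and> 0 < d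
             \<longrightarrow> spectrally_unstable \<epsilon>1 \<epsilon>2 p U)
        \<and> (\<forall>\<Gamma> l r W \<tau>.
             (homoclinic_cycle \<epsilon>1 \<epsilon>2 p Um \<Gamma> \<or> heteroclinic_two_cycle \<epsilon>1 \<epsilon>2 p Um \<Gamma>)
             \<and> nested_family_bounded_by \<epsilon>1 \<epsilon>2 p Um \<Gamma> l r W \<tau>
             \<longrightarrow> (\<exists>\<delta>>0. \<forall>a\<in>{l<..<r}. hausdorff_close \<delta> (range (W a)) \<Gamma>
                    \<longrightarrow> spectrally_unstable \<epsilon>1 \<epsilon>2 p (W a)))
          \<comment> \<open>(b)\<close>
        \<and> (\<forall>U T d M. periodic_orbit \<epsilon>1 \<epsilon>2 p Um U T \<and> has_period_deriv \<epsilon>1 \<epsilon>2 p Um U d \<and> d < 0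
             \<and> has_mass_deriv \<epsilon>1 \<epsilon>2 p Um U T M \<and> invertible M
             \<and> \<not> eigvals (matrix_inv M ** dflux p Um) \<subseteq> \<real>
             \<longrightarrow> spectrally_unstable \<epsilon>1 \<epsilon>2 p U)
          \<comment> \<open>(c)\<close>
        \<and> (\<forall>R l r W \<tau>.
             nonlinear_center \<epsilon>1 \<epsilon>2 p Um R \<and> family_shrinking_to \<epsilon>1 \<epsilon>2 p Um R l r W \<tau>
             \<longrightarrow> (\<exists>\<delta>>0. \<forall>a\<in>{l<..<r}. range (W a) \<subseteq> ball R \<delta>
                    \<longrightarrow> spectrally_unstable \<epsilon>1 \<epsilon>2 p (W a))))"
proof (intro conjI allI impI)
  note unstable = periodic_orbit_spectrally_unstable[OF eps p_C2]
  show "s = 0" "\<exists>Um T. periodic_orbit \<epsilon>1 \<epsilon>2 p Um U T"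
    if "traveling_wave \<epsilon>1 \<epsilon>2 p s U \<and> (\<exists>P>0. \<forall>x. U (x + P) = U x) \<and> (\<exists>x y. U x \<noteq> U y)" for s U
    using that periodic_wave_stationary[OF eps p_C2, of s U] by blast+
  show "hamiltonian_field (stat_field \<epsilon>1 \<epsilon>2 p Um)" for Um
    by (rule hamiltonian_stat_field[OF eps p_C2])
  show "spectrally_unstable \<epsilon>1 \<epsilon>2 p U"
    if "periodic_orbit \<epsilon>1 \<epsilon>2 p Um U T \<and> has_period_deriv \<epsilon>1 \<epsilon>2 p Um U d \<and> 0 < d" for Um U T d
    using that unstable by blast
  show "spectrally_unstable \<epsilon>1 \<epsilon>2 p U"
    if "periodic_orbit \<epsilon>1 \<epsilon>2 p Um U T \<and> has_period_deriv \<epsilon>1 \<epsilon>2 p Um U d \<and> d < 0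
        \<and> has_mass_deriv \<epsilon>1 \<epsilon>2 p Um U T M \<and> invertible M
        \<and> \<not> eigvals (matrix_inv M ** dflux p Um) \<subseteq> \<real>" for Um U T d M
    using that unstable by blast
  (* the members of both families are periodic orbits, so that any distance serves as a threshold *)
  show "\<exists>\<delta>>0. \<forall>a\<in>{l<..<r}. hausdorff_close \<delta> (range (W a)) \<Gamma> \<longrightarrow> spectrally_unstable \<epsilon>1 \<epsilon>2 p (W a)"
    if "(homoclinic_cycle \<epsilon>1 \<epsilon>2 p Um \<Gamma> \<or> heteroclinic_two_cycle \<epsilon>1 \<epsilon>2 p Um \<Gamma>)
        \<and> nested_family_bounded_by \<epsilon>1 \<epsilon>2 p Um \<Gamma> l r W \<tau>" for Um \<Gamma> l r W \<tau>
    using that unstable unfolding nested_family_bounded_by_def by (intro exI[of _ 1]) auto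
  show "\<exists>\<delta>>0. \<forall>a\<in>{l<..<r}. range (W a) \<subseteq> ball R \<delta> \<longrightarrow> spectrally_unstable \<epsilon>1 \<epsilon>2 p (W a)"
    if "nonlinear_center \<epsilon>1 \<epsilon>2 p Um R \<and> family_shrinking_to \<epsilon>1 \<epsilon>2 p Um R l r W \<tau>" for Um R l r W \<tau>
    using that unstable unfolding family_shrinking_to_def by (intro exI[of _ 1]) auto
qed

end
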